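(* Let $X$ and $Y$ be complex infinite-dimensional Banach spaces, and let $A\in B(X)$ and $B\in B(Y)$. For $C\in B(Y,X)$ let $M_C=\begin{pmatrix}A&C\\0&B\end{pmatrix}\in B(X\oplus Y)$. Then $$\bigcap_{C\in B(Y,X)}\sigma_b(M_C)=\sigma_{lb}(A)\cup\sigma_{rb}(B)\cup\{\lambda\in\mathbb{C}: N(A-\lambda)\times N(B-\lambda)\not\cong X/R(A-\lambda)\times Y/R(B-\lambda)\}.$$
   Context: $B(Y,X)$ is the set of bounded linear operators from $Y$ to $X$, and $B(X)=B(X,X)$. For an operator $T$, $N(T)$ is its kernel and $R(T)$ its range. For $T\in B(Z)$ with $Z$ a Banach space, $\alpha(T)=\dim N(T)$ and $\beta(T)=\dim Z/R(T)$; $asc(T)=\inf\{k\ge 0:N(T^k)=N(T^{k+1})\}$ and $des(T)=\inf\{k\ge 0:R(T^k)=R(T^{k+1})\}$ (equal to $\infty$ if no such $k$ exists). $T$ is Fredholm if $\alpha(T)<\infty$ and $\beta(T)<\infty$. $T$ is Browder if it is Fredholm and $asc(T)=des(T)<\infty$. $T$ is left semi-Fredholm if $R(T)$ is a closed and complemented subspace of $Z$ and $\alpha(T)<\infty$; $T$ is right semi-Fredholm if $N(T)$ is a closed and complemented subspace of $Z$ and $\beta(T)<\infty$. $T$ is left semi-Browder if it is left semi-Fredholm and $asc(T)<\infty$; $T$ is right semi-Browder if it is right semi-Fredholm and $des(T)<\infty$. The Browder spectrum $\sigma_b(T)$, left semi-Browder spectrum $\sigma_{lb}(T)$ and right semi-Browder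 spectrum $\sigma_{rb}(T)$ are the sets of $\lambda\in\mathbb{C}$ for which $T-\lambda$ is not Browder, not left semi-Browder, and not right semi-Browder, respectively. The symbol $\cong$ denotes isomorphism (linear homeomorphism) of Banach spaces. For $\lambda\notin\sigma_{lb}(A)\cup\sigma_{rb}(B)$ the ranges $R(A-\lambda)$ and $R(B-\lambda)$ are closed, so the quotients are Banach spaces; for the other $\lambda$ the third set does not affect the union. *)

theory Defs
  imports "HOL-Analysis.Analysis" "HOL-Library.Extended_Nat"
begin

section \<open>Complex Banach spaces\<close>

class complex_normed_vector = real_normed_vector +
  fixes scaleC :: "complex \<Rightarrow> 'a \<Rightarrow> 'a"  (infixr "*\<^sub>C" 75)
  assumes scaleC_add_right: "c *\<^sub>C (x + y) = c *\<^sub>C x + c *\<^sub>C y"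
    and scaleC_add_left: "(c + d) *\<^sub>C x = c *\<^sub>C x + d *\<^sub>C x"
    and scaleC_scaleC: "c *\<^sub>C (d *\<^sub>C x) = (c * d) *\<^sub>C x"
    and scaleC_one: "1 *\<^sub>C x = x"
    and scaleR_scaleC: "r *\<^sub>R x = complex_of_real r *\<^sub>C x"
    and norm_scaleC: "norm (c *\<^sub>C x) = cmod c * norm x"

class complex_banach = complex_normed_vector + banach

global_interpretation complex_vector: vector_space "scaleC :: complex \<Rightarrow> 'a \<Rightarrow> 'a::complex_normed_vector"
  by unfold_locales
    (simp_all add: scaleC_add_right scaleC_add_left scaleC_scaleC scaleC_one)

text \<open>The direct sum of two complex Banach spaces is the product type, with the library's
  (Euclidean) product norm.\<close>

instantiation prod :: (complex_normed_vector, complex_normed_vector) complex_normed_vector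
begin

definition scaleC_prod :: "complex \<Rightarrow> 'a \<times> 'b \<Rightarrow> 'a \<times> 'b" where
  "scaleC_prod c p = (c *\<^sub>C fst p, c *\<^sub>C snd p)"

instance
proof
  fix c d :: complex and x y :: "'a \<times> 'b" and r :: real
  show "c *\<^sub>C (x + y) = c *\<^sub>C x + c *\<^sub>C y"
    by (simp add: scaleC_prod_def scaleC_add_right)
  show "(c + d) *\<^sub>C x = c *\<^sub>C x + d *\<^sub>C x"
    by (simp add: scaleC_prod_def scaleC_add_left)
  show "c *\<^sub>C d *\<^sub>C x = (c * d) *\<^sub>C x"
    by (simp add: scaleC_prod_def scaleC_scaleC)
  show "1 *\<^sub>C x = x"
    by (simp add: scaleC_prod_def scaleC_one)
  show "r *\<^sub>R x = complex_of_real r *\<^sub>C x"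
    by (simp add: scaleC_prod_def scaleR_prod_def scaleR_scaleC)
  show "norm (c *\<^sub>C x) = cmod c * norm x"
    by (simp add: scaleC_prod_def norm_prod_def norm_scaleC power_mult_distrib
        real_sqrt_mult flip: distrib_left)
qed

end

instance prod :: (complex_banach, complex_banach) complex_banach ..

definition bounded_clinear ::
    "('a::complex_normed_vector \<Rightarrow> 'b::complex_normed_vector) \<Rightarrow> bool" where
  "bounded_clinear T \<longleftrightarrow>
     Vector_Spaces.linear (*\<^sub>C) (*\<^sub>C) T \<and> (\<exists>K. \<forall>x. norm (T x) \<le> K * norm x)"

section \<open>Kernels, quotients and products as complex normed spaces\<close>

text \<open>Kernels and quotients depend on an operator and so are not types; they are
  represented by records with an explicit carrier.\<close>

record 'v cspace =
  carr :: "'v set"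
  vzero :: 'v
  vadd :: "'v \<Rightarrow> 'v \<Rightarrow> 'v"
  vscale :: "complex \<Rightarrow> 'v \<Rightarrow> 'v"
  vnorm :: "'v \<Rightarrow> real"

definition sub_space :: "'a::complex_normed_vector set \<Rightarrow> 'a cspace" where
  "sub_space M =
     \<lparr>carr = M, vzero = 0, vadd = (+), vscale = (*\<^sub>C), vnorm = norm\<rparr>"

text \<open>The elements of \<open>quot_space M\<close> are the cosets \<open>x + M\<close>. The norm of a coset is the
  distance of the coset to \<open>0\<close>; it is a norm (and not only a seminorm) precisely when the
  subspace \<open>M\<close> is closed.\<close>

definition quot_space :: "'a::complex_normed_vector set \<Rightarrow> 'a set cspace" where
  "quot_space M =
     \<lparr>carr = UNIV // {(x, y). x - y \<in> M},
      vzero = M,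
      vadd = (\<lambda>P Q. {p + q | p q. p \<in> P \<and> q \<in> Q}),
      vscale = (\<lambda>c P. {c *\<^sub>C p + m | p m. p \<in> P \<and> m \<in> M}),
      vnorm = (\<lambda>P. INF p\<in>P. norm p)\<rparr>"

definition prod_space :: "'v cspace \<Rightarrow> 'w cspace \<Rightarrow> ('v \<times> 'w) cspace"  (infixr "\<times>\<^sub>V" 80) where
  "V \<times>\<^sub>V W =
     \<lparr>carr = carr V \<times> carr W,
      vzero = (vzero V, vzero W),
      vadd = (\<lambda>p q. (vadd V (fst p) (fst q), vadd W (snd p) (snd q))),
      vscale = (\<lambda>c p. (vscale V c (fst p), vscale W c (snd p))),
      vnorm = (\<lambda>p. sqrt ((vnorm V (fst p))\<^sup>2 + (vnorm W (snd p))\<^sup>2))\<rparr>"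

definition isomorphic_spaces :: "'v cspace \<Rightarrow> 'w cspace \<Rightarrow> bool"  (infix "\<cong>\<^sub>V" 50) where
  "V \<cong>\<^sub>V W \<longleftrightarrow> (\<exists>f.
     bij_betw f (carr V) (carr W) \<and>
     (\<forall>x\<in>carr V. \<forall>y\<in>carr V. f (vadd V x y) = vadd W (f x) (f y)) \<and>
     (\<forall>c. \<forall>x\<in>carr V. f (vscale V c x) = vscale W c (f x)) \<and>
     (\<exists>K. \<forall>x\<in>carr V. vnorm W (f x) \<le> K * vnorm V x) \<and>
     (\<exists>K. \<forall>x\<in>carr V. vnorm V x \<le> K * vnorm W (f x)))"

subsection \<open>Dimension\<close>

definition lincomb :: "'v cspace \<Rightarrow> complex list \<Rightarrow> 'v list \<Rightarrow> 'v" where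
  "lincomb V cs vs = foldr (\<lambda>(c, v). vadd V (vscale V c v)) (zip cs vs) (vzero V)"

definition is_basis :: "'v cspace \<Rightarrow> 'v list \<Rightarrow> bool" where
  "is_basis V vs \<longleftrightarrow> set vs \<subseteq> carr V \<and>
     (\<forall>v\<in>carr V. \<exists>!cs. length cs = length vs \<and> lincomb V cs vs = v)"

text \<open>All infinite dimensions are identified with \<open>\<infinity>\<close>, the infimum of the empty set.\<close>

definition vdim :: "'v cspace \<Rightarrow> enat" where
  "vdim V = Inf {enat (length vs) | vs. is_basis V vs}"

section \<open>Classes of operators\<close>

definition ker :: "('a::complex_normed_vector \<Rightarrow> 'a) \<Rightarrow> 'a set" where
  "ker T = {x. T x = 0}"

definition alpha :: "('a::complex_normed_vector \<Rightarrow> 'a) \<Rightarrow> enat" where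
  "alpha T = vdim (sub_space (ker T))"

definition beta :: "('a::complex_normed_vector \<Rightarrow> 'a) \<Rightarrow> enat" where
  "beta T = vdim (quot_space (range T))"

definition asc :: "('a::complex_normed_vector \<Rightarrow> 'a) \<Rightarrow> enat" where
  "asc T = Inf {enat k | k. ker (T ^^ k) = ker (T ^^ Suc k)}"

definition des :: "('a::complex_normed_vector \<Rightarrow> 'a) \<Rightarrow> enat" where
  "des T = Inf {enat k | k. range (T ^^ k) = range (T ^^ Suc k)}"

text \<open>Complements are topological, i.e. required to be closed.\<close>

definition closed_complemented :: "'a::complex_normed_vector set \<Rightarrow> bool" where
  "closed_complemented M \<longleftrightarrow> complex_vector.subspace M \<and> closed M \<and>
     (\<exists>L. complex_vector.subspace L \<and> closed L \<and> M \<inter> L = {0} \<and>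
          {m + l | m l. m \<in> M \<and> l \<in> L} = UNIV)"

definition fredholm :: "('a::complex_banach \<Rightarrow> 'a) \<Rightarrow> bool" where
  "fredholm T \<longleftrightarrow> alpha T < \<infinity> \<and> beta T < \<infinity>"

definition browder :: "('a::complex_banach \<Rightarrow> 'a) \<Rightarrow> bool" where
  "browder T \<longleftrightarrow> fredholm T \<and> asc T = des T \<and> asc T < \<infinity>"

definition left_semi_fredholm :: "('a::complex_banach \<Rightarrow> 'a) \<Rightarrow> bool" where
  "left_semi_fredholm T \<longleftrightarrow> closed_complemented (range T) \<and> alpha T < \<infinity>"

definition right_semi_fredholm :: "('a::complex_banach \<Rightarrow> 'a) \<Rightarrow> bool" where
  "right_semi_fredholm T \<longleftrightarrow> closed_complemented (ker T) \<and> beta T < \<infinity>"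

definition left_semi_browder :: "('a::complex_banach \<Rightarrow> 'a) \<Rightarrow> bool" where
  "left_semi_browder T \<longleftrightarrow> left_semi_fredholm T \<and> asc T < \<infinity>"

definition right_semi_browder :: "('a::complex_banach \<Rightarrow> 'a) \<Rightarrow> bool" where
  "right_semi_browder T \<longleftrightarrow> right_semi_fredholm T \<and> des T < \<infinity>"

definition shift :: "('a::complex_normed_vector \<Rightarrow> 'a) \<Rightarrow> complex \<Rightarrow> 'a \<Rightarrow> 'a" where
  "shift T \<mu> = (\<lambda>x. T x - \<mu> *\<^sub>C x)"

definition browder_spectrum :: "('a::complex_banach \<Rightarrow> 'a) \<Rightarrow> complex set" where
  "browder_spectrum T = {\<mu>. \<not> browder (shift T \<mu>)}"

definition left_semi_browder_spectrum :: "('a::complex_banach \<Rightarrow> 'a) \<Rightarrow> complex set" where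
  "left_semi_browder_spectrum T = {\<mu>. \<not> left_semi_browder (shift T \<mu>)}"

definition right_semi_browder_spectrum :: "('a::complex_banach \<Rightarrow> 'a) \<Rightarrow> complex set" where
  "right_semi_browder_spectrum T = {\<mu>. \<not> right_semi_browder (shift T \<mu>)}"

definition upper_triangular ::
    "('a::complex_normed_vector \<Rightarrow> 'a) \<Rightarrow> ('b::complex_normed_vector \<Rightarrow> 'a) \<Rightarrow> ('b \<Rightarrow> 'b)
      \<Rightarrow> 'a \<times> 'b \<Rightarrow> 'a \<times> 'b" where
  "upper_triangular A C B = (\<lambda>(x, y). (A x + C y, B y))"

end

theory Submission
  imports Defs
begin

text \<open>After a shift, \<open>\<mu> = 0\<close>. If \<open>M\<^sub>C\<close> is Browder, it is Fredholm of index zero with finite ascent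
  and descent. The operator \<open>N(B) \<rightarrow> X/R(A)\<close> induced by \<open>C\<close> then has finite-dimensional kernel and
  co-range, and the index of \<open>M\<^sub>C\<close> is determined by the dimensions of these two spaces,
  \<open>\<alpha>(A)\<close> and \<open>\<beta>(B)\<close>. As the index is zero, a finite-rank correction turns this operator into an
  isomorphism \<open>N(A) \<times> N(B) \<cong> X/R(A) \<times> Y/R(B)\<close>. The complements of \<open>R(A)\<close> and \<open>N(B)\<close> are images of
  closed subspaces under bounded operators, hence closed by the open mapping theorem.

  Conversely, let \<open>i\<close> and \<open>j\<close> be exponents at which the kernels of the powers of \<open>A\<close> and the ranges of
  the powers of \<open>B\<close> are stationary. Cancelling finite-dimensional summands in the given isomorphism yields a bounded
  \<open>C\<close> that maps \<open>N(B) \<inter> R(B\<^sup>j)\<close> bijectively onto a complement of \<open>R(A) + N(A\<^sup>i)\<close>. Then \<open>M\<^sub>C\<close> is bijective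
  up to the finite-dimensional spaces \<open>N(A\<^sup>i)\<close> and \<open>Y/R(B\<^sup>j)\<close>, which bounds the kernels and co-ranges
  of all its powers.\<close>

text \<open>A Fredholm operator of index zero may fail to be Browder: for the unilateral shift
  \<open>A\<close> on l^2, its adjoint \<open>B\<close> and \<open>C = 0\<close>, the triangular
  operator has index zero and its powers have ever larger kernels. An arbitrary isomorphism of N(A)
  x N(B) with the quotients is therefore too crude, and \<open>C\<close> has to be adapted to N(A^i)
  and R(B^j). This is possible because dimensions match: N(A) has the dimension of the image of
  N(A^i) in X/R(A), and N(B)/(N(B) \<inter> R(B^j)) has that of Y/R(B). Both equalities say that an
  operator on a finite-dimensional space has index zero, namely \<open>A\<close> on N(A^i) and the
  operator induced by \<open>B\<close> on Y/R(B^j). Dimensions live in \<open>enat\<close>, so no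
  index is formed as a difference: every index identity is an equation between sums, from which
  finite terms are cancelled. Quotients are replaced by algebraic complements in the same type, and
  topology enters only where a projection has to be bounded.\<close>

global_interpretation clin: vector_space_pair
  "scaleC :: complex \<Rightarrow> 'a \<Rightarrow> 'a::complex_normed_vector"
  "scaleC :: complex \<Rightarrow> 'b \<Rightarrow> 'b::complex_normed_vector"
  by unfold_locales

abbreviation csubspace :: "'a::complex_normed_vector set \<Rightarrow> bool" where
  "csubspace \<equiv> complex_vector.subspace"

abbreviation cspan :: "'a::complex_normed_vector set \<Rightarrow> 'a set" where
  "cspan \<equiv> complex_vector.span"

abbreviation cindependent :: "'a::complex_normed_vector set \<Rightarrow> bool" where
  "cindependent S \<equiv> \<not> complex_vector.dependent S"

abbreviation clinear :: "('a::complex_normed_vector \<Rightarrow> 'b::complex_normed_vector) \<Rightarrow> bool" where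
  "clinear \<equiv> Vector_Spaces.linear (*\<^sub>C) (*\<^sub>C)"

abbreviation cdim :: "'a::complex_normed_vector set \<Rightarrow> enat" where
  "cdim S \<equiv> vdim (sub_space S)"

lemma clinearI:
  assumes "\<And>x y. f (x + y) = f x + f y" "\<And>c x. f (c *\<^sub>C x) = c *\<^sub>C f x"
  shows "clinear f"
  by (intro Vector_Spaces.linear_iff[THEN iffD2] conjI allI complex_vector.vector_space_axioms assms)

lemma scaleC_Pair [simp]: "c *\<^sub>C (x, y) = (c *\<^sub>C x, c *\<^sub>C y)"
  by (simp add: scaleC_prod_def)

lemma fst_scaleC [simp]: "fst (c *\<^sub>C p) = c *\<^sub>C fst p"
  and snd_scaleC [simp]: "snd (c *\<^sub>C p) = c *\<^sub>C snd p"
  by (simp_all add: scaleC_prod_def)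

lemma csubspace_Times: "csubspace U \<Longrightarrow> csubspace V \<Longrightarrow> csubspace (U \<times> V)"
  by (auto simp: complex_vector.subspace_def zero_prod_def)

lemma csubspace_range: "clinear f \<Longrightarrow> csubspace (range f)"
  by (rule clin.linear_subspace_image) auto

lemma csubspace_ker: "clinear f \<Longrightarrow> csubspace (ker f)"
  unfolding ker_def by (rule clin.linear_subspace_kernel)

subsection \<open>Dimension\<close>

lemma lincomb_sub_space:
  "length cs = length vs \<Longrightarrow> lincomb (sub_space S) cs vs = (\<Sum>i<length vs. cs ! i *\<^sub>C vs ! i)"
proof (induction vs arbitrary: cs)
  case Nil then show ?case by (simp add: lincomb_def sub_space_def)
next
  case (Cons v vs)
  then obtain c cs' where cs: "cs = c # cs'" by (cases cs) auto
  with Cons show ?case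
    unfolding lincomb_def sub_space_def by (simp add: sum.lessThan_Suc_shift del: sum.lessThan_Suc)
qed

lemma sum_nth_distinct:
  assumes "distinct vs"
  shows "(\<Sum>i<length vs. u (vs ! i) *\<^sub>C vs ! i) = (\<Sum>v\<in>set vs. u v *\<^sub>C v)"
  using sum.reindex_bij_betw[OF bij_betw_nth[OF assms refl refl], of "\<lambda>v. u v *\<^sub>C v"] by simp

text \<open>Unique coordinates exclude both repetitions and linear relations, since either would
  represent 0 by a second coefficient list. Through this equivalence \<open>vdim\<close> of a
  subspace is governed by the usual theory of span and independence.\<close>

lemma is_basis_sub_space_iff:
  assumes S: "csubspace S"
  shows "is_basis (sub_space S) vs \<longleftrightarrow> distinct vs \<and> cindependent (set vs) \<and> cspan (set vs) = S"
proof
  assume b: "is_basis (sub_space S) vs"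
  have sub: "set vs \<subseteq> S" using b by (simp add: is_basis_def sub_space_def)
  have ex: "\<exists>!cs. length cs = length vs \<and> (\<Sum>i<length vs. cs ! i *\<^sub>C vs ! i) = v" if "v \<in> S" for v
  proof -
    have "\<exists>!cs. length cs = length vs \<and> lincomb (sub_space S) cs vs = v"
      using b that by (simp add: is_basis_def sub_space_def)
    then show ?thesis by (metis lincomb_sub_space)
  qed
  have zero: "cs = replicate (length vs) 0"
    if "length cs = length vs" "(\<Sum>i<length vs. cs ! i *\<^sub>C vs ! i) = 0" for cs
    using ex[of 0] that complex_vector.subspace_0[OF S]
    by (metis (no_types, lifting) complex_vector.scale_zero_left length_replicate lessThan_iff nth_replicate sum.neutral)
  have dist: "distinct vs"
  proof (rule ccontr)
    assume "\<not> distinct vs"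
    then obtain i j where ij: "i < length vs" "j < length vs" "i \<noteq> j" "vs ! i = vs ! j"
      by (auto simp: distinct_conv_nth)
    \<comment> \<open>Coefficients 1 and -1 at two positions holding the same vector represent 0 by
      a nonzero list.\<close>
    define cs where "cs = map (\<lambda>k. if k = i then 1 else if k = j then -1 else 0 :: complex) [0..<length vs]"
    have "(\<Sum>k<length vs. cs ! k *\<^sub>C vs ! k)
        = (\<Sum>k<length vs. (if k = i then vs ! i else 0) - (if k = j then vs ! j else 0))"
      using ij by (intro sum.cong) (auto simp: cs_def)
    also have "\<dots> = 0" using ij by (simp add: sum_subtractf)
    finally have "cs = replicate (length vs) 0" by (intro zero) (simp_all add: cs_def)
    then have "cs ! i = 0" using ij by simp
    then show False using ij by (simp add: cs_def)
  qed
  have "cindependent (set vs)"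
  proof (rule complex_vector.independent_if_scalars_zero)
    fix u v assume u: "(\<Sum>x\<in>set vs. u x *\<^sub>C x) = 0" and v: "v \<in> set vs"
    have "map u vs = replicate (length vs) 0"
      by (rule zero) (use u sum_nth_distinct[OF dist, of u] in simp_all)
    with v show "u v = 0" by (metis in_set_conv_nth length_map nth_map nth_replicate)
  qed auto
  moreover have "cspan (set vs) = S"
  proof
    show "cspan (set vs) \<subseteq> S" using sub S by (rule complex_vector.span_minimal)
    show "S \<subseteq> cspan (set vs)"
    proof
      fix v assume "v \<in> S"
      then obtain cs where "v = (\<Sum>i<length vs. cs ! i *\<^sub>C vs ! i)" using ex by metis
      moreover have "(\<Sum>i<length vs. cs ! i *\<^sub>C vs ! i) \<in> cspan (set vs)"
        by (intro complex_vector.span_sum complex_vector.span_scale complex_vector.span_base) simp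
      ultimately show "v \<in> cspan (set vs)" by simp
    qed
  qed
  ultimately show "distinct vs \<and> cindependent (set vs) \<and> cspan (set vs) = S" using dist by simp
next
  assume "distinct vs \<and> cindependent (set vs) \<and> cspan (set vs) = S"
  then have d: "distinct vs" and i: "cindependent (set vs)" and s: "cspan (set vs) = S" by auto
  have "\<exists>!cs. length cs = length vs \<and> lincomb (sub_space S) cs vs = v" if v: "v \<in> S" for v
  proof (rule ex_ex1I)
    obtain u where "v = (\<Sum>x\<in>set vs. u x *\<^sub>C x)"
      using v s complex_vector.span_finite[of "set vs"] by auto
    then have "length (map u vs) = length vs \<and> lincomb (sub_space S) (map u vs) vs = v"
      using sum_nth_distinct[OF d, of u] by (simp add: lincomb_sub_space)
    then show "\<exists>cs. length cs = length vs \<and> lincomb (sub_space S) cs vs = v" by blast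
  next
    fix cs ds assume a: "length cs = length vs \<and> lincomb (sub_space S) cs vs = v"
      "length ds = length vs \<and> lincomb (sub_space S) ds vs = v"
    define u where "u x = (let k = (THE k. k < length vs \<and> vs ! k = x) in cs ! k - ds ! k)" for x
    have the: "(THE k'. k' < length vs \<and> vs ! k' = vs ! k) = k" if "k < length vs" for k
      using that d by (auto simp: nth_eq_iff_index_eq)
    have u: "u (vs ! k) = cs ! k - ds ! k" if "k < length vs" for k
      using the[OF that] by (simp add: u_def Let_def)
    have "(\<Sum>k<length vs. u (vs ! k) *\<^sub>C vs ! k) = (\<Sum>k<length vs. cs ! k *\<^sub>C vs ! k - ds ! k *\<^sub>C vs ! k)"
      by (intro sum.cong) (auto simp: u complex_vector.scale_left_diff_distrib)
    also have "\<dots> = 0"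
      using a lincomb_sub_space[of cs vs S] lincomb_sub_space[of ds vs S] by (simp add: sum_subtractf)
    finally have "(\<Sum>x\<in>set vs. u x *\<^sub>C x) = 0" using sum_nth_distinct[OF d, of u] by simp
    then have "u x = 0" if "x \<in> set vs" for x
      using complex_vector.independentD[OF i _ subset_refl _ that, of u] by simp
    then have "cs ! k = ds ! k" if "k < length vs" for k
      using u[OF that] that nth_mem by fastforce
    then show "cs = ds" using a by (metis nth_equalityI)
  qed
  then show "is_basis (sub_space S) vs"
    using s complex_vector.span_superset[of "set vs"] by (auto simp: is_basis_def sub_space_def)
qed

text \<open>The infimum in \<open>vdim\<close> is taken over a singleton, because any two bases of a
  span have equally many elements.\<close>

lemma cdim_span:
  assumes "finite B" "cindependent B"
  shows "cdim (cspan B) = enat (card B)"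
proof -
  have "{enat (length vs) |vs. is_basis (sub_space (cspan B)) vs} = {enat (card B)}"
  proof (intro equalityI subsetI)
    fix n assume "n \<in> {enat (length vs) |vs. is_basis (sub_space (cspan B)) vs}"
    then obtain vs where n: "n = enat (length vs)" and
      vs: "distinct vs" "cindependent (set vs)" "cspan (set vs) = cspan B"
      by (auto simp: is_basis_sub_space_iff complex_vector.subspace_span)
    have "card (set vs) = card B"
      using complex_vector.dim_eq_card[OF vs(3,2)] complex_vector.dim_eq_card[OF refl assms(2)] by simp
    then show "n \<in> {enat (card B)}" using n vs(1) distinct_card by force
  next
    fix n assume n: "n \<in> {enat (card B)}"
    obtain vs where "set vs = B" "distinct vs" using finite_distinct_list[OF assms(1)] by blast
    then show "n \<in> {enat (length vs) |vs. is_basis (sub_space (cspan B)) vs}"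
      using n assms(2) distinct_card[of vs]
      by (auto simp: is_basis_sub_space_iff complex_vector.subspace_span intro!: exI[of _ vs])
  qed
  then show ?thesis by (simp add: vdim_def)
qed

lemma cdim_finite_obtain_basis:
  assumes "csubspace S" "cdim S < \<infinity>"
  obtains B where "finite B" "cindependent B" "cspan B = S" "cdim S = enat (card B)"
proof -
  \<comment> \<open>In \<open>enat\<close> the infimum of the empty set is the top element, so a
    finite value forces a basis list to exist.\<close>
  have "{enat (length vs) |vs. is_basis (sub_space S) vs} \<noteq> {}"
    using assms(2) by (auto simp: vdim_def top_enat_def simp del: Collect_empty_eq)
  then obtain vs where "cindependent (set vs)" "cspan (set vs) = S"
    using is_basis_sub_space_iff[OF assms(1)] by blast
  then show thesis using that[of "set vs"] cdim_span[of "set vs"] by simp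
qed

lemma cdim_mono:
  assumes "csubspace U" "csubspace V" "U \<subseteq> V"
  shows "cdim U \<le> cdim V"
proof (cases "cdim V < \<infinity>")
  case True
  obtain B where B: "finite B" "cspan B = V" "cdim V = enat (card B)"
    using cdim_finite_obtain_basis[OF assms(2) True] by metis
  obtain C where C: "C \<subseteq> U" "cindependent C" "U \<subseteq> cspan C"
    using complex_vector.maximal_independent_subset by blast
  have "C \<subseteq> cspan B" using C assms B by auto
  then have fC: "finite C \<and> card C \<le> card B"
    by (rule complex_vector.independent_span_bound[OF B(1) C(2)])
  have "cspan C = U" using C complex_vector.span_minimal[OF C(1) assms(1)] by auto
  then show ?thesis using cdim_span[of C] C fC B by auto
qed auto

lemma cdim_image_le_inj:
  assumes "clinear f" "csubspace S" "inj_on f S" "cdim S < \<infinity>"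
  shows "cdim (f ` S) = cdim S"
proof -
  obtain B where B: "finite B" "cindependent B" "cspan B = S" "cdim S = enat (card B)"
    using cdim_finite_obtain_basis assms by blast
  have "cindependent (f ` B)"
    using clin.linear_independent_injective_image[OF assms(1) B(2)] assms(3) B(3) by simp
  moreover have "cspan (f ` B) = f ` S" using clin.linear_span_image[OF assms(1)] B by simp
  moreover have "card (f ` B) = card B"
    using assms(3) B(3) complex_vector.span_superset[of B] by (metis card_image inj_on_subset)
  ultimately show ?thesis using cdim_span[of "f ` B"] B by simp
qed

text \<open>In the infinite case a linear left inverse of \<open>f\<close> on \<open>S\<close> would
  carry a finite basis of the image back to \<open>S\<close>, so both dimensions are infinite
  together.\<close>

lemma cdim_image_inj:
  assumes f: "clinear f" "csubspace S" "inj_on f S"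
  shows "cdim (f ` S) = cdim S"
proof (cases "cdim S < \<infinity>")
  case False
  have "\<not> cdim (f ` S) < \<infinity>"
  proof
    assume fin: "cdim (f ` S) < \<infinity>"
    obtain g where g: "clinear g" "\<And>x. x \<in> S \<Longrightarrow> g (f x) = x"
      using clin.linear_exists_left_inverse_on[OF f] by blast
    have "cdim (g ` (f ` S)) = cdim (f ` S)"
      using g fin clin.linear_subspace_image[OF f(1,2)]
      by (intro cdim_image_le_inj) (auto simp: inj_on_def)
    moreover have "g ` (f ` S) = S" using g by force
    ultimately show False using False fin by simp
  qed
  then show ?thesis using False by simp
qed (use cdim_image_le_inj assms in blast)

text \<open>If a factor is infinite-dimensional, its embedding already makes the product so.
  Otherwise the embedded bases are disjoint, as 0 belongs to no independent set, and together they
  form a basis.\<close>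

lemma cdim_Times:
  fixes U :: "'a::complex_normed_vector set" and V :: "'b::complex_normed_vector set"
  assumes U: "csubspace U" and V: "csubspace V"
  shows "cdim (U \<times> V) = cdim U + cdim V"
proof -
  have l1: "clinear (\<lambda>x::'a. (x, 0::'b))" and l2: "clinear (\<lambda>y::'b. (0::'a, y))"
    by (auto intro: clinearI)
  have d1: "cdim ((\<lambda>x::'a. (x, 0::'b)) ` U) = cdim U" "cdim ((\<lambda>y::'b. (0::'a, y)) ` V) = cdim V"
    using l1 l2 U V by (auto intro!: cdim_image_inj simp: inj_on_def)
  have "cdim ((\<lambda>x::'a. (x, 0::'b)) ` U) \<le> cdim (U \<times> V)"
    using U V complex_vector.subspace_0[OF V]
    by (intro cdim_mono clin.linear_subspace_image l1 csubspace_Times) auto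
  moreover have "cdim ((\<lambda>y::'b. (0::'a, y)) ` V) \<le> cdim (U \<times> V)"
    using U V complex_vector.subspace_0[OF U]
    by (intro cdim_mono clin.linear_subspace_image l2 csubspace_Times) auto
  ultimately have le: "cdim U \<le> cdim (U \<times> V)" "cdim V \<le> cdim (U \<times> V)"
    using d1 by simp_all
  show ?thesis
  proof (cases "cdim U < \<infinity> \<and> cdim V < \<infinity>")
    case False
    then have "cdim U = \<infinity> \<or> cdim V = \<infinity>" by simp
    then show ?thesis using le by auto
  next
    case True
    obtain B where B: "finite B" "cindependent B" "cspan B = U" "cdim U = enat (card B)"
      using cdim_finite_obtain_basis U True by blast
    obtain C where C: "finite C" "cindependent C" "cspan C = V" "cdim V = enat (card C)"
      using cdim_finite_obtain_basis V True by blast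
    let ?B = "(\<lambda>x::'a. (x, 0::'b)) ` B" and ?C = "(\<lambda>y::'b. (0::'a, y)) ` C"
    have disj: "?B \<inter> ?C = {}"
      using B(2) complex_vector.dependent_zero by auto
    have sum1: "(\<Sum>v\<in>?B. u v *\<^sub>C v) = (\<Sum>x\<in>B. u (x, 0) *\<^sub>C x, 0)" for u
      by (subst sum.reindex) (auto simp: inj_on_def sum_prod)
    have sum2: "(\<Sum>v\<in>?C. u v *\<^sub>C v) = (0, \<Sum>x\<in>C. u (0, x) *\<^sub>C x)" for u
      by (subst sum.reindex) (auto simp: inj_on_def sum_prod)
    have sum: "(\<Sum>v\<in>?B \<union> ?C. u v *\<^sub>C v) = (\<Sum>x\<in>B. u (x, 0) *\<^sub>C x, \<Sum>x\<in>C. u (0, x) *\<^sub>C x)" for u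
      using B C disj by (subst sum.union_disjoint) (auto simp: sum1 sum2)
    have "cindependent (?B \<union> ?C)"
    proof (rule complex_vector.independent_if_scalars_zero)
      fix u v assume "(\<Sum>v\<in>?B \<union> ?C. u v *\<^sub>C v) = 0" and v: "v \<in> ?B \<union> ?C"
      then have "(\<Sum>x\<in>B. u (x, 0) *\<^sub>C x) = 0" "(\<Sum>x\<in>C. u (0, x) *\<^sub>C x) = 0"
        by (auto simp only: sum zero_prod_def)
      then have "\<forall>x\<in>B. u (x, 0) = 0" "\<forall>x\<in>C. u (0, x) = 0"
        using complex_vector.independentD[OF B(2,1) subset_refl, of "\<lambda>x. u (x, 0)"]
          complex_vector.independentD[OF C(2,1) subset_refl, of "\<lambda>x. u (0, x)"] by blast+
      then show "u v = 0" using v by auto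
    qed (use B C in auto)
    moreover have "cspan (?B \<union> ?C) = U \<times> V"
    proof
      show "cspan (?B \<union> ?C) \<subseteq> U \<times> V"
        using complex_vector.span_superset[of B] complex_vector.span_superset[of C] B C
          complex_vector.subspace_0[OF U] complex_vector.subspace_0[OF V]
        by (intro complex_vector.span_minimal csubspace_Times U V) auto
      show "U \<times> V \<subseteq> cspan (?B \<union> ?C)"
      proof
        fix p assume "p \<in> U \<times> V"
        then have "(fst p, 0::'b) \<in> (\<lambda>x. (x, 0)) ` cspan B" "(0::'a, snd p) \<in> (\<lambda>y. (0, y)) ` cspan C"
          using B C by auto
        then have "(fst p, 0) \<in> cspan ?B" "(0, snd p) \<in> cspan ?C"
          by (simp_all add: clin.linear_span_image[OF l1] clin.linear_span_image[OF l2])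
        then have "(fst p, 0) + (0, snd p) \<in> cspan (?B \<union> ?C)"
          by (meson Un_upper1 Un_upper2 complex_vector.span_add complex_vector.span_mono subset_iff)
        then show "p \<in> cspan (?B \<union> ?C)" by simp
      qed
    qed
    moreover have "card (?B \<union> ?C) = card B + card C"
      using B C disj by (subst card_Un_disjoint) (auto simp: card_image inj_on_def)
    ultimately show ?thesis using cdim_span[of "?B \<union> ?C"] B C by simp
  qed
qed

subsection \<open>Direct sums\<close>

text \<open>A purely algebraic notion, so that every subspace of a subspace \<open>V\<close> has a
  complement in \<open>V\<close>. Closedness is tracked separately. A complement serves as a model
  of the quotient inside the same type.\<close>

definition direct_sum ::
    "'a::complex_normed_vector set \<Rightarrow> 'a set \<Rightarrow> 'a set \<Rightarrow> bool" where
  "direct_sum U L V \<longleftrightarrow> csubspace U \<and> csubspace L \<and> U \<inter> L = {0} \<and>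
     {u + l | u l. u \<in> U \<and> l \<in> L} = V"

lemma direct_sumI:
  assumes "csubspace U" "csubspace L" "csubspace V" "U \<subseteq> V" "L \<subseteq> V"
    and "\<And>x. x \<in> U \<Longrightarrow> x \<in> L \<Longrightarrow> x = 0"
    and "\<And>x. x \<in> V \<Longrightarrow> \<exists>u\<in>U. \<exists>l\<in>L. x = u + l"
  shows "direct_sum U L V"
proof -
  have "0 \<in> U" "0 \<in> L" using assms by (auto intro: complex_vector.subspace_0)
  then have "U \<inter> L = {0}" using assms(6) by blast
  moreover have "{u + l | u l. u \<in> U \<and> l \<in> L} = V"
  proof (intro equalityI subsetI)
    fix x assume "x \<in> {u + l | u l. u \<in> U \<and> l \<in> L}"
    then show "x \<in> V" using assms(4,5) complex_vector.subspace_add[OF assms(3)] by blast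
  next
    fix x assume "x \<in> V"
    then show "x \<in> {u + l | u l. u \<in> U \<and> l \<in> L}" using assms(7) by blast
  qed
  ultimately show ?thesis using assms(1,2) by (simp add: direct_sum_def)
qed

lemma direct_sumD:
  assumes "direct_sum U L V"
  shows "csubspace U" "csubspace L" "U \<subseteq> V" "L \<subseteq> V" "csubspace V"
    and "\<And>x. x \<in> U \<Longrightarrow> x \<in> L \<Longrightarrow> x = 0"
    and "\<And>x. x \<in> V \<Longrightarrow> \<exists>u\<in>U. \<exists>l\<in>L. x = u + l"
proof -
  show s: "csubspace U" "csubspace L" using assms by (auto simp: direct_sum_def)
  have V: "V = {u + l | u l. u \<in> U \<and> l \<in> L}" using assms by (auto simp: direct_sum_def)
  show "U \<subseteq> V"
  proof
    fix u assume "u \<in> U"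
    then show "u \<in> V" unfolding V using complex_vector.subspace_0[OF s(2)] by force
  qed
  show "L \<subseteq> V"
  proof
    fix l assume "l \<in> L"
    then show "l \<in> V" unfolding V using complex_vector.subspace_0[OF s(1)] by force
  qed
  show "csubspace V" unfolding V using s by (rule complex_vector.subspace_sums)
  show "\<And>x. x \<in> U \<Longrightarrow> x \<in> L \<Longrightarrow> x = 0" using assms by (auto simp: direct_sum_def)
  show "\<And>x. x \<in> V \<Longrightarrow> \<exists>u\<in>U. \<exists>l\<in>L. x = u + l" unfolding V by blast
qed

lemma direct_sum_unique:
  assumes "direct_sum U L V" "u \<in> U" "u' \<in> U" "l \<in> L" "l' \<in> L" "u + l = u' + l'"
  shows "u = u'" "l = l'"
proof -
  have "u - u' = l' - l" using assms(6) by (simp add: algebra_simps)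
  moreover have "u - u' \<in> U" "l' - l \<in> L"
    using assms direct_sumD(1,2)[OF assms(1)] by (auto intro: complex_vector.subspace_diff)
  ultimately have "u - u' = 0" using direct_sumD(6)[OF assms(1), of "u - u'"] by metis
  then show "u = u'" "l = l'" using assms(6) by auto
qed

lemma direct_sum_commute: "direct_sum U L V \<longleftrightarrow> direct_sum L U V"
proof -
  have *: "direct_sum L U V" if "direct_sum U L V" for U L V :: "'a set"
  proof (rule direct_sumI)
    fix x assume "x \<in> V"
    then show "\<exists>u\<in>L. \<exists>l\<in>U. x = u + l" using direct_sumD(7)[OF that] by (metis add.commute)
  qed (use direct_sumD[OF that] in blast)+
  then show ?thesis by blast
qed

lemma direct_sum_exists:
  assumes U: "csubspace U" and V: "csubspace V" and "U \<subseteq> V"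
  obtains L where "direct_sum U L V"
proof -
  obtain B where B: "B \<subseteq> U" "cindependent B" "U \<subseteq> cspan B"
    by (rule complex_vector.maximal_independent_subset)
  obtain C where C: "B \<subseteq> C" "C \<subseteq> V" "cindependent C" "V \<subseteq> cspan C"
    by (rule complex_vector.maximal_independent_subset_extend[of B V]) (use B assms in auto)
  have U_eq: "cspan B = U" using complex_vector.span_subspace[OF B(1,3) U] .
  have V_eq: "cspan C = V" using complex_vector.span_subspace[OF C(2,4) V] .
  have "direct_sum U (cspan (C - B)) V"
  proof (rule direct_sumI)
    show "cspan (C - B) \<subseteq> V" using V_eq complex_vector.span_mono[OF Diff_subset] by blast
    fix x
    show "x = 0" if "x \<in> U" "x \<in> cspan (C - B)"
    proof -
      \<comment> \<open>The coordinates of \<open>x\<close> with respect to \<open>C\<close> are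
        supported both in \<open>B\<close> and in \<open>C - B\<close>, hence vanish.\<close>
      have "complex_vector.representation C x = complex_vector.representation B x"
        using C that U_eq by (intro complex_vector.representation_extend) auto
      moreover have "complex_vector.representation C x = complex_vector.representation (C - B) x"
        using C that by (intro complex_vector.representation_extend) auto
      ultimately have "complex_vector.representation C x b = 0" for b
        by (metis (mono_tags, lifting) Diff_iff complex_vector.representation_ne_zero)
      moreover have "x \<in> cspan C" using that U_eq V_eq assms(3) by auto
      ultimately show "x = 0"
        using complex_vector.sum_nonzero_representation_eq[OF C(3)] by fastforce
    qed
    show "\<exists>u\<in>U. \<exists>l\<in>cspan (C - B). x = u + l" if "x \<in> V"
    proof -
      have "x \<in> cspan (B \<union> (C - B))" using that V_eq C by (simp add: Un_absorb1)
      then show ?thesis unfolding complex_vector.span_Un U_eq by auto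
    qed
  qed (use U V assms complex_vector.subspace_span in auto)
  then show thesis by (rule that)
qed

lemma cdim_direct_sum:
  fixes U L V :: "'a::complex_normed_vector set"
  assumes "direct_sum U L V"
  shows "cdim V = cdim U + cdim L"
proof -
  note D = direct_sumD[OF assms]
  have lin: "clinear (\<lambda>p. fst p + snd p :: 'a)"
    by (rule clinearI) (simp_all add: scaleC_add_right add_ac)
  have "inj_on (\<lambda>p. fst p + snd p) (U \<times> L)"
  proof (rule inj_onI)
    fix p q assume "p \<in> U \<times> L" "q \<in> U \<times> L" "fst p + snd p = fst q + snd q"
    then show "p = q"
      using direct_sum_unique[OF assms, of "fst p" "fst q" "snd p" "snd q"] by (auto simp: prod_eq_iff)
  qed
  then have "cdim ((\<lambda>p. fst p + snd p) ` (U \<times> L)) = cdim (U \<times> L)"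
    by (intro cdim_image_inj csubspace_Times lin D)
  moreover have "(\<lambda>p. fst p + snd p) ` (U \<times> L) = V"
  proof (intro equalityI subsetI)
    fix x assume "x \<in> V"
    then obtain u l where "u \<in> U" "l \<in> L" "x = u + l" using D(7) by blast
    then show "x \<in> (\<lambda>p. fst p + snd p) ` (U \<times> L)" by (intro image_eqI[of _ _ "(u, l)"]) auto
  next
    fix x assume "x \<in> (\<lambda>p. fst p + snd p) ` (U \<times> L)"
    then show "x \<in> V" using D(3,4) by (auto intro!: complex_vector.subspace_add[OF D(5)])
  qed
  ultimately show ?thesis using cdim_Times[OF D(1,2)] by simp
qed

lemma cdim_trivial [simp]: "cdim {0} = 0"
  using cdim_span[of "{}"] complex_vector.independent_empty by (simp add: zero_enat_def)

lemma cdim_eq_0D: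
  assumes "csubspace S" "cdim S = 0"
  shows "S = {0}"
proof -
  obtain B where "finite B" "cspan B = S" "cdim S = enat (card B)"
    using cdim_finite_obtain_basis[OF assms(1)] assms(2) by auto
  then show ?thesis using assms(2) by (auto simp: zero_enat_def)
qed

lemma csubspace_eq_if_cdim_eq:
  assumes "csubspace U" "csubspace V" "U \<subseteq> V" "cdim V < \<infinity>" "cdim U = cdim V"
  shows "U = V"
proof -
  obtain L where L: "direct_sum U L V" using direct_sum_exists assms by blast
  have "cdim L = 0" using cdim_direct_sum[OF L] assms(4,5) by auto
  then have "L = {0}" using cdim_eq_0D[OF direct_sumD(2)[OF L]] by simp
  then show ?thesis using assms(3) direct_sumD(7)[OF L] by fastforce
qed

text \<open>On a complement of its kernel in \<open>U\<close> the map is injective and has the same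
  image. The additive form stays meaningful when terms are infinite.\<close>

lemma cdim_rank_nullity:
  assumes f: "clinear f" and U: "csubspace U"
  shows "cdim U = cdim {x \<in> U. f x = 0} + cdim (f ` U)"
proof -
  let ?K = "{x \<in> U. f x = 0}"
  have K: "csubspace ?K"
    using U clin.linear_0[OF f] clin.linear_add[OF f] clin.linear_scale[OF f]
    by (auto simp: complex_vector.subspace_def)
  obtain W where W: "direct_sum ?K W U" using direct_sum_exists[OF K U] by blast
  note D = direct_sumD[OF W]
  have "inj_on f W"
  proof (rule inj_onI)
    fix x y assume xy: "x \<in> W" "y \<in> W" "f x = f y"
    then have "x - y \<in> W" using complex_vector.subspace_diff[OF D(2)] by blast
    moreover have "f (x - y) = 0" using xy clin.linear_diff[OF f] by simp
    ultimately have "x - y = 0" using D(4) by (intro D(6)) auto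
    then show "x = y" by simp
  qed
  then have "cdim (f ` W) = cdim W" using f D(2) by (intro cdim_image_inj)
  moreover have "f ` W = f ` U"
  proof
    show "f ` U \<subseteq> f ` W"
    proof
      fix z assume "z \<in> f ` U"
      then obtain x where x: "x \<in> U" "z = f x" by blast
      obtain k w where "k \<in> ?K" "w \<in> W" "x = k + w" using D(7)[OF x(1)] by blast
      then show "z \<in> f ` W" using x clin.linear_add[OF f] by auto
    qed
  qed (use D(4) in blast)
  ultimately show ?thesis using cdim_direct_sum[OF W] by simp
qed

lemma direct_sum_projection:
  assumes "direct_sum U L UNIV"
  obtains p where "clinear p" "\<And>x. p x \<in> L" "\<And>x. x - p x \<in> U" "\<And>x. x \<in> L \<Longrightarrow> p x = x"
    "\<And>x. p x = 0 \<longleftrightarrow> x \<in> U"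
proof -
  note D = direct_sumD[OF assms]
  have "\<exists>l. l \<in> L \<and> x - l \<in> U" for x
    using D(7)[of x] by force
  then have "\<exists>p. \<forall>x. p x \<in> L \<and> x - p x \<in> U" by (intro choice) blast
  then obtain p where p: "\<And>x. p x \<in> L" "\<And>x. x - p x \<in> U" by blast
  have uniq: "p x = l" if "l \<in> L" "x - l \<in> U" for x l
    using direct_sum_unique(2)[OF assms that(2) p(2)[of x] that(1) p(1)[of x]] by simp
  have "clinear p"
  proof (rule clinearI)
    fix x y
    have "(x - p x) + (y - p y) \<in> U" using p(2) complex_vector.subspace_add[OF D(1)] by blast
    then show "p (x + y) = p x + p y"
      using p(1) complex_vector.subspace_add[OF D(2)] by (intro uniq) (auto simp: algebra_simps)
  next
    fix c x
    have "c *\<^sub>C (x - p x) \<in> U" using p(2) complex_vector.subspace_scale[OF D(1)] by blast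
    then show "p (c *\<^sub>C x) = c *\<^sub>C p x"
      using p(1) complex_vector.subspace_scale[OF D(2)]
      by (intro uniq) (auto simp: complex_vector.scale_right_diff_distrib)
  qed
  moreover have "p x = x" if "x \<in> L" for x
    using that complex_vector.subspace_0[OF D(1)] by (intro uniq) auto
  moreover have "p x = 0 \<longleftrightarrow> x \<in> U" for x
  proof
    assume "p x = 0" then show "x \<in> U" using p(2)[of x] by simp
  next
    assume "x \<in> U" then show "p x = 0"
      using complex_vector.subspace_0[OF D(2)] by (intro uniq) auto
  qed
  ultimately show thesis using that p by blast
qed

lemma cdim_le_complement:
  assumes "direct_sum U L UNIV" "csubspace G" "U \<inter> G = {0}"
  shows "cdim G \<le> cdim L"
proof -
  obtain p where p: "clinear p" "\<And>x. p x \<in> L" "\<And>x. p x = 0 \<longleftrightarrow> x \<in> U"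
    by (rule direct_sum_projection[OF assms(1)]) blast
  have "inj_on p G"
  proof (rule inj_onI)
    fix x y assume xy: "x \<in> G" "y \<in> G" "p x = p y"
    then have "x - y \<in> G" using complex_vector.subspace_diff[OF assms(2)] by blast
    moreover have "x - y \<in> U" using xy p(3)[of "x - y"] clin.linear_diff[OF p(1), of x y] by simp
    ultimately have "x - y \<in> U \<inter> G" by blast
    then show "x = y" using assms(3) by simp
  qed
  then have "cdim G = cdim (p ` G)" using cdim_image_inj[OF p(1) assms(2)] by simp
  also have "\<dots> \<le> cdim L"
    using p(2) by (intro cdim_mono clin.linear_subspace_image p(1) assms(2) direct_sumD(2)[OF assms(1)]) auto
  finally show ?thesis .
qed

lemma cdim_image_le:
  assumes "clinear f" "csubspace U"
  shows "cdim (f ` U) \<le> cdim U"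
  using cdim_rank_nullity[OF assms] by simp

text \<open>A linear \<open>q\<close> that vanishes on \<open>V\<close> exactly at \<open>U\<close>
  is a concrete quotient map of \<open>V\<close> by \<open>U\<close>, and every complement
  \<open>E\<close> is a model of its image. Dimensions of quotients are read off from such
  maps.\<close>

lemma image_projection_eq:
  assumes E: "direct_sum U E V" and q: "clinear q" "\<And>x. x \<in> V \<Longrightarrow> q x = 0 \<longleftrightarrow> x \<in> U"
  shows "q ` V = q ` E" "inj_on q E" "cdim (q ` V) = cdim E"
proof -
  note D = direct_sumD[OF E]
  show inj: "inj_on q E"
  proof (rule inj_onI)
    fix x y assume xy: "x \<in> E" "y \<in> E" "q x = q y"
    then have "x - y \<in> E" using complex_vector.subspace_diff[OF D(2)] by blast
    moreover have "x - y \<in> U"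
      using xy q(2)[of "x - y"] clin.linear_diff[OF q(1), of x y] calculation D(4) by auto
    ultimately have "x - y = 0" using D(6) by blast
    then show "x = y" by simp
  qed
  show img: "q ` V = q ` E"
  proof (intro equalityI subsetI)
    fix z assume "z \<in> q ` V"
    then obtain x where x: "x \<in> V" "z = q x" by blast
    obtain u e where ue: "u \<in> U" "e \<in> E" "x = u + e" using D(7)[OF x(1)] by blast
    then have "z = q e" using x(2) clin.linear_add[OF q(1), of u e] q(2)[of u] D(3) by auto
    then show "z \<in> q ` E" using ue by blast
  qed (use D(4) in blast)
  show "cdim (q ` V) = cdim E" unfolding img by (rule cdim_image_inj[OF q(1) D(2) inj])
qed

text \<open>A projection along \<open>U\<close> has kernel \<open>U\<close>. The quotient map thus
  takes values in the same type and can be composed with other operators.\<close>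

lemma direct_sum_quotient_map:
  assumes "csubspace U"
  obtains q :: "'a::complex_normed_vector \<Rightarrow> 'a" where "clinear q" "\<And>x. q x = 0 \<longleftrightarrow> x \<in> U"
proof -
  obtain R where "direct_sum U R UNIV"
    by (rule direct_sum_exists[OF assms complex_vector.subspace_UNIV]) simp
  then show thesis by (rule direct_sum_projection) (rule that)
qed

text \<open>This is dim X/U = dim V/U + dim X/V. A quotient map by \<open>V\<close>, restricted to
  the model \<open>L\<close> of X/U, has as kernel a copy of V/U and keeps its full image.\<close>

lemma cdim_complement_chain:
  fixes U E V F L :: "'a::complex_normed_vector set"
  assumes E: "direct_sum U E V" and F: "direct_sum V F UNIV" and L: "direct_sum U L UNIV"
  shows "cdim L = cdim E + cdim F"
proof -
  obtain q :: "'a \<Rightarrow> 'a" where q: "clinear q" "\<And>x. q x = 0 \<longleftrightarrow> x \<in> V"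
    by (rule direct_sum_quotient_map[OF direct_sumD(1)[OF F]]) (rule that)
  obtain p where p: "clinear p" "\<And>x. p x \<in> L" "\<And>x. x - p x \<in> U" "\<And>x. x \<in> L \<Longrightarrow> p x = x"
    "\<And>x. p x = 0 \<longleftrightarrow> x \<in> U"
    by (rule direct_sum_projection[OF L]) (rule that)
  note DE = direct_sumD[OF E] and DL = direct_sumD[OF L]
  have "{x \<in> L. q x = 0} = p ` V"
  proof (intro equalityI subsetI)
    fix x assume "x \<in> {x \<in> L. q x = 0}"
    then have "x \<in> V" "p x = x" using q(2) p(4) by auto
    then show "x \<in> p ` V" by force
  next
    fix x assume "x \<in> p ` V"
    then obtain v where v: "v \<in> V" "x = p v" by blast
    have "v - (v - p v) \<in> V"
      by (rule complex_vector.subspace_diff[OF DE(5) v(1)]) (use p(3) DE(3) in blast)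
    then show "x \<in> {x \<in> L. q x = 0}" using v(2) p(2) q(2) by simp
  qed
  moreover have "q ` L = q ` UNIV"
  proof (intro equalityI subsetI)
    fix z assume "z \<in> range q"
    then obtain x where x: "z = q x" by blast
    have "q (x - p x) = 0" using p(3) DE(3) q(2) by blast
    then have "z = q (p x)" using x clin.linear_diff[OF q(1), of x "p x"] by simp
    then show "z \<in> q ` L" using p(2) by blast
  qed blast
  ultimately show ?thesis
    using cdim_rank_nullity[OF q(1) DL(2)] image_projection_eq(3)[OF F q] image_projection_eq(3)[OF E p(1,5)]
    by simp
qed

subsection \<open>Quotients\<close>

text \<open>The order of the difference is that of the relation in \<open>quot_space\<close>, so
  this is literally the equivalence class of \<open>x\<close>.\<close>

definition coset :: "'a::complex_normed_vector set \<Rightarrow> 'a \<Rightarrow> 'a set" where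
  "coset M x = {y. x - y \<in> M}"

lemma coset_eq_iff:
  assumes "csubspace M"
  shows "coset M x = coset M y \<longleftrightarrow> x - y \<in> M"
proof
  assume "coset M x = coset M y"
  moreover have "y \<in> coset M y" using complex_vector.subspace_0[OF assms] by (simp add: coset_def)
  ultimately show "x - y \<in> M" by (auto simp: coset_def)
next
  assume xy: "x - y \<in> M"
  have "x - z \<in> M \<longleftrightarrow> y - z \<in> M" for z
  proof
    assume "x - z \<in> M"
    then have "(x - z) - (x - y) \<in> M" using xy by (rule complex_vector.subspace_diff[OF assms])
    then show "y - z \<in> M" by simp
  next
    assume "y - z \<in> M"
    then have "(x - y) + (y - z) \<in> M" by (rule complex_vector.subspace_add[OF assms xy])
    then show "x - z \<in> M" by simp
  qed
  then show "coset M x = coset M y" by (simp add: coset_def)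
qed

lemma carr_quot_space: "carr (quot_space M) = range (coset M)"
  by (auto simp: quot_space_def quotient_def coset_def)

lemma vzero_quot_space:
  assumes "csubspace M"
  shows "vzero (quot_space M) = coset M 0"
proof -
  have "x \<in> M \<longleftrightarrow> - x \<in> M" for x
    using complex_vector.subspace_neg[OF assms, of x] complex_vector.subspace_neg[OF assms, of "-x"] by auto
  then show ?thesis by (auto simp: quot_space_def coset_def)
qed

lemma vadd_quot_space:
  assumes "csubspace M"
  shows "vadd (quot_space M) (coset M x) (coset M y) = coset M (x + y)"
proof -
  have "{p + q |p q. p \<in> coset M x \<and> q \<in> coset M y} = coset M (x + y)"
  proof (intro equalityI subsetI)
    fix z assume "z \<in> {p + q |p q. p \<in> coset M x \<and> q \<in> coset M y}"
    then obtain p q where pq: "x - p \<in> M" "y - q \<in> M" "z = p + q" by (auto simp: coset_def)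
    have "(x - p) + (y - q) \<in> M" using complex_vector.subspace_add[OF assms pq(1,2)] .
    then show "z \<in> coset M (x + y)" using pq(3) by (simp add: coset_def algebra_simps)
  next
    fix z assume "z \<in> coset M (x + y)"
    then have "x \<in> coset M x" "z - x \<in> coset M y" "z = x + (z - x)"
      using complex_vector.subspace_0[OF assms] by (simp_all add: coset_def algebra_simps)
    then show "z \<in> {p + q |p q. p \<in> coset M x \<and> q \<in> coset M y}" by blast
  qed
  then show ?thesis by (simp add: quot_space_def)
qed

lemma vscale_quot_space:
  assumes "csubspace M"
  shows "vscale (quot_space M) c (coset M x) = coset M (c *\<^sub>C x)"
proof -
  have "{c *\<^sub>C p + m |p m. p \<in> coset M x \<and> m \<in> M} = coset M (c *\<^sub>C x)"
  proof (intro equalityI subsetI)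
    fix z assume "z \<in> {c *\<^sub>C p + m |p m. p \<in> coset M x \<and> m \<in> M}"
    then obtain p m where pm: "x - p \<in> M" "m \<in> M" "z = c *\<^sub>C p + m" by (auto simp: coset_def)
    have "c *\<^sub>C (x - p) - m \<in> M"
      by (intro complex_vector.subspace_diff[OF assms] complex_vector.subspace_scale[OF assms] pm)
    then show "z \<in> coset M (c *\<^sub>C x)"
      using pm(3) by (simp add: coset_def complex_vector.scale_right_diff_distrib diff_diff_eq)
  next
    fix z assume "z \<in> coset M (c *\<^sub>C x)"
    then have "- (c *\<^sub>C x - z) \<in> M"
      using complex_vector.subspace_neg[OF assms] unfolding coset_def by blast
    then have "x \<in> coset M x" "z - c *\<^sub>C x \<in> M" "z = c *\<^sub>C x + (z - c *\<^sub>C x)"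
      using complex_vector.subspace_0[OF assms] by (simp_all add: coset_def)
    then show "z \<in> {c *\<^sub>C p + m |p m. p \<in> coset M x \<and> m \<in> M}" by blast
  qed
  then show ?thesis by (simp add: quot_space_def)
qed

lemma bij_betw_coset:
  assumes "direct_sum M L UNIV"
  shows "bij_betw (coset M) L (carr (quot_space M))"
proof -
  note D = direct_sumD[OF assms]
  have "inj_on (coset M) L"
  proof (rule inj_onI)
    fix x y assume xy: "x \<in> L" "y \<in> L" "coset M x = coset M y"
    then have "x - y \<in> M" using coset_eq_iff[OF D(1)] by blast
    moreover have "x - y \<in> L" using complex_vector.subspace_diff[OF D(2)] xy by blast
    ultimately have "x - y = 0" by (rule D(6))
    then show "x = y" by simp
  qed
  moreover have "coset M x \<in> coset M ` L" for x
  proof -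
    obtain u l where "u \<in> M" "l \<in> L" "x = u + l" using D(7)[of x] by blast
    then have "coset M x = coset M l" by (simp add: coset_eq_iff[OF D(1)])
    then show ?thesis using \<open>l \<in> L\<close> by blast
  qed
  ultimately show ?thesis unfolding bij_betw_def carr_quot_space by blast
qed

text \<open>Quotient records have no vector space type, so their dimension is transported from a
  complement: \<open>h\<close> commutes with \<open>lincomb\<close> and therefore matches basis
  lists with basis lists.\<close>

lemma vdim_sub_space_cong:
  assumes L: "csubspace L" and bij: "bij_betw h L (carr W)"
    and zero: "h 0 = vzero W"
    and add: "\<And>x y. x \<in> L \<Longrightarrow> y \<in> L \<Longrightarrow> h (x + y) = vadd W (h x) (h y)"
    and scale: "\<And>c x. x \<in> L \<Longrightarrow> h (c *\<^sub>C x) = vscale W c (h x)"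
  shows "vdim W = cdim L"
proof -
  have lc: "lincomb (sub_space L) cs vs \<in> L \<and> lincomb W cs (map h vs) = h (lincomb (sub_space L) cs vs)"
    if "set vs \<subseteq> L" for cs vs
    using that
  proof (induction vs arbitrary: cs)
    case Nil
    then show ?case using zero complex_vector.subspace_0[OF L] by (simp add: lincomb_def sub_space_def)
  next
    case (Cons v vs)
    show ?case
    proof (cases cs)
      \<comment> \<open>\<open>zip\<close> truncates to the shorter list, so an exhausted
        coefficient list contributes \<open>vzero\<close>.\<close>
      case Nil
      then show ?thesis using zero complex_vector.subspace_0[OF L] by (simp add: lincomb_def sub_space_def)
    next
      case (Cons c cs')
      have IH: "lincomb (sub_space L) cs' vs \<in> L"
        "lincomb W cs' (map h vs) = h (lincomb (sub_space L) cs' vs)"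
        using Cons.IH Cons.prems by auto
      have s: "c *\<^sub>C v \<in> L" using Cons.prems complex_vector.subspace_scale[OF L] by simp
      have "lincomb (sub_space L) cs (v # vs) = c *\<^sub>C v + lincomb (sub_space L) cs' vs"
        by (simp add: lincomb_def sub_space_def Cons)
      moreover have "lincomb W cs (map h (v # vs)) = vadd W (vscale W c (h v)) (lincomb W cs' (map h vs))"
        by (simp add: lincomb_def Cons)
      ultimately show ?thesis
        using IH s add[OF s IH(1)] scale[of v c] Cons.prems complex_vector.subspace_add[OF L s IH(1)] by simp
    qed
  qed
  have inj: "inj_on h L" and img: "h ` L = carr W" using bij by (auto simp: bij_betw_def)
  have basis: "is_basis W (map h vs) \<longleftrightarrow> is_basis (sub_space L) vs" if vs: "set vs \<subseteq> L" for vs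
  proof -
    have "(\<exists>!cs. length cs = length vs \<and> lincomb W cs (map h vs) = h v) \<longleftrightarrow>
        (\<exists>!cs. length cs = length vs \<and> lincomb (sub_space L) cs vs = v)" if v: "v \<in> L" for v
    proof -
      have "lincomb W cs (map h vs) = h v \<longleftrightarrow> lincomb (sub_space L) cs vs = v" for cs
        using lc[OF vs, of cs] inj_on_eq_iff[OF inj, of "lincomb (sub_space L) cs vs" v] v by simp
      then show ?thesis by simp
    qed
    then have "(\<forall>w\<in>h ` L. \<exists>!cs. length cs = length vs \<and> lincomb W cs (map h vs) = w) \<longleftrightarrow>
        (\<forall>v\<in>L. \<exists>!cs. length cs = length vs \<and> lincomb (sub_space L) cs vs = v)" by simp
    moreover have "carr (sub_space L) = L" by (simp add: sub_space_def)
    moreover have "h ` set vs \<subseteq> h ` L" using vs by blast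
    ultimately show ?thesis using vs unfolding is_basis_def img[symmetric] by simp
  qed
  have "{enat (length vs) |vs. is_basis W vs} = {enat (length vs) |vs. is_basis (sub_space L) vs}"
  proof (intro equalityI subsetI)
    fix n assume "n \<in> {enat (length vs) |vs. is_basis W vs}"
    then obtain ws where ws: "n = enat (length ws)" "is_basis W ws" by blast
    then have "set ws \<subseteq> h ` L" using img by (simp add: is_basis_def)
    then have "ws \<in> lists (h ` L)" by auto
    then obtain vs where "set vs \<subseteq> L" "ws = map h vs" unfolding lists_image by auto
    then show "n \<in> {enat (length vs) |vs. is_basis (sub_space L) vs}" using ws basis[of vs] by auto
  next
    fix n assume "n \<in> {enat (length vs) |vs. is_basis (sub_space L) vs}"
    then obtain vs where vs: "n = enat (length vs)" "is_basis (sub_space L) vs" by blast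
    then have "set vs \<subseteq> L" by (simp add: is_basis_def sub_space_def)
    then have "is_basis W (map h vs)" using basis vs by blast
    then show "n \<in> {enat (length vs) |vs. is_basis W vs}" using vs(1) by (metis (mono_tags, lifting) length_map mem_Collect_eq)
  qed
  then show ?thesis by (simp add: vdim_def)
qed

lemma vdim_quot_space:
  assumes "direct_sum M L UNIV"
  shows "vdim (quot_space M) = cdim L"
  using direct_sumD(1,2)[OF assms]
  by (intro vdim_sub_space_cong[of L "coset M"] bij_betw_coset[OF assms])
     (simp_all add: vzero_quot_space vadd_quot_space vscale_quot_space)

text \<open>Makes \<open>beta\<close> computable from whichever complement is at hand, which keeps
  cosets out of all later index counts.\<close>

lemma beta_eq_cdim: "direct_sum (range T) L UNIV \<Longrightarrow> beta T = cdim L"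
  by (simp add: beta_def vdim_quot_space)

lemma range_complement_exists:
  assumes "clinear f"
  obtains L where "direct_sum (range f) L UNIV"
  by (rule direct_sum_exists[OF csubspace_range[OF assms] complex_vector.subspace_UNIV]) simp

subsection \<open>Kernel and range of an upper triangular operator\<close>

lemma clinear_upper_triangular:
  assumes "clinear A" "clinear B" "clinear C"
  shows "clinear (upper_triangular A C B)"
  by (rule clinearI)
    (auto simp: upper_triangular_def clin.linear_add[OF assms(1)] clin.linear_add[OF assms(2)]
      clin.linear_add[OF assms(3)] clin.linear_scale[OF assms(1)] clin.linear_scale[OF assms(2)]
      clin.linear_scale[OF assms(3)] scaleC_add_right split: prod.splits)

lemma csubspace_vimage_kernel:
  assumes "clinear C" "csubspace U" "csubspace V"
  shows "csubspace {y \<in> V. C y \<in> U}"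
  using assms(2,3) clin.linear_0[OF assms(1)] clin.linear_add[OF assms(1)] clin.linear_scale[OF assms(1)]
  by (auto simp: complex_vector.subspace_def)

text \<open>The shear (x, y) -> (x - g (C y), y), with \<open>g\<close> a linear right inverse of
  \<open>A\<close> on its range, maps N(A) x K onto the kernel, where K consists of the y in N(B)
  with C y in R(A).\<close>

lemma alpha_upper_triangular:
  fixes A :: "'a::complex_normed_vector \<Rightarrow> 'a" and B :: "'b::complex_normed_vector \<Rightarrow> 'b"
  assumes A: "clinear A" and B: "clinear B" and C: "clinear C"
  shows "alpha (upper_triangular A C B) = cdim (ker A) + cdim {y \<in> ker B. C y \<in> range A}"
proof -
  let ?K = "{y \<in> ker B. C y \<in> range A}"
  have K: "csubspace ?K" by (intro csubspace_vimage_kernel C csubspace_range A csubspace_ker B)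
  obtain g where g: "clinear g" "\<And>w. w \<in> range A \<Longrightarrow> A (g w) = w"
    using clin.linear_exists_right_inverse_on[OF A complex_vector.subspace_UNIV] by blast
  define \<psi> where "\<psi> p = (fst p - g (C (snd p)), snd p)" for p :: "'a \<times> 'b"
  have lin: "clinear \<psi>"
    by (rule clinearI)
      (simp_all add: \<psi>_def clin.linear_add[OF g(1)] clin.linear_add[OF C] clin.linear_scale[OF g(1)]
        clin.linear_scale[OF C] complex_vector.scale_right_diff_distrib)
  have "inj \<psi>"
  proof (rule injI)
    fix q q' assume "\<psi> q = \<psi> q'"
    then have e: "snd q = snd q'" "fst q - g (C (snd q)) = fst q' - g (C (snd q'))"
      unfolding \<psi>_def by blast+
    have "fst q = fst q'" using e(2) unfolding e(1) by simp
    then show "q = q'" using e(1) by (simp add: prod_eq_iff)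
  qed
  then have "cdim (\<psi> ` (ker A \<times> ?K)) = cdim (ker A \<times> ?K)"
    by (intro cdim_image_inj lin csubspace_Times csubspace_ker A K) (rule inj_on_subset, auto)
  moreover have "\<psi> ` (ker A \<times> ?K) = ker (upper_triangular A C B)"
  proof (intro equalityI subsetI)
    fix q assume "q \<in> \<psi> ` (ker A \<times> ?K)"
    then show "q \<in> ker (upper_triangular A C B)"
      using g(2) by (auto simp: \<psi>_def ker_def upper_triangular_def clin.linear_diff[OF A] zero_prod_def)
  next
    fix q assume "q \<in> ker (upper_triangular A C B)"
    then have q: "A (fst q) + C (snd q) = 0" "B (snd q) = 0"
      by (auto simp: ker_def upper_triangular_def zero_prod_def split: prod.splits)
    have "C (snd q) = - A (fst q)" using q(1) by (simp add: eq_neg_iff_add_eq_0 add.commute)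
    also have "\<dots> = A (- fst q)" by (simp add: clin.linear_neg[OF A])
    finally have r: "C (snd q) \<in> range A" by blast
    then have "A (fst q + g (C (snd q))) = 0" using q(1) g(2) by (simp add: clin.linear_add[OF A])
    then have "(fst q + g (C (snd q)), snd q) \<in> ker A \<times> ?K" using q r by (simp add: ker_def)
    then show "q \<in> \<psi> ` (ker A \<times> ?K)" by (rule rev_image_eqI) (simp add: \<psi>_def)
  qed
  ultimately show ?thesis using cdim_Times[OF csubspace_ker[OF A] K] by (simp add: alpha_def)
qed

text \<open>Modulo the range, the second coordinate can be brought into \<open>F\<close>. The
  preimage used for this is free up to N(B), which changes the first coordinate by R(A) + C(N(B)); a
  complement of that sum is modelled by \<open>E\<close> inside \<open>L\<close>.\<close>

lemma direct_sum_range_upper_triangular: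
  fixes A :: "'a::complex_normed_vector \<Rightarrow> 'a" and B :: "'b::complex_normed_vector \<Rightarrow> 'b"
  assumes A: "clinear A" and B: "clinear B" and C: "clinear C"
    and L: "direct_sum (range A) L UNIV" and F: "direct_sum (range B) F UNIV"
    and p: "clinear p" "\<And>x. p x \<in> L" "\<And>x. x - p x \<in> range A" "\<And>x. x \<in> L \<Longrightarrow> p x = x"
      "\<And>x. p x = 0 \<longleftrightarrow> x \<in> range A"
    and E: "direct_sum ((\<lambda>y. p (C y)) ` ker B) E L"
  shows "direct_sum (range (upper_triangular A C B)) (E \<times> F) UNIV"
proof (rule direct_sumI)
  note DL = direct_sumD[OF L] and DF = direct_sumD[OF F] and DE = direct_sumD[OF E]
  show "csubspace (range (upper_triangular A C B))"
    by (intro csubspace_range clinear_upper_triangular A B C)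
  show "csubspace (E \<times> F)" using DE(2) DF(2) by (rule csubspace_Times)
  fix q :: "'a \<times> 'b"
  show "q = 0" if qr: "q \<in> range (upper_triangular A C B)" and qE: "q \<in> E \<times> F"
  proof -
    obtain z where "q = upper_triangular A C B z" using qr by blast
    then obtain x y where q: "fst q = A x + C y" "snd q = B y"
      by (simp add: upper_triangular_def split_beta)
    then have "B y \<in> F" using qE by auto
    then have y: "B y = 0" using DF(6) by blast
    have "fst q = p (fst q)" using qE p(4) DE(4) by auto
    also have "\<dots> = p (A x) + p (C y)" using q clin.linear_add[OF p(1)] by simp
    also have "p (A x) = 0" using p(5) by blast
    finally have "fst q \<in> (\<lambda>y. p (C y)) ` ker B" using y by (simp add: ker_def)
    then have "fst q = 0" using qE DE(6) by auto
    then show "q = 0" using q y by (simp add: prod_eq_iff)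
  qed
  show "\<exists>u\<in>range (upper_triangular A C B). \<exists>l\<in>E \<times> F. q = u + l"
  proof -
    obtain y f where y: "f \<in> F" "snd q = B y + f" using DF(7)[of "snd q"] by blast
    \<comment> \<open>Once \<open>y\<close> has settled the second coordinate, \<open>w\<close> is
      what the first one still needs. Adding \<open>n\<close> from N(B) reduces \<open>p w\<close>
      to its part in \<open>E\<close>.\<close>
    define w where "w = fst q - C y"
    obtain n e where n: "n \<in> ker B" "e \<in> E" "p w = p (C n) + e" using DE(7)[of "p w"] p(2) by blast
    have "(w - p w) - (C n - p (C n)) \<in> range A"
      by (intro complex_vector.subspace_diff DL(1) p(3))
    then obtain x where x: "A x = (w - p w) - (C n - p (C n))" by (metis rangeE)
    have "fst q = A x + C (y + n) + e"
      using x n(3) by (simp add: w_def clin.linear_add[OF C] algebra_simps)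
    moreover have "snd q = B (y + n) + f" using y n by (simp add: ker_def clin.linear_add[OF B])
    ultimately have "q = upper_triangular A C B (x, y + n) + (e, f)"
      by (simp add: upper_triangular_def prod_eq_iff)
    then show ?thesis using n y by blast
  qed
qed auto

text \<open>The map y -> p (C y) from N(B) to \<open>L\<close> contributes its kernel to
  \<open>alpha M\<close> and \<open>alpha B\<close>, its image to \<open>alpha B\<close> and
  \<open>beta A\<close>, and its co-range \<open>E\<close> to \<open>beta A\<close> and
  \<open>beta M\<close>. The identity is ind M = ind A + ind B with the negative terms moved
  across.\<close>

lemma index_upper_triangular:
  assumes A: "clinear A" and B: "clinear B" and C: "clinear C"
    and fin: "alpha A < \<infinity>" "alpha B < \<infinity>" "beta A < \<infinity>" "beta B < \<infinity>"
  defines "M \<equiv> upper_triangular A C B"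
  shows "alpha M < \<infinity>" "beta M < \<infinity>"
    "alpha M + (beta A + beta B) = beta M + (alpha A + alpha B)"
proof -
  obtain L where L: "direct_sum (range A) L UNIV" using range_complement_exists[OF A] .
  obtain F where F: "direct_sum (range B) F UNIV" using range_complement_exists[OF B] .
  obtain p where p: "clinear p" "\<And>x. p x \<in> L" "\<And>x. x - p x \<in> range A" "\<And>x. x \<in> L \<Longrightarrow> p x = x"
      "\<And>x. p x = 0 \<longleftrightarrow> x \<in> range A"
    using direct_sum_projection[OF L] by blast
  have pC: "clinear (\<lambda>y. p (C y))"
    using Vector_Spaces.linear_compose[OF C p(1)] by (simp add: o_def)
  let ?G = "(\<lambda>y. p (C y)) ` ker B"
  obtain E where E: "direct_sum ?G E L"
    by (rule direct_sum_exists[OF clin.linear_subspace_image[OF pC csubspace_ker[OF B]] direct_sumD(2)[OF L]])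
      (use p(2) in auto)
  have K: "{y \<in> ker B. C y \<in> range A} = {y \<in> ker B. p (C y) = 0}" using p(5) by blast
  have 1: "alpha M = alpha A + cdim {y \<in> ker B. p (C y) = 0}"
    using alpha_upper_triangular[OF A B C] unfolding M_def K alpha_def[of A] by simp
  have 2: "alpha B = cdim {y \<in> ker B. p (C y) = 0} + cdim ?G"
    using cdim_rank_nullity[OF pC csubspace_ker[OF B]] by (simp add: alpha_def)
  have 3: "beta A = cdim ?G + cdim E" using beta_eq_cdim[OF L] cdim_direct_sum[OF E] by simp
  have 4: "beta M = cdim E + beta B"
    using beta_eq_cdim[OF direct_sum_range_upper_triangular[OF A B C L F p E]] beta_eq_cdim[OF F]
      cdim_Times[OF direct_sumD(2)[OF E] direct_sumD(2)[OF F]] by (simp add: M_def)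
  show "alpha M < \<infinity>" "beta M < \<infinity>" using fin unfolding 1 2 3 4
    by (cases "cdim {y \<in> ker B. p (C y) = 0}"; cases "cdim E"; auto)+
  show "alpha M + (beta A + beta B) = beta M + (alpha A + alpha B)"
    unfolding 1 2 3 4 by (simp add: ac_simps)
qed

subsection \<open>Index, ascent and descent\<close>

text \<open>The composition is obtained from the triangular operator by invertible row and column
  operations.\<close>

lemma index_comp:
  fixes S T :: "'a::complex_normed_vector \<Rightarrow> 'a"
  assumes S: "clinear S" and T: "clinear T"
    and fin: "alpha S < \<infinity>" "alpha T < \<infinity>" "beta S < \<infinity>" "beta T < \<infinity>"
  shows "alpha (T \<circ> S) < \<infinity>" "beta (T \<circ> S) < \<infinity>"
    "alpha (T \<circ> S) + (beta S + beta T) = beta (T \<circ> S) + (alpha S + alpha T)"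
proof -
  let ?M = "upper_triangular S id T"
  have I: "clinear (id :: 'a \<Rightarrow> 'a)" by (rule clinearI) auto
  have TS: "clinear (T \<circ> S)" using Vector_Spaces.linear_compose[OF S T] .
  have lin: "clinear (\<lambda>x. (x, - S x))"
    by (rule clinearI) (simp_all add: clin.linear_add[OF S] clin.linear_scale[OF S])
  have "ker ?M = (\<lambda>x. (x, - S x)) ` ker (T \<circ> S)"
  proof (intro equalityI subsetI)
    fix q assume "q \<in> ker ?M"
    then have q: "S (fst q) + snd q = 0" "T (snd q) = 0"
      by (auto simp: ker_def upper_triangular_def zero_prod_def split: prod.splits)
    then have s: "snd q = - S (fst q)" by (simp add: eq_neg_iff_add_eq_0 add.commute)
    then have "fst q \<in> ker (T \<circ> S)" using q(2) by (simp add: ker_def clin.linear_neg[OF T])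
    then show "q \<in> (\<lambda>x. (x, - S x)) ` ker (T \<circ> S)"
      by (rule rev_image_eqI) (simp add: prod_eq_iff s)
  next
    fix q assume "q \<in> (\<lambda>x. (x, - S x)) ` ker (T \<circ> S)"
    then show "q \<in> ker ?M"
      by (auto simp: ker_def upper_triangular_def zero_prod_def clin.linear_neg[OF T])
  qed
  then have a: "alpha ?M = alpha (T \<circ> S)"
    using cdim_image_inj[OF lin csubspace_ker[OF TS]] by (simp add: alpha_def inj_on_def)
  obtain L where L: "direct_sum (range (T \<circ> S)) L UNIV" using range_complement_exists[OF TS] .
  note D = direct_sumD[OF L]
  have "direct_sum (range ?M) ({0} \<times> L) UNIV"
  proof (rule direct_sumI)
    show "csubspace (range ?M)" by (intro csubspace_range clinear_upper_triangular S T I)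
    show "csubspace ({0 :: 'a} \<times> L)" by (intro csubspace_Times D) simp
    fix q :: "'a \<times> 'a"
    show "q = 0" if qr: "q \<in> range ?M" and qL: "q \<in> {0} \<times> L"
    proof -
      obtain z where "q = ?M z" using qr by blast
      then obtain x y where q: "S x + y = 0" "snd q = T y" "fst q = 0"
        using qL by (auto simp: upper_triangular_def split_beta)
      have "y = S (- x)" using q(1) by (simp add: clin.linear_neg[OF S] eq_neg_iff_add_eq_0 add.commute)
      then have "snd q \<in> range (T \<circ> S)" using q(2) by auto
      then show "q = 0" using D(6) qL q(3) by (auto simp: prod_eq_iff)
    qed
    obtain x l where x: "l \<in> L" "snd q - T (fst q) = (T \<circ> S) x + l"
      using D(7)[of "snd q - T (fst q)"] by blast
    \<comment> \<open>The second entry makes the first row yield \<open>fst q\<close> exactly; the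
      second row then yields \<open>T (fst q) + T (S x)\<close>.\<close>
    have "q = ?M (- x, fst q + S x) + (0, l)"
      using x(2) by (simp add: upper_triangular_def prod_eq_iff clin.linear_neg[OF S] clin.linear_add[OF T]
          algebra_simps)
    then show "\<exists>u\<in>range ?M. \<exists>l\<in>{0} \<times> L. q = u + l" using x(1) by blast
  qed auto
  then have b: "beta ?M = beta (T \<circ> S)"
    using beta_eq_cdim[OF L] beta_eq_cdim cdim_Times[OF _ D(2), of "{0 :: 'a}"] by fastforce
  show "alpha (T \<circ> S) < \<infinity>" "beta (T \<circ> S) < \<infinity>"
    "alpha (T \<circ> S) + (beta S + beta T) = beta (T \<circ> S) + (alpha S + alpha T)"
    using index_upper_triangular[OF S T I fin] unfolding a b by auto
qed

section \<open>Index of the powers of an operator\<close>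

lemma clinear_funpow:
  fixes T :: "'a::complex_normed_vector \<Rightarrow> 'a"
  assumes "clinear T"
  shows "clinear (T ^^ k)"
proof (induction k)
  case 0
  have "clinear (\<lambda>x::'a. x)" by (rule clinearI) auto
  then show ?case by (simp add: id_def)
next
  case (Suc k)
  then show ?case using Vector_Spaces.linear_compose[OF Suc assms] by (simp only: funpow.simps)
qed

lemma alpha_beta_id:
  "alpha (id :: 'a::complex_normed_vector \<Rightarrow> 'a) = 0" "beta (id :: 'a \<Rightarrow> 'a) = 0"
proof -
  show "alpha (id :: 'a \<Rightarrow> 'a) = 0" by (simp add: alpha_def ker_def)
  have "direct_sum (range (id :: 'a \<Rightarrow> 'a)) {0} UNIV"
    by (rule direct_sumI) auto
  then show "beta (id :: 'a \<Rightarrow> 'a) = 0" using beta_eq_cdim by fastforce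
qed

lemma alpha_beta_funpow_finite:
  assumes T: "clinear T" and fin: "alpha T < \<infinity>" "beta T < \<infinity>"
  shows "alpha (T ^^ k) < \<infinity> \<and> beta (T ^^ k) < \<infinity>"
proof (induction k)
  case 0 show ?case by (simp add: alpha_beta_id id_def[symmetric])
next
  case (Suc k)
  then show ?case using index_comp(1,2)[OF clinear_funpow[OF T, of k] T] fin by (simp only: funpow.simps)
qed

lemma index_funpow:
  assumes T: "clinear T" and fin: "alpha T < \<infinity>" "beta T < \<infinity>"
  shows "alpha (T ^^ Suc k) + (beta (T ^^ k) + beta T) = beta (T ^^ Suc k) + (alpha (T ^^ k) + alpha T)"
  using index_comp(3)[OF clinear_funpow[OF T, of k] T] fin alpha_beta_funpow_finite[OF T fin, of k] by simp

lemma alpha_eq_beta_funpow: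
  assumes T: "clinear T" and fin: "alpha T < \<infinity>" and eq: "alpha T = beta T"
  shows "alpha (T ^^ k) = beta (T ^^ k)"
proof (induction k)
  case 0 show ?case by (simp add: alpha_beta_id id_def[symmetric])
next
  case (Suc k)
  have f: "beta T < \<infinity>" using fin eq by simp
  have "alpha (T ^^ Suc k) + (beta (T ^^ k) + beta T) = beta (T ^^ Suc k) + (beta (T ^^ k) + beta T)"
    using index_funpow[OF T fin f, of k] unfolding Suc eq .
  then show ?case using alpha_beta_funpow_finite[OF T fin f, of k] f
    by (cases "beta (T ^^ k)"; cases "beta T") (simp_all del: funpow.simps)
qed

text \<open>Cancellation in the codimension chain shows that a complement of the smaller range in
  the larger one has dimension zero.\<close>

lemma range_eq_if_beta_eq:
  assumes S: "clinear S" and T: "clinear T" and sub: "range S \<subseteq> range T"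
    and fin: "beta S < \<infinity>" and eq: "beta S = beta T"
  shows "range S = range T"
proof -
  obtain L where L: "direct_sum (range S) L UNIV" using range_complement_exists[OF S] .
  obtain K where K: "direct_sum (range T) K UNIV" using range_complement_exists[OF T] .
  obtain E where E: "direct_sum (range S) E (range T)"
    by (rule direct_sum_exists[OF csubspace_range[OF S] csubspace_range[OF T] sub])
  have "beta S = cdim E + beta T"
    using cdim_complement_chain[OF E K L] beta_eq_cdim[OF K] beta_eq_cdim[OF L] by simp
  then have "cdim E = 0" using fin eq by (cases "beta T"; cases "cdim E") (auto simp: zero_enat_def)
  then have "E = {0}" by (rule cdim_eq_0D[OF direct_sumD(2)[OF E]])
  then have "range T \<subseteq> range S" using direct_sumD(7)[OF E] by auto
  then show ?thesis using sub by blast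
qed

section \<open>Stationary kernels and ranges, and their relation to the index\<close>

lemma asc_finite_iff: "asc T < \<infinity> \<longleftrightarrow> (\<exists>k. ker (T ^^ k) = ker (T ^^ Suc k))"
proof
  assume "asc T < \<infinity>"
  then have "{enat k | k. ker (T ^^ k) = ker (T ^^ Suc k)} \<noteq> {}"
    unfolding asc_def by (metis Inf_enat_def less_irrefl)
  then show "\<exists>k. ker (T ^^ k) = ker (T ^^ Suc k)" by blast
next
  assume "\<exists>k. ker (T ^^ k) = ker (T ^^ Suc k)"
  then obtain k where "enat k \<in> {enat k | k. ker (T ^^ k) = ker (T ^^ Suc k)}" by blast
  then have "asc T \<le> enat k" unfolding asc_def by (rule Inf_lower)
  then show "asc T < \<infinity>" by (metis enat_ord_simps(4) enat_ord_code(3) infinity_ileE neq_iff)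
qed

lemma des_finite_iff: "des T < \<infinity> \<longleftrightarrow> (\<exists>k. range (T ^^ k) = range (T ^^ Suc k))"
proof
  assume "des T < \<infinity>"
  then have "{enat k | k. range (T ^^ k) = range (T ^^ Suc k)} \<noteq> {}"
    unfolding des_def by (metis Inf_enat_def less_irrefl)
  then show "\<exists>k. range (T ^^ k) = range (T ^^ Suc k)" by blast
next
  assume "\<exists>k. range (T ^^ k) = range (T ^^ Suc k)"
  then obtain k where "enat k \<in> {enat k | k. range (T ^^ k) = range (T ^^ Suc k)}" by blast
  then have "des T \<le> enat k" unfolding des_def by (rule Inf_lower)
  then show "des T < \<infinity>" by (metis enat_ord_simps(4) enat_ord_code(3) infinity_ileE neq_iff)
qed

lemma asc_attained:
  assumes "asc T = enat k" shows "ker (T ^^ k) = ker (T ^^ Suc k)"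
proof -
  let ?S = "{enat k | k. ker (T ^^ k) = ker (T ^^ Suc k)}"
  have "?S \<noteq> {}" using assms asc_finite_iff[of T] by auto
  then obtain x where "x \<in> ?S" by blast
  then have "(LEAST x. x \<in> ?S) \<in> ?S" by (rule LeastI)
  then have "Inf ?S \<in> ?S" using \<open>?S \<noteq> {}\<close> by (simp only: Inf_enat_def if_False)
  then show ?thesis using assms by (auto simp: asc_def)
qed

lemma des_attained:
  assumes "des T = enat k" shows "range (T ^^ k) = range (T ^^ Suc k)"
proof -
  let ?S = "{enat k | k. range (T ^^ k) = range (T ^^ Suc k)}"
  have "?S \<noteq> {}" using assms des_finite_iff[of T] by auto
  then obtain x where "x \<in> ?S" by blast
  then have "(LEAST x. x \<in> ?S) \<in> ?S" by (rule LeastI)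
  then have "Inf ?S \<in> ?S" using \<open>?S \<noteq> {}\<close> by (simp only: Inf_enat_def if_False)
  then show ?thesis using assms by (auto simp: des_def)
qed

text \<open>All powers have index zero, so \<open>alpha\<close> and \<open>beta\<close> of each
  power coincide. By finite dimension, nested kernels of equal dimension are equal, and so are
  nested ranges of equal codimension; hence kernels and ranges stop changing at the same
  exponents.\<close>

lemma asc_eq_des:
  assumes T: "clinear T" and fin: "alpha T < \<infinity>" and eq: "alpha T = beta T"
  shows "asc T = des T"
proof -
  have f: "beta T < \<infinity>" using fin eq by simp
  have "ker (T ^^ k) = ker (T ^^ Suc k) \<longleftrightarrow> range (T ^^ k) = range (T ^^ Suc k)" for k
  proof
    have ab: "alpha (T ^^ k) = beta (T ^^ k)" "alpha (T ^^ Suc k) = beta (T ^^ Suc k)"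
      using alpha_eq_beta_funpow[OF T fin eq] by blast+
    note fk = alpha_beta_funpow_finite[OF T fin f]
    {
      assume "ker (T ^^ k) = ker (T ^^ Suc k)"
      then have "beta (T ^^ Suc k) = beta (T ^^ k)" using ab unfolding alpha_def by simp
      moreover have "range (T ^^ Suc k) \<subseteq> range (T ^^ k)" by (auto simp: funpow_swap1)
      ultimately show "range (T ^^ k) = range (T ^^ Suc k)"
        using range_eq_if_beta_eq[OF clinear_funpow[OF T, of "Suc k"] clinear_funpow[OF T, of k]] fk by blast
    next
      assume "range (T ^^ k) = range (T ^^ Suc k)"
      then have "alpha (T ^^ k) = alpha (T ^^ Suc k)" using ab unfolding beta_def by simp
      moreover have "ker (T ^^ k) \<subseteq> ker (T ^^ Suc k)" by (auto simp: ker_def clin.linear_0[OF T])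
      ultimately show "ker (T ^^ k) = ker (T ^^ Suc k)"
        using csubspace_eq_if_cdim_eq[OF csubspace_ker[OF clinear_funpow[OF T, of k]]
            csubspace_ker[OF clinear_funpow[OF T, of "Suc k"]]] fk[of "Suc k"]
        by (simp add: alpha_def)
    }
  qed
  then show ?thesis by (simp add: asc_def des_def)
qed

text \<open>At k = asc = des the powers k and k + 1 have the same \<open>alpha\<close> and the same
  \<open>beta\<close>, so additivity of the index forces \<open>alpha T = beta T\<close>. Equality
  of ascent and descent is thereby traded for an equation that the triangular structure can
  see.\<close>

lemma browder_iff_index:
  assumes T: "clinear T"
  shows "browder T \<longleftrightarrow> alpha T < \<infinity> \<and> alpha T = beta T \<and> asc T < \<infinity>"
proof
  assume b: "browder T"
  then have fin: "alpha T < \<infinity>" "beta T < \<infinity>" by (auto simp: browder_def fredholm_def)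
  have "asc T = des T" "asc T < \<infinity>" using b unfolding browder_def by blast+
  then obtain k where k: "asc T = enat k" "des T = enat k" by (cases "asc T") auto
  have "alpha (T ^^ Suc k) = alpha (T ^^ k)" "beta (T ^^ Suc k) = beta (T ^^ k)"
    using asc_attained[OF k(1)] des_attained[OF k(2)] by (simp_all only: alpha_def beta_def)
  then have "alpha (T ^^ k) + (beta (T ^^ k) + beta T) = beta (T ^^ k) + (alpha (T ^^ k) + alpha T)"
    using index_funpow[OF T fin, of k] by metis
  then have "(alpha (T ^^ k) + beta (T ^^ k)) + beta T = (alpha (T ^^ k) + beta (T ^^ k)) + alpha T"
    by (simp only: ac_simps)
  then have "beta T = alpha T" using alpha_beta_funpow_finite[OF T fin, of k] by auto
  then show "alpha T < \<infinity> \<and> alpha T = beta T \<and> asc T < \<infinity>" using fin k by simp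
next
  assume "alpha T < \<infinity> \<and> alpha T = beta T \<and> asc T < \<infinity>"
  then show "browder T" using asc_eq_des[OF T] by (auto simp: browder_def fredholm_def)
qed

subsection \<open>Bounded operators\<close>

lemma bounded_clinear_clinear: "bounded_clinear T \<Longrightarrow> clinear T"
  by (simp add: bounded_clinear_def)

lemma bounded_clinear_bounded_linear:
  assumes "bounded_clinear T" shows "bounded_linear T"
proof -
  obtain K where lin: "clinear T" and K: "\<And>x. norm (T x) \<le> K * norm x"
    using assms unfolding bounded_clinear_def by blast
  show ?thesis
    by (rule bounded_linear_intro[where K = K])
      (simp_all add: clin.linear_add[OF lin] scaleR_scaleC clin.linear_scale[OF lin] K mult.commute)
qed

lemma bounded_clinearI:
  assumes "clinear T" "bounded_linear T" shows "bounded_clinear T"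
  using assms bounded_linear.bounded[OF assms(2)] unfolding bounded_clinear_def
  by (metis mult.commute)

lemma bounded_clinear_compose:
  assumes "bounded_clinear S" "bounded_clinear T"
  shows "bounded_clinear (\<lambda>x. S (T x))"
proof (rule bounded_clinearI)
  show "clinear (\<lambda>x. S (T x))"
    using Vector_Spaces.linear_compose[OF assms(2,1)[THEN bounded_clinear_clinear]] by (simp add: o_def)
  show "bounded_linear (\<lambda>x. S (T x))"
    by (rule bounded_linear_compose[OF assms[THEN bounded_clinear_bounded_linear]])
qed

lemma bounded_clinear_add:
  assumes "bounded_clinear S" "bounded_clinear T"
  shows "bounded_clinear (\<lambda>x. S x + T x)"
  by (intro bounded_clinearI clin.linear_compose_add bounded_linear_add
      assms[THEN bounded_clinear_clinear] assms[THEN bounded_clinear_bounded_linear])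

lemma bounded_clinear_diff:
  assumes "bounded_clinear S" "bounded_clinear T"
  shows "bounded_clinear (\<lambda>x. S x - T x)"
  by (intro bounded_clinearI clin.linear_compose_sub bounded_linear_sub
      assms[THEN bounded_clinear_clinear] assms[THEN bounded_clinear_bounded_linear])

lemma bounded_clinear_sum:
  assumes "\<And>i. i \<in> I \<Longrightarrow> bounded_clinear (f i)"
  shows "bounded_clinear (\<lambda>x. \<Sum>i\<in>I. f i x)"
  by (intro bounded_clinearI clin.linear_compose_sum bounded_linear_sum ballI
      assms[THEN bounded_clinear_clinear] assms[THEN bounded_clinear_bounded_linear])

lemma bounded_clinear_Pair:
  assumes "bounded_clinear S" "bounded_clinear T"
  shows "bounded_clinear (\<lambda>x. (S x, T x))"
  by (intro bounded_clinearI clinearI bounded_linear_Pair assms[THEN bounded_clinear_bounded_linear])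
    (simp_all add: clin.linear_add[OF assms(1)[THEN bounded_clinear_clinear]]
      clin.linear_add[OF assms(2)[THEN bounded_clinear_clinear]]
      clin.linear_scale[OF assms(1)[THEN bounded_clinear_clinear]]
      clin.linear_scale[OF assms(2)[THEN bounded_clinear_clinear]])

lemma bounded_clinear_ident: "bounded_clinear (\<lambda>x. x)"
  and bounded_clinear_zero: "bounded_clinear (\<lambda>x. 0)"
  and bounded_clinear_fst: "bounded_clinear fst"
  and bounded_clinear_snd: "bounded_clinear snd"
  by (rule bounded_clinearI; auto intro!: clinearI simp: bounded_linear_fst bounded_linear_snd)+

lemma bounded_clinear_scaleC: "bounded_clinear (\<lambda>x. c *\<^sub>C x)"
  unfolding bounded_clinear_def
proof
  show "clinear (\<lambda>x. c *\<^sub>C x)"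
    by (rule clinearI) (simp_all add: scaleC_add_right complex_vector.scale_left_commute)
  show "\<exists>K. \<forall>x. norm (c *\<^sub>C x) \<le> K * norm x" using norm_scaleC by (metis order_refl)
qed

lemma bounded_clinear_continuous_on: "bounded_clinear T \<Longrightarrow> continuous_on S T"
  by (intro linear_continuous_on bounded_clinear_bounded_linear)

lemma bounded_clinear_closed_vimage:
  assumes "bounded_clinear T" "closed V" "closed S"
  shows "closed {x \<in> S. T x \<in> V}"
proof -
  have "{x \<in> S. T x \<in> V} = S \<inter> T -` V" by blast
  then show ?thesis
    using closed_Int[OF assms(3) closed_vimage[OF assms(2) bounded_clinear_continuous_on[OF assms(1)]]] by simp
qed

lemma closed_ker: "bounded_clinear T \<Longrightarrow> closed (ker T)"
  unfolding ker_def using bounded_clinear_closed_vimage[of T "{0}" UNIV] by simp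

lemma csubspace_imp_subspace: "csubspace S \<Longrightarrow> subspace S"
  by (auto simp: complex_vector.subspace_def real_vector.subspace_def scaleR_scaleC)

subsection \<open>The open mapping theorem\<close>

text \<open>The Baire half of the open mapping theorem, relative to the closed image of
  \<open>S\<close>. The closure of the image of some ball of \<open>S\<close> has interior points in
  that image, and differences of approximants near such a point give approximate preimages of
  controlled norm.\<close>

lemma almost_open_mapping:
  fixes T :: "'a::real_normed_vector \<Rightarrow> 'b::banach"
  assumes T: "bounded_linear T" and S: "subspace S" and S': "closed (T ` S)"
  obtains K where "K > 0"
    "\<And>y \<delta>. y \<in> T ` S \<Longrightarrow> \<delta> > 0 \<Longrightarrow> \<exists>x\<in>S. norm x \<le> K * norm y \<and> norm (y - T x) < \<delta>"
proof -
  interpret T: bounded_linear T by fact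
  define C where "C n = closure (T ` (S \<inter> cball 0 (real n)))" for n
  have CS: "C n \<subseteq> T ` S" for n unfolding C_def by (rule closure_minimal) (use S' in auto)
  have cover: "T ` S \<subseteq> (\<Union>n. C n)"
  proof
    fix y assume "y \<in> T ` S"
    then obtain x where x: "x \<in> S" "y = T x" by blast
    obtain n where "norm x \<le> real n" using real_arch_simple by blast
    then have "y \<in> C n" unfolding C_def using x closure_subset by fastforce
    then show "y \<in> (\<Union>n. C n)" by blast
  qed
  let ?X = "top_of_set (T ` S)"
  have "\<exists>n. ?X interior_of C n \<noteq> {}"
  proof (rule ccontr)
    assume "\<nexists>n. ?X interior_of C n \<noteq> {}"
    then have e: "?X interior_of C n = {}" for n by blast
    have "?X interior_of \<Union>(range C) = {}"
    proof (rule Baire_category_alt)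
      show "completely_metrizable_space ?X \<or> locally_compact_space ?X \<and> regular_space ?X"
        using S' closed_closedin completely_metrizable_space_closedin completely_metrizable_space_euclidean
        by blast
      fix Z assume "Z \<in> range C"
      then obtain n where n: "Z = C n" by blast
      have "closed (C n)" by (simp add: C_def)
      then show "closedin ?X Z \<and> ?X interior_of Z = {}"
        using closed_subset[OF CS] e n by blast
    qed simp
    moreover have "\<Union>(range C) = T ` S" using cover CS by blast
    moreover have "?X interior_of (T ` S) = T ` S"
      using interior_of_topspace[of ?X] by (simp only: topspace_euclidean_subtopology)
    ultimately have "T ` S = {}" by simp
    then show False using subspace_0[OF S] by blast
  qed
  then obtain n U y0 where U: "openin ?X U" "y0 \<in> U" "U \<subseteq> C n" by (auto simp: interior_of_def)
  obtain W where W: "open W" "U = T ` S \<inter> W" using U(1) by (auto simp: openin_open)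
  obtain \<epsilon> where \<epsilon>: "\<epsilon> > 0" "ball y0 \<epsilon> \<subseteq> W" using W U(2) openE by blast
  have y0: "y0 \<in> T ` S" "y0 \<in> C n" using U W by auto
  have TS: "subspace (T ` S)" using S T.linear_axioms linear_subspace_image by blast
  \<comment> \<open>Vectors of norm below \<epsilon> have approximate preimages of norm at most 2n.
    Scaling \<open>y\<close> to norm \<epsilon>/2 turns this into 4n/\<epsilon> times the norm of
    \<open>y\<close>; the summand 1 keeps \<open>K\<close> positive for n = 0.\<close>
  define K where "K = 4 * (real n + 1) / \<epsilon>"
  have small: "\<exists>x\<in>S. norm x \<le> 2 * real n \<and> norm (y - T x) < \<delta>"
    if y: "y \<in> T ` S" "norm y < \<epsilon>" and \<delta>: "\<delta> > 0" for y \<delta>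
  proof -
    \<comment> \<open>Both \<open>y0 + y\<close> and \<open>y0\<close> lie in the closure
      \<open>C n\<close>; subtracting their approximants removes the centre
      \<open>y0\<close>.\<close>
    have "y0 + y \<in> W" using \<epsilon>(2) y(2) by (auto simp: dist_norm intro!: subsetD[OF \<epsilon>(2)])
    then have "y0 + y \<in> C n" using subspace_add[OF TS y0(1) y(1)] U(3) W(2) by blast
    then obtain a where a: "a \<in> S" "norm a \<le> real n" "dist (T a) (y0 + y) < \<delta> / 2"
      using \<delta> unfolding C_def closure_approachable by (auto dest!: spec[of _ "\<delta> / 2"])
    obtain b where b: "b \<in> S" "norm b \<le> real n" "dist (T b) y0 < \<delta> / 2"
      using \<delta> y0(2) unfolding C_def closure_approachable by (auto dest!: spec[of _ "\<delta> / 2"])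
    have "y - T (a - b) = (T b - y0) - (T a - (y0 + y))" by (simp add: T.diff)
    then have "norm (y - T (a - b)) \<le> norm (T b - y0) + norm (T a - (y0 + y))"
      by (metis norm_triangle_ineq4)
    then have "norm (y - T (a - b)) < \<delta>" using a(3) b(3) by (simp add: dist_norm)
    moreover have "norm (a - b) \<le> 2 * real n" using norm_triangle_ineq4[of a b] a b by simp
    ultimately show ?thesis using subspace_diff[OF S a(1) b(1)] by blast
  qed
  show thesis
  proof (rule that)
    show "K > 0" using \<epsilon> by (simp add: K_def)
    fix y \<delta> assume y: "y \<in> T ` S" and \<delta>: "(\<delta>::real) > 0"
    show "\<exists>x\<in>S. norm x \<le> K * norm y \<and> norm (y - T x) < \<delta>"
    proof (cases "y = 0")
      case True
      then show ?thesis using subspace_0[OF S] \<delta> by (intro bexI[of _ 0]) (auto simp: T.zero)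
    next
      case False
      define s where "s = \<epsilon> / (2 * norm y)"
      have s: "s > 0" using \<epsilon> False by (simp add: s_def)
      have "norm (s *\<^sub>R y) < \<epsilon>" using s False \<epsilon> by (simp add: s_def)
      moreover have "s *\<^sub>R y \<in> T ` S" using subspace_scale[OF TS y] .
      ultimately obtain x where x: "x \<in> S" "norm x \<le> 2 * real n" "norm (s *\<^sub>R y - T x) < s * \<delta>"
        using small[of "s *\<^sub>R y" "s * \<delta>"] s \<delta> by auto
      have "y - T (x /\<^sub>R s) = (s *\<^sub>R y - T x) /\<^sub>R s"
        using s by (simp add: T.scaleR scaleR_right_diff_distrib)
      then have "norm (y - T (x /\<^sub>R s)) < \<delta>" using x(3) s by (simp add: divide_simps mult.commute)
      moreover have "norm (x /\<^sub>R s) \<le> K * norm y"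
      proof -
        have "norm (x /\<^sub>R s) = norm x / s" using s by (simp add: divide_inverse mult.commute)
        also have "\<dots> \<le> 2 * (real n + 1) / s" using x(2) s by (intro divide_right_mono) auto
        also have "\<dots> = K * norm y" using False \<epsilon> by (simp add: s_def K_def field_simps)
        finally show ?thesis .
      qed
      ultimately show ?thesis using subspace_scale[OF S x(1)] by blast
    qed
  qed
qed

text \<open>Successive approximation: each step approximates the current residual within half of the
  previous error bound. The corrections form an absolutely convergent series whose sum stays in the
  closed subspace \<open>S\<close>.\<close>

lemma open_mapping_bound:
  fixes T :: "'a::banach \<Rightarrow> 'b::banach"
  assumes T: "bounded_linear T" and S: "subspace S" "closed S" and S': "closed (T ` S)"
  obtains K where "K > 0" "\<And>y. y \<in> T ` S \<Longrightarrow> \<exists>x\<in>S. T x = y \<and> norm x \<le> K * norm y"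
proof -
  interpret T: bounded_linear T by fact
  obtain K where K: "K > 0"
    "\<And>y \<delta>. y \<in> T ` S \<Longrightarrow> \<delta> > 0 \<Longrightarrow> \<exists>x\<in>S. norm x \<le> K * norm y \<and> norm (y - T x) < \<delta>"
    using almost_open_mapping[OF T S(1) S'] by blast
  have TS: "subspace (T ` S)" using S(1) T.linear_axioms linear_subspace_image by blast
  have "\<exists>x\<in>S. T x = y \<and> norm x \<le> 2 * K * norm y" if y: "y \<in> T ` S" for y
  proof (cases "y = 0")
    case True
    then show ?thesis using subspace_0[OF S(1)] by (intro bexI[of _ 0]) (auto simp: T.zero)
  next
    case False
    \<comment> \<open>\<open>d k\<close> bounds the residual after k steps and
      \<open>K * d k\<close> the next correction; the geometric sum is the origin of the constant
      2K.\<close>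
    define d where "d k = norm y / 2 ^ k" for k :: nat
    have d: "d k > 0" for k using False by (simp add: d_def)
    define P where "P k r \<longleftrightarrow> r \<in> T ` S \<and> norm r \<le> d k" for k r
    define Q where "Q k r r' \<longleftrightarrow> (\<exists>x\<in>S. norm x \<le> K * d k \<and> r' = r - T x)" for k :: nat and r r'
    have step: "\<exists>r'. P (Suc k) r' \<and> Q k r r'" if "P k r" for k r
    proof -
      obtain x where x: "x \<in> S" "norm x \<le> K * norm r" "norm (r - T x) < d (Suc k)"
        using K(2)[of r "d (Suc k)"] \<open>P k r\<close> d unfolding P_def by blast
      have "K * norm r \<le> K * d k" using \<open>P k r\<close> K(1) by (simp add: P_def)
      then have "norm x \<le> K * d k" using x(2) by linarith
      moreover have "r - T x \<in> T ` S" using subspace_diff[OF TS] \<open>P k r\<close> x(1) unfolding P_def by blast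
      ultimately show ?thesis using x unfolding P_def Q_def by (intro exI[of _ "r - T x"]) auto
    qed
    \<comment> \<open>The clause on k = 0 makes the chain of residuals start at
      \<open>y\<close>.\<close>
    have "\<exists>f. \<forall>k. (P k (f k) \<and> (k = 0 \<longrightarrow> f k = y)) \<and> Q k (f k) (f (Suc k))"
    proof (rule dependent_nat_choice)
      show "\<exists>x. P 0 x \<and> ((0::nat) = 0 \<longrightarrow> x = y)" 
        by (rule exI[of _ y]) (use y in \<open>simp add: P_def d_def\<close>)
      fix r k assume "P k r \<and> (k = 0 \<longrightarrow> r = y)"
      then show "\<exists>r'. (P (Suc k) r' \<and> (Suc k = 0 \<longrightarrow> r' = y)) \<and> Q k r r'" using step[of k r] by auto
    qed
    then obtain r where r: "\<And>k. P k (r k)" "\<And>k. Q k (r k) (r (Suc k))" "r 0 = y" by blast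
    have "\<exists>x. \<forall>k. x k \<in> S \<and> norm (x k) \<le> K * d k \<and> r (Suc k) = r k - T (x k)"
      by (rule choice) (use r(2) in \<open>auto simp: Q_def\<close>)
    then obtain x where x: "\<And>k. x k \<in> S" "\<And>k. norm (x k) \<le> K * d k"
      "\<And>k. r (Suc k) = r k - T (x k)" by blast
    have geo: "(\<lambda>k. K * d k) sums (2 * K * norm y)"
    proof -
      have "(\<lambda>k. K * norm y * (1 / 2) ^ k) sums (K * norm y * (1 / (1 - 1 / 2)))"
        by (intro sums_mult geometric_sums) simp
      moreover have "(\<lambda>k. K * d k) = (\<lambda>k. K * norm y * (1 / 2) ^ k)"
        by (simp add: d_def power_divide fun_eq_iff)
      moreover have "K * norm y * (1 / (1 - 1 / 2)) = 2 * K * norm y" by simp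
      ultimately show ?thesis by (simp only:)
    qed
    have sm: "summable (\<lambda>k. norm (x k))"
      by (rule summable_comparison_test'[OF sums_summable[OF geo], of 0]) (use x(2) in simp)
    then have sx: "summable x" by (rule summable_norm_cancel)
    have "(\<Sum>k<n. x k) \<in> S" for n by (rule subspace_sum[OF S(1)]) (use x(1) in auto)
    then have mem: "suminf x \<in> S"
      by (rule closed_sequentially[OF S(2) _ summable_LIMSEQ[OF sx]])
    have "(\<Sum>k<n. T (x k)) = y - r n" for n
      by (induction n) (simp_all add: r(3) x(3))
    moreover have "r \<longlonglongrightarrow> 0"
    proof (rule Lim_null_comparison)
      show "\<forall>\<^sub>F n in sequentially. norm (r n) \<le> d n" using r(1) by (simp add: P_def)
      have "(\<lambda>n. norm y * (1 / 2) ^ n) \<longlonglongrightarrow> norm y * 0" by (intro tendsto_mult tendsto_const LIMSEQ_power_zero) simp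
      moreover have "d = (\<lambda>n. norm y * (1 / 2) ^ n)" by (simp add: d_def power_divide fun_eq_iff)
      ultimately show "d \<longlonglongrightarrow> 0" by simp
    qed
    ultimately have "(\<lambda>n. \<Sum>k<n. T (x k)) \<longlonglongrightarrow> y - 0" by (simp only:) (intro tendsto_diff tendsto_const)
    then have "(\<lambda>k. T (x k)) sums y" by (simp add: sums_def)
    moreover have "(\<lambda>k. T (x k)) sums T (suminf x)" using T.sums[OF summable_sums[OF sx]] .
    ultimately have "T (suminf x) = y" by (rule sums_unique2[symmetric])
    moreover have "norm (suminf x) \<le> 2 * K * norm y"
    proof -
      have "norm (suminf x) \<le> (\<Sum>k. norm (x k))" by (rule summable_norm[OF sm])
      also have "\<dots> \<le> (\<Sum>k. K * d k)" by (rule suminf_le[OF x(2) sm sums_summable[OF geo]])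
      also have "\<dots> = 2 * K * norm y" using sums_unique[OF geo] by simp
      finally show ?thesis .
    qed
    ultimately show ?thesis using mem by blast
  qed
  then show thesis using that[of "2 * K"] K(1) by simp
qed

text \<open>Every x is T1 s1 + T2 s2, with norms controlled by that of x through the open mapping
  bound, and p x = T2 s2. The summands are given as images of closed subspaces because closedness of
  these images is what is to be derived.\<close>

lemma bounded_projection:
  fixes T\<^sub>1 :: "'b::complex_banach \<Rightarrow> 'a::complex_banach" and T\<^sub>2 :: "'c::complex_banach \<Rightarrow> 'a"
  assumes T: "bounded_clinear T\<^sub>1" "bounded_clinear T\<^sub>2"
    and S: "csubspace S\<^sub>1" "closed S\<^sub>1" "csubspace S\<^sub>2" "closed S\<^sub>2"
    and sum: "direct_sum (T\<^sub>1 ` S\<^sub>1) (T\<^sub>2 ` S\<^sub>2) UNIV"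
  obtains p where "bounded_clinear p" "\<And>x. p x \<in> T\<^sub>2 ` S\<^sub>2" "\<And>x. x - p x \<in> T\<^sub>1 ` S\<^sub>1"
    "\<And>x. x \<in> T\<^sub>2 ` S\<^sub>2 \<Longrightarrow> p x = x" "\<And>x. p x = 0 \<longleftrightarrow> x \<in> T\<^sub>1 ` S\<^sub>1"
proof -
  obtain p where p: "clinear p" "\<And>x. p x \<in> T\<^sub>2 ` S\<^sub>2" "\<And>x. x - p x \<in> T\<^sub>1 ` S\<^sub>1"
    "\<And>x. x \<in> T\<^sub>2 ` S\<^sub>2 \<Longrightarrow> p x = x" "\<And>x. p x = 0 \<longleftrightarrow> x \<in> T\<^sub>1 ` S\<^sub>1"
    using direct_sum_projection[OF sum] by blast
  let ?T = "\<lambda>z. T\<^sub>1 (fst z) + T\<^sub>2 (snd z)"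
  have bT: "bounded_clinear ?T"
    by (intro bounded_clinear_add bounded_clinear_compose[OF T(1)] bounded_clinear_compose[OF T(2)]
        bounded_clinear_fst bounded_clinear_snd)
  have surj: "?T ` (S\<^sub>1 \<times> S\<^sub>2) = UNIV"
  proof -
    have "x \<in> ?T ` (S\<^sub>1 \<times> S\<^sub>2)" for x
    proof -
      obtain s1 s2 where "s1 \<in> S\<^sub>1" "s2 \<in> S\<^sub>2" "x = T\<^sub>1 s1 + T\<^sub>2 s2" using direct_sumD(7)[OF sum, of x] by blast
      then show ?thesis by (intro image_eqI[of _ _ "(s1, s2)"]) auto
    qed
    then show ?thesis by blast
  qed
  obtain K where K: "K > 0" "\<And>x. \<exists>z\<in>S\<^sub>1 \<times> S\<^sub>2. ?T z = x \<and> norm z \<le> K * norm x"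
    using open_mapping_bound[OF bounded_clinear_bounded_linear[OF bT], of "S\<^sub>1 \<times> S\<^sub>2"] S
    unfolding surj by (auto simp: csubspace_imp_subspace csubspace_Times closed_Times)
  obtain K2 where K2: "\<And>y. norm (T\<^sub>2 y) \<le> norm y * K2" "K2 > 0"
    using bounded_linear.pos_bounded[OF bounded_clinear_bounded_linear[OF T(2)]] by blast
  have "norm (p x) \<le> (K * K2) * norm x" for x
  proof -
    obtain z where z: "z \<in> S\<^sub>1 \<times> S\<^sub>2" "?T z = x" "norm z \<le> K * norm x" using K(2) by blast
    have "p x = p (T\<^sub>1 (fst z)) + p (T\<^sub>2 (snd z))" using z(2) clin.linear_add[OF p(1)] by metis
    also have "p (T\<^sub>1 (fst z)) = 0" using z(1) p(5) by auto
    also have "p (T\<^sub>2 (snd z)) = T\<^sub>2 (snd z)" using z(1) p(4) by auto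
    finally have "norm (p x) \<le> norm (snd z) * K2" using K2(1) by simp
    also have "\<dots> \<le> norm z * K2" using K2(2) norm_snd_le[of "snd z" "fst z"] by simp
    also have "\<dots> \<le> (K * norm x) * K2" using z(3) K2(2) by simp
    finally show ?thesis by (simp add: mult_ac)
  qed
  then have "bounded_clinear p" using p(1) by (auto simp: bounded_clinear_def)
  then show thesis using that p by blast
qed

text \<open>The image is the kernel of a bounded projection. Ranges are shown to be closed in this
  way: it is enough to exhibit an algebraic complement that is again a bounded image of a closed
  subspace.\<close>

lemma closed_image_complement:
  fixes T\<^sub>1 :: "'b::complex_banach \<Rightarrow> 'a::complex_banach" and T\<^sub>2 :: "'c::complex_banach \<Rightarrow> 'a"
  assumes "bounded_clinear T\<^sub>1" "bounded_clinear T\<^sub>2"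
    and "csubspace S\<^sub>1" "closed S\<^sub>1" "csubspace S\<^sub>2" "closed S\<^sub>2"
    and "direct_sum (T\<^sub>1 ` S\<^sub>1) (T\<^sub>2 ` S\<^sub>2) UNIV"
  shows "closed (T\<^sub>1 ` S\<^sub>1)"
proof -
  obtain p :: "'a \<Rightarrow> 'a" where p: "bounded_clinear p" "\<And>x. p x = 0 \<longleftrightarrow> x \<in> T\<^sub>1 ` S\<^sub>1"
    by (rule bounded_projection[OF assms]) blast
  then have "T\<^sub>1 ` S\<^sub>1 = ker p" by (auto simp: ker_def)
  then show ?thesis using closed_ker[OF p(1)] by simp
qed

lemma bounded_projection_closed:
  fixes U L :: "'a::complex_banach set"
  assumes "direct_sum U L UNIV" "closed U" "closed L"
  obtains p where "bounded_clinear p" "\<And>x. p x \<in> L" "\<And>x. x - p x \<in> U"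
    "\<And>x. x \<in> L \<Longrightarrow> p x = x" "\<And>x. p x = 0 \<longleftrightarrow> x \<in> U"
  by (rule bounded_projection[OF bounded_clinear_ident bounded_clinear_ident, of U L])
    (use assms direct_sumD(1,2)[OF assms(1)] in auto)

subsection \<open>The Hahn--Banach theorem and finite-dimensional subspaces\<close>

text \<open>Zorn's lemma is applied to graphs; a subspace of pairs dominated by the norm is automatically
  single-valued.\<close>

definition norm_dominated :: "('a::real_normed_vector \<times> real) set \<Rightarrow> bool" where
  "norm_dominated G \<longleftrightarrow> subspace G \<and> (\<forall>(x, r)\<in>G. r \<le> norm x)"

text \<open>The one-dimensional step of Hahn-Banach. A value \<open>a\<close> at \<open>x0\<close>
  is admissible if it lies between all r - |x - x0| and all |x' + x0| - r'; the supremum of the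
  former qualifies. Homogeneity reduces y + c x0 to c = 1 or c = -1.\<close>

lemma norm_dominated_extend:
  assumes G: "norm_dominated G"
  obtains a G' where "norm_dominated G'" "G \<subseteq> G'" "(x0, a) \<in> G'"
proof -
  have sG: "subspace G" and le: "\<And>x r. (x, r) \<in> G \<Longrightarrow> r \<le> norm x"
    using G by (auto simp: norm_dominated_def)
  let ?R = "{r - norm (x - x0) | x r. (x, r) \<in> G}"
  have bound: "r - norm (x - x0) \<le> norm (x' + x0) - r'" if "(x, r) \<in> G" "(x', r') \<in> G" for x r x' r'
  proof -
    have "(x + x', r + r') \<in> G" using subspace_add[OF sG that] by simp
    then have "r + r' \<le> norm ((x - x0) + (x' + x0))" using le by fastforce
    also have "\<dots> \<le> norm (x - x0) + norm (x' + x0)" by (rule norm_triangle_ineq)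
    finally show ?thesis by simp
  qed
  have zero: "(0, 0) \<in> G" using subspace_0[OF sG] by (simp add: zero_prod_def)
  define a where "a = Sup ?R"
  have bdd: "bdd_above ?R" using bound[OF _ zero] by (auto intro!: bdd_aboveI)
  have lower: "r - norm (x - x0) \<le> a" if "(x, r) \<in> G" for x r
    unfolding a_def by (rule cSup_upper[OF _ bdd]) (use that in blast)
  have upper: "a \<le> norm (x' + x0) - r'" if "(x', r') \<in> G" for x' r'
    unfolding a_def by (rule cSup_least) (use bound[OF _ that] zero in blast)+
  let ?G' = "{g + l | g l. g \<in> G \<and> l \<in> span {(x0, a)}}"
  have "subspace ?G'" by (intro subspace_sums sG subspace_span)
  moreover have "r \<le> norm x" if xr: "(x, r) \<in> ?G'" for x r
  proof -
    obtain y s c where g: "(y, s) \<in> G" "x = y + c *\<^sub>R x0" "r = s + c * a"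
      using xr by (auto simp: span_singleton)
    have sc: "(y /\<^sub>R d, s / d) \<in> G" for d
      using subspace_scale[OF sG g(1), of "inverse d"] by (simp add: divide_inverse mult.commute)
    consider "c = 0" | "c > 0" | "c < 0" by linarith
    then show ?thesis
    proof cases
      case 1 then show ?thesis using g le by simp
    next
      case 2
      have "c * a \<le> c * (norm (y /\<^sub>R c + x0) - s / c)" using upper[OF sc] 2 by simp
      also have "\<dots> = norm (c *\<^sub>R (y /\<^sub>R c + x0)) - s" using 2 by (simp add: right_diff_distrib)
      also have "c *\<^sub>R (y /\<^sub>R c + x0) = x" using 2 g(2) by (simp add: scaleR_add_right)
      finally show ?thesis using g(3) by simp
    next
      case 3
      define d where "d = - c"
      have d: "d > 0" using 3 by (simp add: d_def)
      have "s - norm (d *\<^sub>R (y /\<^sub>R d - x0)) = d * (s / d - norm (y /\<^sub>R d - x0))"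
        using d by (simp add: right_diff_distrib)
      also have "\<dots> \<le> d * a" using lower[OF sc] d by simp
      also have "d *\<^sub>R (y /\<^sub>R d - x0) = x" using d g(2) by (simp add: scaleR_diff_right d_def)
      finally show ?thesis using g(3) by (simp add: d_def)
    qed
  qed
  ultimately have "norm_dominated ?G'" unfolding norm_dominated_def by blast
  moreover have "G \<subseteq> ?G'"
  proof
    fix g assume "g \<in> G"
    moreover have "g = g + 0" by simp
    ultimately show "g \<in> ?G'" using span_zero[of "{(x0, a)}"] by blast
  qed
  moreover have "(x0, a) \<in> ?G'"
  proof -
    have "(x0, a) = (0, 0) + (x0, a)" by simp
    then show ?thesis using zero span_base[of "(x0, a)" "{(x0, a)}"] by blast
  qed
  ultimately show thesis by (rule that)
qed

text \<open>A maximal dominated graph through (v, norm v) has a value at every point, as it would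
  otherwise admit an extension, and so is the graph of a linear functional.\<close>

lemma real_norming_functional:
  fixes v :: "'a::real_normed_vector"
  obtains f :: "'a \<Rightarrow> real" where "linear f" "f v = norm v" "\<And>x. f x \<le> norm x"
proof -
  let ?A = "{G. norm_dominated G \<and> (v, norm v) \<in> G}"
  have "span {(v, norm v)} \<in> ?A"
  proof -
    have "c * norm v \<le> norm (c *\<^sub>R v)" for c :: real by (simp add: mult_right_mono)
    then have "\<forall>(x, r)\<in>span {(v, norm v)}. r \<le> norm x" by (auto simp: span_singleton)
    then show ?thesis by (simp add: norm_dominated_def span_base)
  qed
  then have ne: "?A \<noteq> {}" by blast
  have "\<exists>M\<in>?A. \<forall>X\<in>?A. M \<subseteq> X \<longrightarrow> X = M"
  proof (rule subset_Zorn_nonempty[OF ne])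
    fix \<C> assume C: "\<C> \<noteq> {}" "subset.chain ?A \<C>"
    then have sub: "\<And>G. G \<in> \<C> \<Longrightarrow> norm_dominated G \<and> (v, norm v) \<in> G"
      and ch: "\<And>G H. G \<in> \<C> \<Longrightarrow> H \<in> \<C> \<Longrightarrow> G \<subseteq> H \<or> H \<subseteq> G"
      by (auto simp: subset.chain_def)
    have "subspace (\<Union>\<C>)"
      unfolding real_vector.subspace_def
    proof (intro conjI allI ballI)
      show "0 \<in> \<Union>\<C>" using C(1) sub subspace_0 unfolding norm_dominated_def by blast
    next
      fix x y assume "x \<in> \<Union>\<C>" "y \<in> \<Union>\<C>"
      then obtain G H where GH: "G \<in> \<C>" "H \<in> \<C>" "x \<in> G" "y \<in> H" by blast
      then obtain I where "I \<in> \<C>" "x \<in> I" "y \<in> I" using ch[OF GH(1,2)] by blast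
      then show "x + y \<in> \<Union>\<C>" using sub[of I] subspace_add[of I x y] unfolding norm_dominated_def by blast
    next
      fix c :: real and x assume "x \<in> \<Union>\<C>"
      then obtain G where "G \<in> \<C>" "x \<in> G" by blast
      then show "c *\<^sub>R x \<in> \<Union>\<C>" using sub[of G] subspace_scale[of G x c] unfolding norm_dominated_def by blast
    qed
    then show "\<Union>\<C> \<in> ?A" using C(1) sub unfolding norm_dominated_def by blast
  qed
  then obtain G where G: "norm_dominated G" "(v, norm v) \<in> G"
    and max: "\<And>H. norm_dominated H \<Longrightarrow> G \<subseteq> H \<Longrightarrow> H = G" by blast
  have sG: "subspace G" and le: "\<And>x r. (x, r) \<in> G \<Longrightarrow> r \<le> norm x"
    using G by (auto simp: norm_dominated_def)
  have total: "\<exists>r. (x, r) \<in> G" for x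
  proof -
    obtain a G' where "norm_dominated G'" "G \<subseteq> G'" "(x, a) \<in> G'"
      using norm_dominated_extend[OF G(1)] by blast
    then show ?thesis using max by blast
  qed
  \<comment> \<open>Both (0, r - s) and (0, s - r) lie in the graph, so neither number exceeds the
    norm of 0.\<close>
  have single: "r = s" if "(x, r) \<in> G" "(x, s) \<in> G" for x r s
    using le[of 0 "r - s"] le[of 0 "s - r"] subspace_diff[OF sG that] subspace_diff[OF sG that(2,1)]
    by simp
  obtain f where f: "\<And>x. (x, f x) \<in> G" using total by metis
  show thesis
  proof (rule that[of f])
    show "linear f"
    proof (rule linearI)
      fix x y show "f (x + y) = f x + f y"
        using single[OF f] subspace_add[OF sG f f, of x y] by simp
    next
      fix c x show "f (c *\<^sub>R x) = c *\<^sub>R f x"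
        using single[OF f] subspace_scale[OF sG f, of c x] by simp
    qed
    show "f v = norm v" using single[OF f G(2)] .
    show "f x \<le> norm x" for x using le f by blast
  qed
qed

section \<open>Complex functionals and biorthogonal systems\<close>

text \<open>Written out because \<open>bounded_clinear\<close> asks for a codomain in
  \<open>complex_normed_vector\<close>, and \<open>complex\<close> is not made an instance of that
  class.\<close>

definition bounded_functional :: "('a::complex_normed_vector \<Rightarrow> complex) \<Rightarrow> bool" where
  "bounded_functional \<phi> \<longleftrightarrow> (\<forall>x y. \<phi> (x + y) = \<phi> x + \<phi> y) \<and> (\<forall>c x. \<phi> (c *\<^sub>C x) = c * \<phi> x) \<and>
     (\<exists>K. \<forall>x. cmod (\<phi> x) \<le> K * norm x)"

text \<open>A complex functional is determined by its real part f as f x - i f(i x). Its real part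
  at \<open>v\<close> is the norm of \<open>v\<close>, hence nonzero.\<close>

lemma norming_functional:
  fixes v :: "'a::complex_normed_vector"
  assumes "v \<noteq> 0"
  obtains \<phi> where "bounded_functional \<phi>" "\<phi> v \<noteq> 0"
proof -
  obtain f :: "'a \<Rightarrow> real" where f: "linear f" "f v = norm v" "\<And>x. f x \<le> norm x"
    using real_norming_functional[of v] by metis
  have abs: "\<bar>f x\<bar> \<le> norm x" for x
    using f(3)[of x] f(3)[of "- x"] linear_neg[OF f(1), of x] by simp
  define \<phi> where "\<phi> x = Complex (f x) (- f (\<i> *\<^sub>C x))" for x
  have add: "\<phi> (x + y) = \<phi> x + \<phi> y" for x y
    by (simp add: \<phi>_def scaleC_add_right linear_add[OF f(1)] complex_eq_iff)
  have real: "f (complex_of_real r *\<^sub>C x) = r * f x" for r x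
    using linear_scale[OF f(1), of r x] by (simp add: scaleR_scaleC)
  have scale: "\<phi> (c *\<^sub>C x) = c * \<phi> x" for c x
  proof -
    have "c = complex_of_real (Re c) + complex_of_real (Im c) * \<i>" by (simp add: complex_eq_iff)
    then have "c *\<^sub>C x = complex_of_real (Re c) *\<^sub>C x + complex_of_real (Im c) *\<^sub>C \<i> *\<^sub>C x"
      by (metis scaleC_add_left scaleC_scaleC)
    moreover have "\<i> * c = complex_of_real (Re c) * \<i> + complex_of_real (- Im c)"
      by (simp add: complex_eq_iff)
    then have "\<i> *\<^sub>C c *\<^sub>C x = complex_of_real (Re c) *\<^sub>C \<i> *\<^sub>C x + complex_of_real (- Im c) *\<^sub>C x"
      by (metis scaleC_add_left scaleC_scaleC)
    ultimately have "f (c *\<^sub>C x) = Re c * f x + Im c * f (\<i> *\<^sub>C x)"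
      "f (\<i> *\<^sub>C c *\<^sub>C x) = Re c * f (\<i> *\<^sub>C x) + (- Im c) * f x"
      using real by (metis linear_add[OF f(1)])+
    then show ?thesis by (simp add: \<phi>_def complex_eq_iff)
  qed
  have "cmod (\<phi> x) \<le> 2 * norm x" for x
    using cmod_le[of "\<phi> x"] abs[of x] abs[of "\<i> *\<^sub>C x"] by (simp add: \<phi>_def norm_scaleC)
  then have "bounded_functional \<phi>" unfolding bounded_functional_def using add scale by blast
  moreover have "\<phi> v \<noteq> 0" using f(2) assms by (simp add: \<phi>_def complex_eq_iff)
  ultimately show thesis by (rule that)
qed

lemma bounded_clinear_rank_one:
  assumes "bounded_functional \<phi>"
  shows "bounded_clinear (\<lambda>x. \<phi> x *\<^sub>C v)"
  unfolding bounded_clinear_def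
proof
  show "clinear (\<lambda>x. \<phi> x *\<^sub>C v)"
    using assms by (intro clinearI) (simp_all add: bounded_functional_def scaleC_add_left)
  obtain K where "\<And>x. cmod (\<phi> x) \<le> K * norm x"
    using assms unfolding bounded_functional_def by blast
  then have "norm (\<phi> x *\<^sub>C v) \<le> K * norm v * norm x" for x
    using mult_right_mono[of "cmod (\<phi> x)" "K * norm x" "norm v"] by (simp add: norm_scaleC mult_ac)
  then show "\<exists>K. \<forall>x. norm (\<phi> x *\<^sub>C v) \<le> K * norm x" by blast
qed

lemma bounded_functional_compose:
  assumes \<phi>: "bounded_functional \<phi>" and T: "bounded_clinear T"
  shows "bounded_functional (\<lambda>x. \<phi> (T x))"
proof -
  obtain K where K: "\<And>x. cmod (\<phi> x) \<le> K * norm x"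
    using \<phi> unfolding bounded_functional_def by blast
  obtain J where J: "\<And>x. norm (T x) \<le> norm x * J"
    using bounded_linear.bounded[OF bounded_clinear_bounded_linear[OF T]] by blast
  have "cmod (\<phi> (T x)) \<le> (\<bar>K\<bar> * J) * norm x" for x
  proof -
    have "cmod (\<phi> (T x)) \<le> \<bar>K\<bar> * norm (T x)"
      by (rule order_trans[OF K]) (simp add: mult_right_mono)
    also have "\<dots> \<le> \<bar>K\<bar> * (norm x * J)" using J by (intro mult_left_mono) auto
    finally show ?thesis by (simp add: mult_ac)
  qed
  then show ?thesis
    using \<phi> clin.linear_add[OF bounded_clinear_clinear[OF T]] clin.linear_scale[OF bounded_clinear_clinear[OF T]]
    unfolding bounded_functional_def by auto
qed

lemma bounded_functional_linear_combination:
  assumes "bounded_functional \<phi>" "bounded_functional \<psi>"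
  shows "bounded_functional (\<lambda>x. \<phi> x - \<psi> x * c)"
proof -
  obtain K where K: "\<And>x. cmod (\<phi> x) \<le> K * norm x"
    using assms(1) unfolding bounded_functional_def by blast
  obtain J where J: "\<And>x. cmod (\<psi> x) \<le> J * norm x"
    using assms(2) unfolding bounded_functional_def by blast
  have "cmod (\<phi> x - \<psi> x * c) \<le> (K + J * cmod c) * norm x" for x
  proof -
    have "cmod (\<phi> x - \<psi> x * c) \<le> cmod (\<phi> x) + cmod (\<psi> x) * cmod c"
      using norm_triangle_ineq4[of "\<phi> x" "\<psi> x * c"] by (simp add: norm_mult)
    also have "\<dots> \<le> K * norm x + J * norm x * cmod c" by (intro add_mono K mult_right_mono J) simp
    finally show ?thesis by (simp add: algebra_simps)
  qed
  then have "\<exists>K. \<forall>x. cmod (\<phi> x - \<psi> x * c) \<le> K * norm x" by blast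
  then show ?thesis
    using assms unfolding bounded_functional_def by (simp add: algebra_simps)
qed

lemma bounded_functional_sum:
  assumes "bounded_functional \<phi>" "finite I"
  shows "\<phi> (\<Sum>i\<in>I. f i *\<^sub>C g i) = (\<Sum>i\<in>I. f i * \<phi> (g i))"
proof -
  have add: "\<phi> (x + y) = \<phi> x + \<phi> y" and scale: "\<phi> (c *\<^sub>C x) = c * \<phi> x" for c x y
    using assms(1) unfolding bounded_functional_def by blast+
  have "\<phi> 0 = 0" using scale[of 0 0] by simp
  show ?thesis using assms(2) by (induction I rule: finite_induct) (simp_all add: \<open>\<phi> 0 = 0\<close> add scale)
qed

text \<open>An orthogonalisation step. With P the projection onto the span of \<open>B\<close> built
  from the old functionals, a functional nonzero at b - P b yields an \<omega> that vanishes on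
  \<open>B\<close> and is 1 at \<open>b\<close>; multiples of \<omega> are then subtracted from the
  old functionals to make them vanish at \<open>b\<close>.\<close>

lemma biorthogonal_functionals:
  fixes B :: "'a::complex_normed_vector set"
  assumes "finite B" "cindependent B"
  shows "\<exists>\<phi>. \<forall>b\<in>B. bounded_functional (\<phi> b) \<and> (\<forall>c\<in>B. \<phi> b c = (if b = c then 1 else 0))"
  using assms
proof (induction B rule: finite_induct)
  case empty then show ?case by simp
next
  case (insert b B)
  have i: "cindependent B" "b \<notin> cspan B"
    using insert.prems insert.hyps(2) by (simp_all add: complex_vector.independent_insert)
  obtain \<phi> where \<phi>: "\<And>c. c \<in> B \<Longrightarrow> bounded_functional (\<phi> c)"
    "\<And>c d. c \<in> B \<Longrightarrow> d \<in> B \<Longrightarrow> \<phi> c d = (if c = d then 1 else 0)"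
    using insert.IH[OF i(1)] by blast
  define P where "P x = (\<Sum>c\<in>B. \<phi> c x *\<^sub>C c)" for x
  have bP: "bounded_clinear (\<lambda>x. x - P x)"
    unfolding P_def by (intro bounded_clinear_diff bounded_clinear_ident bounded_clinear_sum
        bounded_clinear_rank_one \<phi>)
  have P: "P d = d" if "d \<in> B" for d
  proof -
    have "P d = (\<Sum>c\<in>B. if c = d then d else 0)" unfolding P_def
      by (intro sum.cong) (auto simp: \<phi>(2) that)
    then show ?thesis using that insert.hyps(1) by simp
  qed
  have "P b \<in> cspan B" unfolding P_def
    by (intro complex_vector.span_sum complex_vector.span_scale complex_vector.span_base)
  then have "b - P b \<noteq> 0" using i(2) by auto
  then obtain \<psi> where \<psi>: "bounded_functional \<psi>" "\<psi> (b - P b) \<noteq> 0" by (rule norming_functional)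
  define \<omega> where "\<omega> x = \<psi> ((1 / \<psi> (b - P b)) *\<^sub>C (x - P x))" for x
  have \<omega>: "bounded_functional \<omega>" unfolding \<omega>_def
    by (rule bounded_functional_compose[OF \<psi>(1)])
      (rule bounded_clinear_compose[OF bounded_clinear_scaleC bP])
  have \<omega>_eq: "\<omega> x = \<psi> (x - P x) / \<psi> (b - P b)" for x
    using \<psi>(1) unfolding \<omega>_def bounded_functional_def by simp
  have \<omega>_b: "\<omega> b = 1" using \<psi>(2) by (simp add: \<omega>_eq)
  have "\<psi> 0 = 0" using \<psi>(1) unfolding bounded_functional_def by (metis add_cancel_left_left)
  then have \<omega>_B: "\<omega> c = 0" if "c \<in> B" for c using P[OF that] by (simp add: \<omega>_eq)
  define \<phi>' where "\<phi>' c x = (if c = b then \<omega> x else \<phi> c x - \<omega> x * \<phi> c b)" for c x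
  have "bounded_functional (\<phi>' c)" if "c \<in> insert b B" for c
  proof (cases "c = b")
    case True then show ?thesis using \<omega> by (simp add: \<phi>'_def[abs_def])
  next
    case False
    then have "\<phi>' c = (\<lambda>x. \<phi> c x - \<omega> x * \<phi> c b)" by (simp add: \<phi>'_def fun_eq_iff)
    then show ?thesis using bounded_functional_linear_combination[OF \<phi>(1) \<omega>] False that by simp
  qed
  moreover have "\<phi>' c d = (if c = d then 1 else 0)" if "c \<in> insert b B" "d \<in> insert b B" for c d
    using that insert.hyps(2) \<omega>_b \<omega>_B \<phi>(2) by (auto simp: \<phi>'_def)
  ultimately show ?case by blast
qed

lemma biorthogonal_expansion:
  assumes B: "finite B" and \<phi>: "\<And>b. b \<in> B \<Longrightarrow> bounded_functional (\<phi> b)"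
    "\<And>b c. b \<in> B \<Longrightarrow> c \<in> B \<Longrightarrow> \<phi> b c = (if b = c then 1 else 0)"
    and x: "x \<in> cspan B"
  shows "(\<Sum>b\<in>B. \<phi> b x *\<^sub>C b) = x"
proof -
  obtain u where u: "x = (\<Sum>b\<in>B. u b *\<^sub>C b)" using x complex_vector.span_finite[OF B] by auto
  have "\<phi> b x = u b" if b: "b \<in> B" for b
  proof -
    have "\<phi> b x = (\<Sum>c\<in>B. u c * \<phi> b c)" unfolding u by (rule bounded_functional_sum[OF \<phi>(1)[OF b] B])
    also have "\<dots> = (\<Sum>c\<in>B. if c = b then u b else 0)" by (intro sum.cong) (auto simp: \<phi>(2)[OF b])
    finally show ?thesis using B b by simp
  qed
  then show ?thesis unfolding u by simp
qed

section \<open>Bounded projections onto finite-dimensional subspaces\<close>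

lemma finite_dimensional_projection:
  assumes "csubspace S" "cdim S < \<infinity>"
  obtains P where "bounded_clinear P" "\<And>x. P x \<in> S" "\<And>x. x \<in> S \<Longrightarrow> P x = x"
proof -
  obtain B where B: "finite B" "cindependent B" "cspan B = S"
    using cdim_finite_obtain_basis[OF assms] by blast
  obtain \<phi> where \<phi>: "\<And>b. b \<in> B \<Longrightarrow> bounded_functional (\<phi> b)"
    "\<And>b c. b \<in> B \<Longrightarrow> c \<in> B \<Longrightarrow> \<phi> b c = (if b = c then 1 else 0)"
    using biorthogonal_functionals[OF B(1,2)] by blast
  show thesis
  proof (rule that[of "\<lambda>x. \<Sum>b\<in>B. \<phi> b x *\<^sub>C b"])
    show "bounded_clinear (\<lambda>x. \<Sum>b\<in>B. \<phi> b x *\<^sub>C b)"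
      by (intro bounded_clinear_sum bounded_clinear_rank_one \<phi>)
    show "(\<Sum>b\<in>B. \<phi> b x *\<^sub>C b) \<in> S" for x unfolding B(3)[symmetric]
      by (intro complex_vector.span_sum complex_vector.span_scale complex_vector.span_base)
    show "(\<Sum>b\<in>B. \<phi> b x *\<^sub>C b) = x" if "x \<in> S" for x
      using biorthogonal_expansion[OF B(1) \<phi>] that B(3) by blast
  qed
qed

lemma finite_dimensional_closed:
  assumes "csubspace S" "cdim S < \<infinity>"
  shows "closed S"
proof -
  obtain P where P: "bounded_clinear P" "\<And>x. P x \<in> S" "\<And>x. x \<in> S \<Longrightarrow> P x = x"
    by (rule finite_dimensional_projection[OF assms]) (rule that)
  have "S = ker (\<lambda>x. x - P x)"
  proof (intro equalityI subsetI)
    fix x assume "x \<in> ker (\<lambda>x. x - P x)"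
    then have "x = P x" by (simp add: ker_def)
    then show "x \<in> S" using P(2) by metis
  qed (simp add: ker_def P(3))
  then show ?thesis using closed_ker[OF bounded_clinear_diff[OF bounded_clinear_ident P(1)]] by simp
qed

text \<open>The complement is the part of \<open>L\<close> annihilated by a bounded projection onto
  \<open>H\<close>. The projection is returned as well, since x - P x is then a bounded map of
  \<open>L\<close> onto the complement.\<close>

lemma closed_complement_exists:
  assumes "csubspace H" "cdim H < \<infinity>" "csubspace L" "closed L" "H \<subseteq> L"
  obtains L' P where "direct_sum H L' L" "closed L'" "bounded_clinear P"
    "\<And>x. x \<in> H \<Longrightarrow> P x = x" "\<And>x. x \<in> L' \<Longrightarrow> P x = 0"
proof -
  obtain P where P: "bounded_clinear P" "\<And>x. P x \<in> H" "\<And>x. x \<in> H \<Longrightarrow> P x = x"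
    by (rule finite_dimensional_projection[OF assms(1,2)]) (rule that)
  let ?L = "{x \<in> L. P x \<in> {0}}"
  show thesis
  proof (rule that)
    show "bounded_clinear P" "\<And>x. x \<in> H \<Longrightarrow> P x = x" "\<And>x. x \<in> ?L \<Longrightarrow> P x = 0"
      using P by simp_all
    show "closed ?L" by (intro bounded_clinear_closed_vimage P assms) simp
    show "direct_sum H ?L L"
    proof (rule direct_sumI)
      show "csubspace ?L"
        by (intro csubspace_vimage_kernel bounded_clinear_clinear[OF P(1)] assms) simp
      fix x
      show "x = 0" if "x \<in> H" "x \<in> ?L" using that P(3) by auto
      assume x: "x \<in> L"
      have "P x \<in> L" using P(2) assms(5) by blast
      then have "x - P x \<in> L" using complex_vector.subspace_diff[OF assms(3) x] by blast
      moreover have "P (x - P x) = 0"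
        using clin.linear_diff[OF bounded_clinear_clinear[OF P(1)], of x "P x"] P(2,3) by simp
      moreover have "x = P x + (x - P x)" by simp
      ultimately show "\<exists>u\<in>H. \<exists>l\<in>?L. x = u + l" using P(2) by blast
    qed (use assms in auto)
  qed
qed

subsection \<open>Criteria for Browder operators\<close>

text \<open>Upper bounds need no exact complement: if \<open>W\<close> meets every coset of the
  range, a projection along the range maps it onto a complement.\<close>

lemma beta_le_cdim:
  fixes T :: "'a::complex_normed_vector \<Rightarrow> 'a"
  assumes T: "clinear T" and W: "csubspace W" and "\<And>z. \<exists>w\<in>W. z - w \<in> range T"
  shows "beta T \<le> cdim W"
proof -
  obtain L where L: "direct_sum (range T) L UNIV" using range_complement_exists[OF T] .
  obtain p :: "'a \<Rightarrow> 'a" where p: "clinear p" "\<And>x. x \<in> L \<Longrightarrow> p x = x" "\<And>x. p x = 0 \<longleftrightarrow> x \<in> range T"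
    by (rule direct_sum_projection[OF L]) (rule that)
  have "L \<subseteq> p ` W"
  proof
    fix l assume "l \<in> L"
    obtain w where w: "w \<in> W" "l - w \<in> range T" using assms(3) by blast
    have "p l = p w" using w(2) p(3)[of "l - w"] clin.linear_diff[OF p(1), of l w] by simp
    then show "l \<in> p ` W" using p(2)[OF \<open>l \<in> L\<close>] w(1) by force
  qed
  then have "cdim L \<le> cdim (p ` W)"
    using cdim_mono[OF direct_sumD(2)[OF L] clin.linear_subspace_image[OF p(1) W]] by blast
  also have "\<dots> \<le> cdim W" by (rule cdim_image_le[OF p(1) W])
  finally show ?thesis using beta_eq_cdim[OF L] by simp
qed

text \<open>\<open>T\<close> maps N(T^(k+1)) into N(T^k), with kernel inside N(T). The estimate
  involves \<open>alpha\<close> alone, as it is meant for a left semi-Fredholm operator, whose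
  \<open>beta\<close> may be infinite.\<close>

lemma alpha_funpow_finite:
  assumes T: "clinear T" and fin: "alpha T < \<infinity>"
  shows "alpha (T ^^ k) < \<infinity>"
proof (induction k)
  case 0 show ?case by (simp add: alpha_beta_id id_def[symmetric])
next
  case (Suc k)
  let ?N = "ker (T ^^ Suc k)"
  have N: "csubspace ?N" by (rule csubspace_ker[OF clinear_funpow[OF T]])
  have "{x \<in> ?N. T x = 0} \<subseteq> ker T" by (auto simp: ker_def)
  moreover have "csubspace {x \<in> ?N. T x \<in> {0}}" by (rule csubspace_vimage_kernel[OF T _ N]) simp
  ultimately have "cdim {x \<in> ?N. T x = 0} \<le> alpha T"
    unfolding alpha_def by (intro cdim_mono csubspace_ker[OF T]) simp_all
  moreover have "T ` ?N \<subseteq> ker (T ^^ k)" by (auto simp: ker_def funpow_swap1)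
  then have "cdim (T ` ?N) \<le> alpha (T ^^ k)"
    unfolding alpha_def by (intro cdim_mono csubspace_ker[OF clinear_funpow[OF T]] clin.linear_subspace_image[OF T N])
  ultimately have "alpha (T ^^ Suc k) \<le> alpha T + alpha (T ^^ k)"
    using cdim_rank_nullity[OF T N] unfolding alpha_def[of "T ^^ Suc k"] by (simp add: add_mono)
  also have "\<dots> < \<infinity>" using fin Suc by (cases "alpha T"; cases "alpha (T ^^ k)") auto
  finally show ?case .
qed

text \<open>The dual estimate: if \<open>F\<close> complements R(T) and \<open>L\<close> complements
  R(T^k), then T^k(F) + L meets every coset of R(T^(k+1)).\<close>

lemma beta_funpow_finite:
  fixes T :: "'a::complex_normed_vector \<Rightarrow> 'a"
  assumes T: "clinear T" and fin: "beta T < \<infinity>"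
  shows "beta (T ^^ k) < \<infinity>"
proof (induction k)
  case 0 show ?case by (simp add: alpha_beta_id id_def[symmetric])
next
  case (Suc k)
  obtain F where F: "direct_sum (range T) F UNIV" using range_complement_exists[OF T] .
  obtain L where L: "direct_sum (range (T ^^ k)) L UNIV"
    using range_complement_exists[OF clinear_funpow[OF T]] .
  let ?S = "T ^^ k"
  have S: "clinear ?S" by (rule clinear_funpow[OF T])
  let ?W = "{s + l | s l. s \<in> ?S ` F \<and> l \<in> L}"
  have W: "csubspace ?W"
    by (intro complex_vector.subspace_sums clin.linear_subspace_image[OF S] direct_sumD(2)[OF F] direct_sumD(2)[OF L])
  have "\<exists>w\<in>?W. z - w \<in> range (T ^^ Suc k)" for z
  proof -
    obtain x l where z: "l \<in> L" "z = ?S x + l" using direct_sumD(7)[OF L, of z] by blast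
    obtain y f where x: "f \<in> F" "x = T y + f" using direct_sumD(7)[OF F, of x] by blast
    have "z - (?S f + l) = (T ^^ Suc k) y"
      using z x by (simp add: clin.linear_add[OF S] funpow_swap1)
    then show ?thesis using z x by blast
  qed
  then have "beta (T ^^ Suc k) \<le> cdim ?W" by (rule beta_le_cdim[OF clinear_funpow[OF T] W])
  also have "\<dots> \<le> cdim (?S ` F \<times> L)"
  proof -
    have "?W = (\<lambda>p. fst p + snd p) ` (?S ` F \<times> L)" by force
    moreover have "clinear (\<lambda>p. fst p + snd p :: 'a)"
      by (rule clinearI) (simp_all add: scaleC_add_right add_ac)
    ultimately show ?thesis
      using cdim_image_le[OF _ csubspace_Times[OF clin.linear_subspace_image[OF S direct_sumD(2)[OF F]] direct_sumD(2)[OF L]]]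
      by (simp only:)
  qed
  also have "\<dots> = cdim (?S ` F) + cdim L"
    by (rule cdim_Times[OF clin.linear_subspace_image[OF S direct_sumD(2)[OF F]] direct_sumD(2)[OF L]])
  also have "\<dots> < \<infinity>"
    using cdim_image_le[OF S direct_sumD(2)[OF F]] fin Suc beta_eq_cdim[OF F] beta_eq_cdim[OF L]
    by (cases "cdim (?S ` F)"; cases "cdim L"; cases "cdim F") auto
  finally show ?case .
qed

lemma ker_funpow_mono: "clinear T \<Longrightarrow> ker (T ^^ k) \<subseteq> ker (T ^^ Suc k)"
  by (auto simp: ker_def clin.linear_0)

lemma range_funpow_mono:
  fixes T :: "'a \<Rightarrow> 'a"
  shows "range (T ^^ Suc k) \<subseteq> range (T ^^ k)"
proof
  fix y assume "y \<in> range (T ^^ Suc k)"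
  then obtain x where "y = (T ^^ Suc k) x" by blast
  then have "y = (T ^^ k) (T x)" by (simp add: funpow_swap1)
  then show "y \<in> range (T ^^ k)" by blast
qed

text \<open>Kernels that never become stationary gain at least one dimension with each power and
  exceed the bound \<open>n\<close> at exponent n + 1.\<close>

lemma asc_finite_if_bounded:
  assumes T: "clinear T" and bound: "\<And>k. alpha (T ^^ k) \<le> enat n"
  shows "asc T < \<infinity>"
proof (rule ccontr)
  assume "\<not> asc T < \<infinity>"
  then have ne: "ker (T ^^ k) \<noteq> ker (T ^^ Suc k)" for k using asc_finite_iff by blast
  have "enat k \<le> alpha (T ^^ k)" for k
  proof (induction k)
    case 0 show ?case by (simp add: zero_enat_def[symmetric])
  next
    case (Suc k)
    have N: "csubspace (ker (T ^^ k))" "csubspace (ker (T ^^ Suc k))"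
      by (rule csubspace_ker[OF clinear_funpow[OF T]])+
    have "alpha (T ^^ Suc k) < \<infinity>" using bound[of "Suc k"] by (rule le_less_trans) simp
    then have "alpha (T ^^ k) \<noteq> alpha (T ^^ Suc k)"
      using csubspace_eq_if_cdim_eq[OF N ker_funpow_mono[OF T]] ne unfolding alpha_def by blast
    moreover have "alpha (T ^^ k) \<le> alpha (T ^^ Suc k)"
      unfolding alpha_def by (rule cdim_mono[OF N ker_funpow_mono[OF T]])
    ultimately have "alpha (T ^^ k) < alpha (T ^^ Suc k)" by (rule le_neq_trans[rotated])
    then have "enat k < alpha (T ^^ Suc k)" using Suc by (rule le_less_trans[rotated])
    then show ?case by (rule Suc_ile_eq[THEN iffD2])
  qed
  from this[of "Suc n"] bound[of "Suc n"] have "enat (Suc n) \<le> enat n" by (rule order_trans)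
  then show False by simp
qed

lemma des_finite_if_bounded:
  assumes T: "clinear T" and bound: "\<And>k. beta (T ^^ k) \<le> enat n"
  shows "des T < \<infinity>"
proof (rule ccontr)
  assume "\<not> des T < \<infinity>"
  then have ne: "range (T ^^ k) \<noteq> range (T ^^ Suc k)" for k using des_finite_iff by blast
  have "enat k \<le> beta (T ^^ k)" for k
  proof (induction k)
    case 0 show ?case by (simp add: zero_enat_def[symmetric])
  next
    case (Suc k)
    have lin: "clinear (T ^^ k)" "clinear (T ^^ Suc k)" by (rule clinear_funpow[OF T])+
    have "beta (T ^^ Suc k) < \<infinity>" using bound[of "Suc k"] by (rule le_less_trans) simp
    then have "beta (T ^^ k) \<noteq> beta (T ^^ Suc k)"
      using range_eq_if_beta_eq[OF lin(2,1) range_funpow_mono] ne by metis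
    moreover have "beta (T ^^ k) \<le> beta (T ^^ Suc k)"
    proof -
      obtain E where E: "direct_sum (range (T ^^ Suc k)) E (range (T ^^ k))"
        by (rule direct_sum_exists[OF csubspace_range[OF lin(2)] csubspace_range[OF lin(1)] range_funpow_mono])
      obtain F where F: "direct_sum (range (T ^^ k)) F UNIV" using range_complement_exists[OF lin(1)] .
      obtain L where L: "direct_sum (range (T ^^ Suc k)) L UNIV" using range_complement_exists[OF lin(2)] .
      show ?thesis using cdim_complement_chain[OF E F L] beta_eq_cdim[OF F] beta_eq_cdim[OF L] by simp
    qed
    ultimately have "beta (T ^^ k) < beta (T ^^ Suc k)" by (rule le_neq_trans[rotated])
    then have "enat k < beta (T ^^ Suc k)" using Suc by (rule le_less_trans[rotated])
    then show ?case by (rule Suc_ile_eq[THEN iffD2])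
  qed
  from this[of "Suc n"] bound[of "Suc n"] have "enat (Suc n) \<le> enat n" by (rule order_trans)
  then show False by simp
qed

lemma ker_funpow_stable:
  fixes T :: "'a::complex_normed_vector \<Rightarrow> 'a"
  assumes "ker (T ^^ k) = ker (T ^^ Suc k)"
  shows "ker (T ^^ (k + j)) = ker (T ^^ Suc (k + j))"
proof (induction j)
  case 0 then show ?case using assms by (simp del: funpow.simps)
next
  case (Suc j)
  have "x \<in> ker (T ^^ Suc n) \<longleftrightarrow> T x \<in> ker (T ^^ n)" for x n by (simp add: ker_def funpow_swap1)
  then show ?case using Suc by (auto simp only: add_Suc_right set_eq_iff)
qed

lemma range_funpow_stable:
  fixes T :: "'a \<Rightarrow> 'a"
  assumes "range (T ^^ k) = range (T ^^ Suc k)"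
  shows "range (T ^^ (k + j)) = range (T ^^ Suc (k + j))"
proof (induction j)
  case 0 then show ?case using assms by (simp del: funpow.simps)
next
  case (Suc j)
  have step: "range (T ^^ Suc n) = T ` range (T ^^ n)" for n by auto
  have "range (T ^^ Suc (k + j)) = T ` range (T ^^ (k + j))" by (rule step)
  also have "\<dots> = T ` range (T ^^ Suc (k + j))" using Suc by (rule arg_cong)
  also have "\<dots> = range (T ^^ Suc (Suc (k + j)))" by (rule step[symmetric])
  finally show ?case unfolding add_Suc_right .
qed

text \<open>At exponent i + j both kernels and ranges are stationary, so the index of
  \<open>T\<close> is zero, and index zero in turn makes ascent and descent equal.\<close>

lemma browderI:
  assumes T: "clinear T" and fin: "alpha T < \<infinity>" "beta T < \<infinity>" and "asc T < \<infinity>" "des T < \<infinity>"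
  shows "browder T"
proof -
  obtain i j where ij: "ker (T ^^ i) = ker (T ^^ Suc i)" "range (T ^^ j) = range (T ^^ Suc j)"
    using assms(4,5) asc_finite_iff des_finite_iff by metis
  let ?k = "i + j"
  have "alpha (T ^^ Suc ?k) = alpha (T ^^ ?k)" "beta (T ^^ Suc ?k) = beta (T ^^ ?k)"
    using ker_funpow_stable[OF ij(1), of j] range_funpow_stable[OF ij(2), of i]
    unfolding alpha_def beta_def by (simp_all only: add.commute)
  then have "alpha (T ^^ ?k) + (beta (T ^^ ?k) + beta T) = beta (T ^^ ?k) + (alpha (T ^^ ?k) + alpha T)"
    using index_funpow[OF T fin, of ?k] by metis
  then have "(alpha (T ^^ ?k) + beta (T ^^ ?k)) + beta T = (alpha (T ^^ ?k) + beta (T ^^ ?k)) + alpha T"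
    by (simp only: ac_simps)
  then have "beta T = alpha T" using alpha_beta_funpow_finite[OF T fin, of ?k] by auto
  then show ?thesis using browder_iff_index[OF T] assms by simp
qed

subsection \<open>Finite-rank corrections\<close>

text \<open>\<open>J\<close> carries a basis of the kernel of \<open>T\<close> on \<open>P\<close>
  to a basis of \<open>E\<close>; biorthogonal functionals extend it boundedly to the whole space. T
  + J is bijective because \<open>J\<close> is faithful where \<open>T\<close> vanishes and supplies
  the part of \<open>Q\<close> that \<open>T\<close> misses.\<close>

lemma bijective_finite_rank_perturbation:
  fixes T :: "'a::complex_normed_vector \<Rightarrow> 'b::complex_normed_vector"
  assumes T: "bounded_clinear T" and P: "csubspace P" and E: "direct_sum (T ` P) E Q"
    and dim: "cdim {x \<in> P. T x = 0} = cdim E" "cdim E < \<infinity>"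
  obtains S where "bounded_clinear S" "inj_on S P" "S ` P = Q"
proof -
  let ?K = "{x \<in> P. T x = 0}"
  note DE = direct_sumD[OF E] and lT = bounded_clinear_clinear[OF T]
  have K: "csubspace ?K" using csubspace_vimage_kernel[OF lT _ P, of "{0}"] by simp
  obtain B where B: "finite B" "cindependent B" "cspan B = ?K" "cdim ?K = enat (card B)"
    using cdim_finite_obtain_basis[OF K] dim by metis
  obtain D where D: "finite D" "cindependent D" "cspan D = E" "cdim E = enat (card D)"
    using cdim_finite_obtain_basis[OF DE(2) dim(2)] by metis
  have "card B = card D" using B(4) D(4) dim(1) by simp
  then obtain g where g: "bij_betw g B D" using finite_same_card_bij[OF B(1) D(1)] by blast
  obtain \<phi> where \<phi>: "\<And>b. b \<in> B \<Longrightarrow> bounded_functional (\<phi> b)"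
    "\<And>b c. b \<in> B \<Longrightarrow> c \<in> B \<Longrightarrow> \<phi> b c = (if b = c then 1 else 0)"
    using biorthogonal_functionals[OF B(1,2)] by blast
  define J where "J x = (\<Sum>b\<in>B. \<phi> b x *\<^sub>C g b)" for x
  have bJ: "bounded_clinear J" unfolding J_def by (intro bounded_clinear_sum bounded_clinear_rank_one \<phi>)
  note lJ = bounded_clinear_clinear[OF bJ]
  have JE: "J x \<in> E" for x
    unfolding J_def D(3)[symmetric] using bij_betwE[OF g]
    by (intro complex_vector.span_sum complex_vector.span_scale complex_vector.span_base) auto
  define S where "S x = T x + J x" for x
  have bS: "bounded_clinear S" unfolding S_def by (rule bounded_clinear_add[OF T bJ])
  note lS = bounded_clinear_clinear[OF bS]
  have zero: "x = 0" if x: "x \<in> P" "S x = 0" for x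
  proof -
    have "T x = - J x" using x(2) by (simp add: S_def eq_neg_iff_add_eq_0)
    then have "T x \<in> E" using complex_vector.subspace_neg[OF DE(2) JE] by simp
    then have Tx: "T x = 0" using DE(6) x(1) by blast
    then have "(\<Sum>b\<in>B. \<phi> b x *\<^sub>C g b) = 0" using x(2) by (simp add: S_def J_def)
    moreover have "(\<Sum>b\<in>B. \<phi> b x *\<^sub>C g b) = (\<Sum>b\<in>B. \<phi> (inv_into B g (g b)) x *\<^sub>C g b)"
      using bij_betw_inv_into_left[OF g] by (intro sum.cong) auto
    moreover have "\<dots> = (\<Sum>d\<in>D. \<phi> (inv_into B g d) x *\<^sub>C d)"
      by (rule sum.reindex_bij_betw[OF g])
    ultimately have "(\<Sum>d\<in>D. \<phi> (inv_into B g d) x *\<^sub>C d) = 0" by simp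
    then have "\<phi> (inv_into B g d) x = 0" if "d \<in> D" for d
      using complex_vector.independentD[OF D(2,1) subset_refl _ that, of "\<lambda>d. \<phi> (inv_into B g d) x"] by blast
    then have "\<phi> b x = 0" if "b \<in> B" for b
      using bij_betwE[OF g] bij_betw_inv_into_left[OF g that] that by metis
    then have "(\<Sum>b\<in>B. \<phi> b x *\<^sub>C b) = 0" by simp
    moreover have "x \<in> cspan B" unfolding B(3) using x(1) Tx by simp
    ultimately show "x = 0" using biorthogonal_expansion[OF B(1) \<phi>, of x] by simp
  qed
  have "inj_on S P"
  proof (rule inj_onI)
    fix x y assume xy: "x \<in> P" "y \<in> P" "S x = S y"
    then have "x - y = 0"
      using complex_vector.subspace_diff[OF P] clin.linear_diff[OF lS, of x y] by (intro zero) auto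
    then show "x = y" by simp
  qed
  moreover have "S ` P = Q"
  proof (intro equalityI subsetI)
    fix q assume "q \<in> S ` P"
    then obtain x where x: "x \<in> P" "q = T x + J x" unfolding S_def by blast
    have "T x \<in> Q" "J x \<in> Q" using x(1) DE(3,4) JE by blast+
    then show "q \<in> Q" unfolding x(2) by (rule complex_vector.subspace_add[OF DE(5)])
  next
    fix q assume "q \<in> Q"
    then obtain y e where y: "y \<in> P" "e \<in> E" "q = T y + e" using DE(7) by blast
    obtain u where u: "e = (\<Sum>d\<in>D. u d *\<^sub>C d)"
      using y(2) complex_vector.span_finite[OF D(1)] unfolding D(3) by auto
    \<comment> \<open>\<open>w\<close> lies in the kernel of \<open>T\<close>, so adding it leaves
      \<open>T y\<close> alone while giving y + w the coordinates of \<open>e\<close>.\<close>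
    define w where "w = (\<Sum>b\<in>B. (u (g b) - \<phi> b y) *\<^sub>C b)"
    have "w \<in> cspan B" unfolding w_def
      by (intro complex_vector.span_sum complex_vector.span_scale complex_vector.span_base)
    then have w: "w \<in> P" "T w = 0" unfolding B(3) by simp_all
    have \<phi>w: "\<phi> c (y + w) = u (g c)" if c: "c \<in> B" for c
    proof -
      have "\<phi> c w = (\<Sum>b\<in>B. (u (g b) - \<phi> b y) * \<phi> c b)"
        unfolding w_def by (rule bounded_functional_sum[OF \<phi>(1)[OF c] B(1)])
      also have "\<dots> = (\<Sum>b\<in>B. if b = c then u (g c) - \<phi> c y else 0)"
        by (intro sum.cong) (auto simp: \<phi>(2)[OF c])
      also have "\<dots> = u (g c) - \<phi> c y" using B(1) c by simp
      finally show ?thesis using \<phi>(1)[OF c] unfolding bounded_functional_def by simp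
    qed
    have "J (y + w) = (\<Sum>b\<in>B. u (g b) *\<^sub>C g b)" unfolding J_def by (intro sum.cong) (simp_all add: \<phi>w)
    also have "\<dots> = e" unfolding u by (rule sum.reindex_bij_betw[OF g])
    finally have "S (y + w) = q" using y(3) w(2) clin.linear_add[OF lT, of y w] by (simp add: S_def)
    moreover have "y + w \<in> P" by (rule complex_vector.subspace_add[OF P y(1) w(1)])
    ultimately show "q \<in> S ` P" by blast
  qed
  ultimately show thesis by (rule that[OF bS])
qed

text \<open>The compression T = \<pi> \<circ> \<Phi> of \<Phi> to \<open>P\<close> and
  \<open>Q\<close> has a kernel and a co-range of equal finite dimension, because the removed spaces
  \<open>G\<close> and \<open>H\<close> have equal dimension. A finite-rank correction then makes it
  bijective.\<close>

lemma finite_codimension_cancellation: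
  fixes \<Phi> :: "'a::complex_normed_vector \<Rightarrow> 'b::complex_normed_vector"
  assumes \<Phi>: "bounded_clinear \<Phi>" "bij_betw \<Phi> D R"
    and P: "direct_sum P G D" and Q: "direct_sum Q H R"
    and dim: "cdim G = cdim H" "cdim H < \<infinity>"
    and \<pi>: "bounded_clinear \<pi>" "\<And>q. q \<in> Q \<Longrightarrow> \<pi> q = q" "\<And>h. h \<in> H \<Longrightarrow> \<pi> h = 0"
  obtains S where "bounded_clinear S" "inj_on S P" "S ` P = Q"
proof -
  note DP = direct_sumD[OF P] and DQ = direct_sumD[OF Q]
  note l\<pi> = bounded_clinear_clinear[OF \<pi>(1)] and l\<Phi> = bounded_clinear_clinear[OF \<Phi>(1)]
  have \<Phi>R: "\<Phi> x \<in> R" if "x \<in> D" for x using bij_betwE[OF \<Phi>(2)] that by blast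
  have \<pi>R: "\<pi> r \<in> Q" "\<pi> r = 0 \<Longrightarrow> r \<in> H" if "r \<in> R" for r
  proof -
    obtain q h where "q \<in> Q" "h \<in> H" "r = q + h" using DQ(7)[OF \<open>r \<in> R\<close>] by blast
    then have "\<pi> r = q" using \<pi> clin.linear_add[OF l\<pi>, of q h] by simp
    then show "\<pi> r \<in> Q" "\<pi> r = 0 \<Longrightarrow> r \<in> H" using \<open>q \<in> Q\<close> \<open>h \<in> H\<close> \<open>r = q + h\<close> by simp_all
  qed
  define T where "T x = \<pi> (\<Phi> x)" for x
  have bT: "bounded_clinear T" unfolding T_def by (rule bounded_clinear_compose[OF \<pi>(1) \<Phi>(1)])
  note lT = bounded_clinear_clinear[OF bT]
  have TQ: "T x \<in> Q" if "x \<in> D" for x unfolding T_def by (rule \<pi>R(1)[OF \<Phi>R[OF that]])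
  obtain E where E: "direct_sum (T ` P) E Q"
    by (rule direct_sum_exists[OF clin.linear_subspace_image[OF lT DP(1)] DQ(1)])
      (use TQ DP(3) in auto)
  obtain \<tau> :: "'a \<Rightarrow> 'a" where \<tau>: "clinear \<tau>" "\<And>x. \<tau> x = 0 \<longleftrightarrow> x \<in> P"
    by (rule direct_sum_quotient_map[OF DP(1)]) (rule that)
  obtain \<kappa> :: "'b \<Rightarrow> 'b" where \<kappa>: "clinear \<kappa>" "\<And>x. \<kappa> x = 0 \<longleftrightarrow> x \<in> T ` P"
    by (rule direct_sum_quotient_map[OF direct_sumD(1)[OF E]]) (rule that)
  have \<kappa>T: "clinear (\<lambda>x. \<kappa> (T x))"
    using Vector_Spaces.linear_compose[OF lT \<kappa>(1)] by (simp add: o_def)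
  let ?N = "{x \<in> D. T x = 0}" and ?K = "{x \<in> P. T x = 0}" and ?G = "{x \<in> G. \<kappa> (T x) = 0}"
  have N: "csubspace ?N" using csubspace_vimage_kernel[OF lT _ DP(5), of "{0}"] by simp
  \<comment> \<open>On \<open>R\<close> the kernel of \<pi> is \<open>H\<close>, so the kernel of
    \<open>T\<close> on \<open>D\<close> is a copy of \<open>H\<close>.\<close>
  have "\<Phi> ` ?N = H"
  proof (intro equalityI subsetI)
    fix h assume "h \<in> \<Phi> ` ?N"
    then obtain x where "x \<in> D" "\<pi> (\<Phi> x) = 0" "h = \<Phi> x" unfolding T_def by blast
    then show "h \<in> H" using \<pi>R(2)[OF \<Phi>R] by blast
  next
    fix h assume h: "h \<in> H"
    then obtain x where "x \<in> D" "h = \<Phi> x" using \<Phi>(2) DQ(4) unfolding bij_betw_def by blast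
    then show "h \<in> \<Phi> ` ?N" using \<pi>(3)[OF h] unfolding T_def by blast
  qed
  moreover have "inj_on \<Phi> ?N"
    using \<Phi>(2) unfolding bij_betw_def by (auto intro: inj_on_subset)
  ultimately have N_dim: "cdim ?N = cdim H" using cdim_image_inj[OF l\<Phi> N] by simp
  have "{x \<in> ?N. \<tau> x = 0} = ?K" using \<tau>(2) DP(3) by auto
  then have 1: "cdim H = cdim ?K + cdim (\<tau> ` ?N)"
    using cdim_rank_nullity[OF \<tau>(1) N] N_dim by simp
  have "(\<lambda>x. \<kappa> (T x)) ` G = \<kappa> ` Q"
  proof (intro equalityI subsetI)
    fix z assume "z \<in> (\<lambda>x. \<kappa> (T x)) ` G"
    then show "z \<in> \<kappa> ` Q" using TQ DP(4) by blast
  next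
    fix z assume "z \<in> \<kappa> ` Q"
    then obtain q where q: "q \<in> Q" "z = \<kappa> q" by blast
    then obtain x where x: "x \<in> D" "q = \<Phi> x" using \<Phi>(2) DQ(3) unfolding bij_betw_def by blast
    obtain p g where pg: "p \<in> P" "g \<in> G" "x = p + g" using DP(7)[OF x(1)] by blast
    have "q = T x" using \<pi>(2)[OF q(1)] x(2) by (simp add: T_def)
    also have "\<dots> = T p + T g" unfolding pg(3) by (rule clin.linear_add[OF lT])
    finally have "z = \<kappa> (T p) + \<kappa> (T g)" using q(2) clin.linear_add[OF \<kappa>(1)] by simp
    then have "z = \<kappa> (T g)" using \<kappa>(2)[of "T p"] pg(1) by simp
    then show "z \<in> (\<lambda>x. \<kappa> (T x)) ` G" using pg(2) by blast
  qed
  then have 2: "cdim G = cdim ?G + cdim E"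
    using cdim_rank_nullity[OF \<kappa>T DP(2)] image_projection_eq(3)[OF E \<kappa>] by simp
  \<comment> \<open>An element of \<open>G\<close> is carried by \<open>T\<close> into T(P) exactly
    when it is congruent modulo \<open>P\<close> to an element of \<open>?N\<close>. The counts
    \<open>1\<close> and \<open>2\<close> therefore share a finite term, which cancels.\<close>
  have "\<tau> ` ?G = \<tau> ` ?N"
  proof (intro equalityI subsetI)
    fix z assume "z \<in> \<tau> ` ?G"
    then obtain x y where x: "x \<in> G" "z = \<tau> x" "y \<in> P" "T x = T y" using \<kappa>(2) by blast
    have "x - y \<in> D" using x DP(3,4) by (intro complex_vector.subspace_diff[OF DP(5)]) auto
    moreover have "T (x - y) = 0" using x(4) clin.linear_diff[OF lT, of x y] by simp
    moreover have "\<tau> (x - y) = z" using x(2,3) \<tau>(2)[of y] clin.linear_diff[OF \<tau>(1), of x y] by simp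
    ultimately show "z \<in> \<tau> ` ?N" by blast
  next
    fix z assume "z \<in> \<tau> ` ?N"
    then obtain x where x: "x \<in> D" "T x = 0" "z = \<tau> x" by blast
    obtain p g where pg: "p \<in> P" "g \<in> G" "x = p + g" using DP(7)[OF x(1)] by blast
    have "T g = - T p" using x(2) pg(3) clin.linear_add[OF lT, of p g] by (simp add: eq_neg_iff_add_eq_0 add.commute)
    also have "\<dots> = T (- p)" by (rule clin.linear_neg[OF lT, symmetric])
    finally have "\<kappa> (T g) = 0" using \<kappa>(2) complex_vector.subspace_neg[OF DP(1) pg(1)] by auto
    moreover have "z = \<tau> g" using x(3) pg(1,3) \<tau>(2)[of p] clin.linear_add[OF \<tau>(1), of p g] by simp
    ultimately show "z \<in> \<tau> ` ?G" using pg(2) by blast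
  qed
  moreover have "cdim (\<tau> ` ?G) = cdim ?G"
  proof (rule cdim_image_inj[OF \<tau>(1)])
    show "csubspace ?G" using csubspace_vimage_kernel[OF \<kappa>T _ DP(2), of "{0}"] by simp
    show "inj_on \<tau> ?G" using image_projection_eq(2)[OF P \<tau>] by (rule inj_on_subset) blast
  qed
  ultimately have "cdim ?K + cdim ?G = cdim ?G + cdim E" using 1 2 dim(1) by simp
  moreover have "cdim ?G < \<infinity>" "cdim E < \<infinity>" using 2 dim
    by (cases "cdim ?G"; cases "cdim E"; auto)+
  ultimately have "cdim ?K = cdim E" by (cases "cdim ?K"; cases "cdim E"; cases "cdim ?G") auto
  then show thesis using bijective_finite_rank_perturbation[OF bT DP(1) E] \<open>cdim E < \<infinity>\<close> that by blast
qed

subsection \<open>Isomorphisms onto quotient spaces\<close>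

lemma vnorm_coset_le:
  assumes "csubspace M"
  shows "0 \<le> vnorm (quot_space M) (coset M x)" "vnorm (quot_space M) (coset M x) \<le> norm x"
proof -
  have x: "x \<in> coset M x" using complex_vector.subspace_0[OF assms] by (simp add: coset_def)
  show "0 \<le> vnorm (quot_space M) (coset M x)"
    unfolding quot_space_def using x by (auto intro!: cINF_greatest)
  show "vnorm (quot_space M) (coset M x) \<le> norm x"
    unfolding quot_space_def using x by (auto intro!: cINF_lower bdd_belowI2[of _ 0])
qed

text \<open>The projection onto \<open>L\<close> along \<open>M\<close> sends every member of the
  coset of \<open>l\<close> to \<open>l\<close>, so its bound compares the norm of \<open>l\<close>
  with the infimum over the coset.\<close>

lemma norm_le_vnorm_coset:
  fixes M L :: "'a::complex_banach set"
  assumes "direct_sum M L UNIV" "closed M" "closed L"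
  obtains K where "K > 0" "\<And>l. l \<in> L \<Longrightarrow> norm l \<le> K * vnorm (quot_space M) (coset M l)"
proof -
  obtain p :: "'a \<Rightarrow> 'a" where p: "bounded_clinear p" "\<And>x. x \<in> L \<Longrightarrow> p x = x" "\<And>x. p x = 0 \<longleftrightarrow> x \<in> M"
    by (rule bounded_projection_closed[OF assms]) (rule that)
  note lp = bounded_clinear_clinear[OF p(1)]
  obtain K where K: "K > 0" "\<And>x. norm (p x) \<le> norm x * K"
    using bounded_linear.pos_bounded[OF bounded_clinear_bounded_linear[OF p(1)]] by blast
  have "norm l \<le> K * vnorm (quot_space M) (coset M l)" if l: "l \<in> L" for l
  proof -
    have "norm l / K \<le> (INF y\<in>coset M l. norm y)"
    proof (rule cINF_greatest)
      have "l \<in> coset M l" using complex_vector.subspace_0[OF direct_sumD(1)[OF assms(1)]] by (simp add: coset_def)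
      then show "coset M l \<noteq> {}" by blast
      fix y assume "y \<in> coset M l"
      then have "p (l - y) = 0" using p(3) by (simp add: coset_def)
      then have "l = p y" using p(2)[OF l] clin.linear_diff[OF lp, of l y] by simp
      then show "norm l / K \<le> norm y" using K(2)[of y] K(1) by (simp add: divide_le_eq)
    qed
    then show ?thesis using K(1) by (simp add: quot_space_def field_simps)
  qed
  then show thesis using that K(1) by blast
qed

lemma vnorm_prod_sub_space: "vnorm (sub_space U \<times>\<^sub>V sub_space V) z = norm z"
  by (simp add: prod_space_def sub_space_def norm_prod_def)

lemma carr_prod_space [simp]: "carr (V \<times>\<^sub>V W) = carr V \<times> carr W"
  by (simp add: prod_space_def)

lemma carr_sub_space [simp]: "carr (sub_space S) = S"
  by (simp add: sub_space_def)

lemma vadd_prod_sub_space: "vadd (sub_space U \<times>\<^sub>V sub_space V) z w = z + w"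
  by (simp add: prod_space_def sub_space_def plus_prod_def)

lemma vscale_prod_sub_space: "vscale (sub_space U \<times>\<^sub>V sub_space V) c z = c *\<^sub>C z"
  by (simp add: prod_space_def sub_space_def scaleC_prod_def)

lemma bij_betw_map_prod:
  assumes "bij_betw f A B" "bij_betw g C D"
  shows "bij_betw (map_prod f g) (A \<times> C) (B \<times> D)"
  using assms unfolding bij_betw_def
  by (auto simp: map_prod_inj_on map_prod_surj_on)

context
  fixes M L :: "'a::complex_banach set" and N F :: "'b::complex_banach set"
    and U :: "'c::complex_banach set" and V :: "'d::complex_banach set"
  assumes M: "direct_sum M L UNIV" "closed M" "closed L"
    and N: "direct_sum N F UNIV" "closed N" "closed F"
    and U: "csubspace U" "closed U" and V: "csubspace V" "closed V"
begin

text \<open>The isomorphism is \<Phi> followed by the coset maps. Its lower bound combines the open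
  mapping bound for \<Phi> with the comparison of the norm on a closed complement and the quotient
  norm.\<close>

lemma isomorphic_quotient_spacesI:
  assumes \<Phi>: "bounded_clinear \<Phi>" "bij_betw \<Phi> (U \<times> V) (L \<times> F)"
  shows "sub_space U \<times>\<^sub>V sub_space V \<cong>\<^sub>V quot_space M \<times>\<^sub>V quot_space N"
proof -
  note l\<Phi> = bounded_clinear_clinear[OF \<Phi>(1)]
  note sM = direct_sumD(1)[OF M(1)] and sN = direct_sumD(1)[OF N(1)]
  let ?V = "sub_space U \<times>\<^sub>V sub_space V" and ?W = "quot_space M \<times>\<^sub>V quot_space N"
  define f where "f z = map_prod (coset M) (coset N) (\<Phi> z)" for z
  have f: "f z = (coset M (fst (\<Phi> z)), coset N (snd (\<Phi> z)))" for z
    by (simp add: f_def map_prod_def split_beta)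
  have "bij_betw (map_prod (coset M) (coset N) \<circ> \<Phi>) (U \<times> V) (carr (quot_space M) \<times> carr (quot_space N))"
    by (rule bij_betw_trans[OF \<Phi>(2) bij_betw_map_prod[OF bij_betw_coset[OF M(1)] bij_betw_coset[OF N(1)]]])
  then have bij: "bij_betw f (carr ?V) (carr ?W)" by (simp add: f_def[abs_def] o_def)
  have add: "f (vadd ?V x y) = vadd ?W (f x) (f y)" for x y
    unfolding vadd_prod_sub_space by (simp add: f clin.linear_add[OF l\<Phi>] prod_space_def vadd_quot_space sM sN)
  have scale: "f (vscale ?V c x) = vscale ?W c (f x)" for c x
    unfolding vscale_prod_sub_space by (simp add: f clin.linear_scale[OF l\<Phi>] prod_space_def vscale_quot_space sM sN)
  have vW: "vnorm ?W (f z) = sqrt ((vnorm (quot_space M) (coset M (fst (\<Phi> z))))\<^sup>2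
      + (vnorm (quot_space N) (coset N (snd (\<Phi> z))))\<^sup>2)" for z
    by (simp add: prod_space_def f)
  have le: "vnorm ?W (f z) \<le> norm (\<Phi> z)" for z
    unfolding vW norm_prod_def
    by (intro real_sqrt_le_mono add_mono power_mono vnorm_coset_le sM sN)
  obtain J where J: "\<And>z. norm (\<Phi> z) \<le> J * norm z"
    using \<Phi>(1) unfolding bounded_clinear_def by blast
  have upper: "\<forall>z\<in>carr ?V. vnorm ?W (f z) \<le> J * vnorm ?V z"
    using order_trans[OF le J] by (simp add: vnorm_prod_sub_space)
  have img: "\<Phi> ` (U \<times> V) = L \<times> F" and inj: "inj_on \<Phi> (U \<times> V)"
    using \<Phi>(2) by (auto simp: bij_betw_def)
  obtain K where K: "K > 0" "\<And>y. y \<in> L \<times> F \<Longrightarrow> \<exists>x\<in>U \<times> V. \<Phi> x = y \<and> norm x \<le> K * norm y"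
    using open_mapping_bound[OF bounded_clinear_bounded_linear[OF \<Phi>(1)], of "U \<times> V"] U V M(3) N(3)
    unfolding img by (metis closed_Times csubspace_Times csubspace_imp_subspace)
  obtain K1 where K1: "K1 > 0" "\<And>l. l \<in> L \<Longrightarrow> norm l \<le> K1 * vnorm (quot_space M) (coset M l)"
    using norm_le_vnorm_coset[OF M] by blast
  obtain K2 where K2: "K2 > 0" "\<And>l. l \<in> F \<Longrightarrow> norm l \<le> K2 * vnorm (quot_space N) (coset N l)"
    using norm_le_vnorm_coset[OF N] by blast
  define C where "C = max K1 K2"
  have C: "C > 0" "K1 \<le> C" "K2 \<le> C" using K1(1) by (auto simp: C_def)
  have "vnorm ?V z \<le> (K * C) * vnorm ?W (f z)" if "z \<in> carr ?V" for z
  proof -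
    have z: "z \<in> U \<times> V" using that by simp
    then have LF: "fst (\<Phi> z) \<in> L" "snd (\<Phi> z) \<in> F" using img by (metis imageI mem_Times_iff)+
    let ?a = "vnorm (quot_space M) (coset M (fst (\<Phi> z)))" and ?b = "vnorm (quot_space N) (coset N (snd (\<Phi> z)))"
    obtain x where x: "x \<in> U \<times> V" "\<Phi> x = \<Phi> z" "norm x \<le> K * norm (\<Phi> z)"
      using K(2)[of "\<Phi> z"] LF by (metis mem_Times_iff)
    have "x = z" using inj_onD[OF inj x(2) x(1) z] .
    have "norm (fst (\<Phi> z)) \<le> C * ?a"
      using K1(2)[OF LF(1)] mult_right_mono[OF C(2) vnorm_coset_le(1)[OF sM]] by (rule order_trans)
    moreover have "norm (snd (\<Phi> z)) \<le> C * ?b"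
      using K2(2)[OF LF(2)] mult_right_mono[OF C(3) vnorm_coset_le(1)[OF sN]] by (rule order_trans)
    ultimately have "norm (\<Phi> z) \<le> sqrt ((C * ?a)\<^sup>2 + (C * ?b)\<^sup>2)"
      unfolding norm_prod_def by (intro real_sqrt_le_mono add_mono power_mono) auto
    also have "\<dots> = C * vnorm ?W (f z)"
    proof -
      have "(C * ?a)\<^sup>2 + (C * ?b)\<^sup>2 = C\<^sup>2 * (?a\<^sup>2 + ?b\<^sup>2)" by (simp add: power_mult_distrib distrib_left)
      then show ?thesis using C(1) unfolding vW by (simp add: real_sqrt_mult)
    qed
    finally have "K * norm (\<Phi> z) \<le> K * (C * vnorm ?W (f z))" using K(1) by simp
    then show ?thesis using x(3) \<open>x = z\<close> by (simp add: vnorm_prod_sub_space mult.assoc)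
  qed
  then show ?thesis unfolding isomorphic_spaces_def using bij add scale upper by blast
qed

text \<open>The given isomorphism lives on carriers only. Lifting its values to \<open>L\<close> and
  \<open>F\<close> gives \<open>h\<close>, linear because representatives in a complement are
  unique; composition with the projections \<open>P\<close> and \<open>Q\<close> extends it to a
  bounded operator on the whole product.\<close>

lemma isomorphic_quotient_spacesE:
  assumes iso: "sub_space U \<times>\<^sub>V sub_space V \<cong>\<^sub>V quot_space M \<times>\<^sub>V quot_space N"
    and P: "bounded_clinear P" "\<And>x. P x \<in> U" "\<And>x. x \<in> U \<Longrightarrow> P x = x"
    and Q: "bounded_clinear Q" "\<And>x. Q x \<in> V" "\<And>x. x \<in> V \<Longrightarrow> Q x = x"
  obtains \<Phi> where "bounded_clinear \<Phi>" "bij_betw \<Phi> (U \<times> V) (L \<times> F)"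
proof -
  note sM = direct_sumD(1)[OF M(1)] and sN = direct_sumD(1)[OF N(1)]
    and sL = direct_sumD(2)[OF M(1)] and sF = direct_sumD(2)[OF N(1)]
  let ?V = "sub_space U \<times>\<^sub>V sub_space V" and ?W = "quot_space M \<times>\<^sub>V quot_space N"
  obtain f J where f: "bij_betw f (carr ?V) (carr ?W)"
    "\<And>x y. x \<in> carr ?V \<Longrightarrow> y \<in> carr ?V \<Longrightarrow> f (vadd ?V x y) = vadd ?W (f x) (f y)"
    "\<And>c x. x \<in> carr ?V \<Longrightarrow> f (vscale ?V c x) = vscale ?W c (f x)"
    "\<And>x. x \<in> carr ?V \<Longrightarrow> vnorm ?W (f x) \<le> J * vnorm ?V x"
    using iso unfolding isomorphic_spaces_def by blast
  note bM = bij_betw_coset[OF M(1)] and bN = bij_betw_coset[OF N(1)]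
  define h where "h z = map_prod (inv_into L (coset M)) (inv_into F (coset N)) (f z)" for z
  have "bij_betw (map_prod (inv_into L (coset M)) (inv_into F (coset N)) \<circ> f) (U \<times> V) (L \<times> F)"
    by (rule bij_betw_trans[OF _ bij_betw_map_prod[OF bij_betw_inv_into[OF bM] bij_betw_inv_into[OF bN]]])
      (use f(1) in simp)
  then have h: "bij_betw h (U \<times> V) (L \<times> F)" by (simp add: h_def[abs_def] o_def)
  have hLF: "fst (h z) \<in> L" "snd (h z) \<in> F" if "z \<in> U \<times> V" for z
    using bij_betwE[OF h] that by (metis mem_Times_iff)+
  have fh: "f z = (coset M (fst (h z)), coset N (snd (h z)))" if "z \<in> U \<times> V" for z
  proof -
    have "f z \<in> carr (quot_space M) \<times> carr (quot_space N)" 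
      using bij_betwE[OF f(1)] that unfolding carr_prod_space carr_sub_space by blast
    then show ?thesis
      unfolding h_def
      by (auto simp: bij_betw_inv_into_right[OF bM] bij_betw_inv_into_right[OF bN] prod_eq_iff map_prod_def
          split: prod.splits)
  qed
  have UV: "csubspace (U \<times> V)" and LF: "csubspace (L \<times> F)"
    using U V sL sF by (simp_all add: csubspace_Times)
  have eqI: "x = y" if "x \<in> L \<times> F" "y \<in> L \<times> F" "coset M (fst x) = coset M (fst y)"
    "coset N (snd x) = coset N (snd y)" for x y
    using that bM bN unfolding bij_betw_def by (auto simp: prod_eq_iff mem_Times_iff dest: inj_onD)
  have hmem: "h z \<in> L \<times> F" if "z \<in> U \<times> V" for z using bij_betwE[OF h] that by blast
  have h_add: "h (x + y) = h x + h y" if xy: "x \<in> U \<times> V" "y \<in> U \<times> V" for x y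
  proof -
    have m: "x + y \<in> U \<times> V" by (rule complex_vector.subspace_add[OF UV xy])
    have "f (x + y) = vadd ?W (f x) (f y)" using f(2)[of x y] xy by (simp add: vadd_prod_sub_space)
    then have "f (x + y) = (coset M (fst (h x + h y)), coset N (snd (h x + h y)))"
      using xy by (simp add: fh prod_space_def vadd_quot_space sM sN)
    then show ?thesis
      using fh[OF m] complex_vector.subspace_add[OF LF hmem[OF xy(1)] hmem[OF xy(2)]] hmem[OF m]
      by (intro eqI) simp_all
  qed
  have h_scale: "h (c *\<^sub>C x) = c *\<^sub>C h x" if x: "x \<in> U \<times> V" for c x
  proof -
    have m: "c *\<^sub>C x \<in> U \<times> V" by (rule complex_vector.subspace_scale[OF UV x])
    have "f (c *\<^sub>C x) = vscale ?W c (f x)" using f(3)[of x c] x by (simp add: vscale_prod_sub_space)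
    then have "f (c *\<^sub>C x) = (coset M (fst (c *\<^sub>C h x)), coset N (snd (c *\<^sub>C h x)))"
      using x by (simp add: fh prod_space_def vscale_quot_space sM sN)
    then show ?thesis
      using fh[OF m] complex_vector.subspace_scale[OF LF hmem[OF x]] hmem[OF m]
      by (intro eqI) simp_all
  qed
  obtain K1 where K1: "K1 > 0" "\<And>l. l \<in> L \<Longrightarrow> norm l \<le> K1 * vnorm (quot_space M) (coset M l)"
    using norm_le_vnorm_coset[OF M] by blast
  obtain K2 where K2: "K2 > 0" "\<And>l. l \<in> F \<Longrightarrow> norm l \<le> K2 * vnorm (quot_space N) (coset N l)"
    using norm_le_vnorm_coset[OF N] by blast
  have h_bound: "norm (h z) \<le> ((K1 + K2) * \<bar>J\<bar>) * norm z" if z: "z \<in> U \<times> V" for z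
  proof -
    let ?a = "vnorm (quot_space M) (coset M (fst (h z)))" and ?b = "vnorm (quot_space N) (coset N (snd (h z)))"
    have W: "vnorm ?W (f z) = sqrt (?a\<^sup>2 + ?b\<^sup>2)" using fh[OF z] by (simp add: prod_space_def)
    have "sqrt (?a\<^sup>2 + ?b\<^sup>2) \<le> J * norm z" using f(4)[of z] z W by (simp add: vnorm_prod_sub_space)
    also have "\<dots> \<le> \<bar>J\<bar> * norm z" by (simp add: mult_right_mono)
    finally have s: "sqrt (?a\<^sup>2 + ?b\<^sup>2) \<le> \<bar>J\<bar> * norm z" .
    have "norm (h z) \<le> norm (fst (h z)) + norm (snd (h z))"
      unfolding norm_prod_def by (rule sqrt_sum_squares_le_sum) auto
    also have "\<dots> \<le> K1 * ?a + K2 * ?b" using K1(2) K2(2) hLF[OF z] by (intro add_mono) auto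
    also have "\<dots> \<le> K1 * (\<bar>J\<bar> * norm z) + K2 * (\<bar>J\<bar> * norm z)"
      using order_trans[OF real_sqrt_sum_squares_ge1 s] order_trans[OF real_sqrt_sum_squares_ge2 s] K1(1) K2(1)
      by (intro add_mono mult_left_mono) auto
    finally show ?thesis by (simp add: algebra_simps)
  qed
  define R where "R z = (P (fst z), Q (snd z))" for z
  have R: "bounded_clinear R" unfolding R_def
    by (intro bounded_clinear_Pair bounded_clinear_compose[OF P(1)] bounded_clinear_compose[OF Q(1)]
        bounded_clinear_fst bounded_clinear_snd)
  note lR = bounded_clinear_clinear[OF R]
  have RUV: "R z \<in> U \<times> V" for z using P(2) Q(2) by (simp add: R_def)
  obtain J' where J': "\<And>z. norm (R z) \<le> J' * norm z" using R unfolding bounded_clinear_def by blast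
  show thesis
  proof (rule that[of "\<lambda>z. h (R z)"])
    have "clinear (\<lambda>z. h (R z))"
      by (rule clinearI) (simp_all add: clin.linear_add[OF lR] clin.linear_scale[OF lR] h_add h_scale RUV)
    moreover have "norm (h (R z)) \<le> ((K1 + K2) * \<bar>J\<bar> * J') * norm z" for z
    proof -
      have "norm (h (R z)) \<le> ((K1 + K2) * \<bar>J\<bar>) * norm (R z)" by (rule h_bound[OF RUV])
      also have "\<dots> \<le> ((K1 + K2) * \<bar>J\<bar>) * (J' * norm z)"
        using K1(1) K2(1) J' by (intro mult_left_mono) auto
      finally show ?thesis by (simp add: mult.assoc)
    qed
    ultimately show "bounded_clinear (\<lambda>z. h (R z))" unfolding bounded_clinear_def by blast
    have "h (R z) = h z" if "z \<in> U \<times> V" for z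
      using that P(3) Q(3) by (auto simp: R_def)
    then show "bij_betw (\<lambda>z. h (R z)) (U \<times> V) (L \<times> F)" using h by (simp cong: bij_betw_cong)
  qed
qed

end

subsection \<open>Complemented kernels and ranges\<close>

lemma closed_complemented_iff:
  "closed_complemented M \<longleftrightarrow> closed M \<and> (\<exists>L. closed L \<and> direct_sum M L UNIV)"
  unfolding closed_complemented_def direct_sum_def by blast

text \<open>A finite-dimensional complement is closed, so the range and its complement are both
  bounded images of closed subspaces.\<close>

lemma closed_range_if_beta_finite:
  fixes T :: "'a::complex_banach \<Rightarrow> 'a"
  assumes T: "bounded_clinear T" and fin: "beta T < \<infinity>" and F: "direct_sum (range T) F UNIV"
  shows "closed (range T)" "closed F"
proof -
  have "cdim F < \<infinity>" using fin beta_eq_cdim[OF F] by simp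
  then show clF: "closed F" by (rule finite_dimensional_closed[OF direct_sumD(2)[OF F]])
  have "direct_sum (range T) ((\<lambda>x. x) ` F) UNIV" using F by simp
  then show "closed (range T)"
    by (rule closed_image_complement[OF T bounded_clinear_ident complex_vector.subspace_UNIV closed_UNIV
          direct_sumD(2)[OF F] clF])
qed

text \<open>The complement of R(A) is C(W) + E. Here \<open>W\<close> complements \<open>?K\<close>
  in N(B), so that \<open>C\<close> is injective on it modulo R(A), and \<open>E\<close> complements
  R(A) + C(N(B)). It is a bounded image of W x E, and the closedness criterion is applied in both
  directions.\<close>

lemma closed_complemented_range_triangular:
  fixes A :: "'a::complex_banach \<Rightarrow> 'a" and B :: "'b::complex_banach \<Rightarrow> 'b"
  assumes A: "bounded_clinear A" and B: "bounded_clinear B" and C: "bounded_clinear C"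
    and K: "cdim {y \<in> ker B. C y \<in> range A} < \<infinity>" and fin: "beta (upper_triangular A C B) < \<infinity>"
  shows "closed_complemented (range A)"
proof -
  note lA = bounded_clinear_clinear[OF A] and lB = bounded_clinear_clinear[OF B]
    and lC = bounded_clinear_clinear[OF C]
  let ?M = "upper_triangular A C B" and ?K = "{y \<in> ker B. C y \<in> range A}"
  have sK: "csubspace ?K" by (intro csubspace_vimage_kernel lC csubspace_range lA csubspace_ker lB)
  obtain W where W: "direct_sum ?K W (ker B)" "closed W"
    by (rule closed_complement_exists[OF sK K csubspace_ker[OF lB] closed_ker[OF B]]) auto
  note DW = direct_sumD[OF W(1)]
  let ?V = "{a + c | a c. a \<in> range A \<and> c \<in> C ` ker B}"
  have sV: "csubspace ?V"
    by (intro complex_vector.subspace_sums csubspace_range lA clin.linear_subspace_image[OF lC] csubspace_ker lB)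
  obtain E where E: "direct_sum ?V E UNIV"
    by (rule direct_sum_exists[OF sV complex_vector.subspace_UNIV]) simp
  note DE = direct_sumD[OF E]
  obtain R where R: "direct_sum (range ?M) R UNIV"
    using range_complement_exists[OF clinear_upper_triangular[OF lA lB lC]] .
  have emb: "clinear (\<lambda>e::'a. (e, 0::'b))" by (rule clinearI) auto
  \<comment> \<open>If (e, 0) is in the range of \<open>?M\<close>, then \<open>e\<close> lies in
    R(A) + C(N(B)) and vanishes. Hence \<open>E\<close> embeds in every complement of that range and
    is finite-dimensional.\<close>
  have "range ?M \<inter> (\<lambda>e. (e, 0)) ` E = {0}"
  proof -
    have "z = 0" if z: "z \<in> range ?M" "z \<in> (\<lambda>e. (e, 0)) ` E" for z
    proof -
      obtain e where e: "e \<in> E" "z = (e, 0)" using z(2) by blast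
      obtain w where "z = ?M w" using z(1) by blast
      then have "e = A (fst w) + C (snd w)" "B (snd w) = 0"
        using e(2) by (simp_all add: upper_triangular_def split_beta)
      then have "e \<in> ?V" by (auto simp: ker_def)
      then show "z = 0" using DE(6) e by (simp add: zero_prod_def)
    qed
    moreover have "0 \<in> range ?M" "0 \<in> (\<lambda>e. (e, 0::'b)) ` E"
      using complex_vector.subspace_0 direct_sumD(1)[OF R] clin.linear_subspace_image[OF emb DE(2)] by blast+
    ultimately show ?thesis by blast
  qed
  then have "cdim ((\<lambda>e. (e, 0::'b)) ` E) \<le> cdim R"
    by (rule cdim_le_complement[OF R clin.linear_subspace_image[OF emb DE(2)]])
  moreover have "cdim ((\<lambda>e. (e, 0::'b)) ` E) = cdim E"
    by (rule cdim_image_inj[OF emb DE(2)]) (simp add: inj_on_def)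
  ultimately have "cdim E \<le> beta ?M" using beta_eq_cdim[OF R] by simp
  then have "cdim E < \<infinity>" using fin by (rule le_less_trans)
  then have clE: "closed E" by (rule finite_dimensional_closed[OF DE(2)])
  let ?T = "\<lambda>z. C (fst z) + snd z"
  have T: "bounded_clinear ?T"
    by (intro bounded_clinear_add bounded_clinear_compose[OF C] bounded_clinear_fst bounded_clinear_snd)
  have WE: "csubspace (W \<times> E)" "closed (W \<times> E)"
    using csubspace_Times[OF DW(2) DE(2)] closed_Times[OF W(2) clE] .
  have sum: "direct_sum (range A) (?T ` (W \<times> E)) UNIV"
  proof (rule direct_sumI)
    show "csubspace (?T ` (W \<times> E))"
      by (rule clin.linear_subspace_image[OF bounded_clinear_clinear[OF T] WE(1)])
    fix x
    show "x = 0" if x: "x \<in> range A" "x \<in> ?T ` (W \<times> E)"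
    proof -
      obtain u where u: "x = A u" using x(1) by blast
      obtain w e where we: "w \<in> W" "e \<in> E" "x = C w + e" using x(2) by auto
      have "A u = C w + e" using u we(3) by simp
      then have "e = A u + C (- w)" by (simp add: clin.linear_neg[OF lC])
      moreover have "- w \<in> ker B" using DW(4) we(1) complex_vector.subspace_neg[OF csubspace_ker[OF lB]] by blast
      ultimately have "e \<in> ?V" by blast
      then have "e = 0" using DE(6) we(2) by blast
      then have "w \<in> ?K" using u we DW(4) by auto
      then have "w = 0" using DW(6) we(1) by blast
      then show "x = 0" using we(3) \<open>e = 0\<close> clin.linear_0[OF lC] by simp
    qed
    obtain u n e where x: "n \<in> ker B" "e \<in> E" "x = A u + C n + e" using DE(7)[of x] by blast
    obtain k w where n: "k \<in> ?K" "w \<in> W" "n = k + w" using DW(7)[OF x(1)] by blast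
    obtain v where v: "C k = A v" using n(1) by blast
    have "x = A (u + v) + ?T (w, e)"
      using x(3) n(3) v by (simp add: clin.linear_add[OF lA] clin.linear_add[OF lC] add_ac)
    then show "\<exists>u\<in>range A. \<exists>l\<in>?T ` (W \<times> E). x = u + l" using n(2) x(2) by blast
  qed (use csubspace_range[OF lA] in auto)
  have "closed (range A)"
    by (rule closed_image_complement[OF A T complex_vector.subspace_UNIV closed_UNIV WE sum])
  moreover have "closed (?T ` (W \<times> E))"
    by (rule closed_image_complement[OF T A WE complex_vector.subspace_UNIV closed_UNIV])
      (use sum in \<open>simp add: direct_sum_commute\<close>)
  ultimately show ?thesis using sum unfolding closed_complemented_iff by blast
qed

text \<open>N(B) meets \<open>?S\<close> in the finite-dimensional \<open>?K\<close>, which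
  \<open>P\<close> splits off. What is left of \<open>?S\<close>, together with a complement
  \<open>G\<close> of \<open>?S\<close> + N(B), complements N(B).\<close>

lemma closed_complemented_ker_triangular:
  fixes A :: "'a::complex_banach \<Rightarrow> 'a" and B :: "'b::complex_banach \<Rightarrow> 'b"
  assumes A: "bounded_clinear A" and B: "bounded_clinear B" and C: "bounded_clinear C"
    and K: "cdim {y \<in> ker B. C y \<in> range A} < \<infinity>" and fin: "beta (upper_triangular A C B) < \<infinity>"
  shows "closed_complemented (ker B)"
proof -
  note lA = bounded_clinear_clinear[OF A] and lB = bounded_clinear_clinear[OF B]
    and lC = bounded_clinear_clinear[OF C]
  let ?M = "upper_triangular A C B" and ?K = "{y \<in> ker B. C y \<in> range A}" and ?S = "{y. C y \<in> range A}"
  have sK: "csubspace ?K" by (intro csubspace_vimage_kernel lC csubspace_range lA csubspace_ker lB)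
  have sS: "csubspace ?S"
    using csubspace_vimage_kernel[OF lC csubspace_range[OF lA] complex_vector.subspace_UNIV] by simp
  obtain P where P: "bounded_clinear P" "\<And>x. P x \<in> ?K" "\<And>x. x \<in> ?K \<Longrightarrow> P x = x"
    by (rule finite_dimensional_projection[OF sK K]) (rule that)
  note lP = bounded_clinear_clinear[OF P(1)]
  have bT0: "bounded_clinear (\<lambda>z. (A (fst z) + C (snd z), P (snd z)))"
    by (intro bounded_clinear_Pair bounded_clinear_add bounded_clinear_compose[OF A]
        bounded_clinear_compose[OF C] bounded_clinear_compose[OF P(1)] bounded_clinear_fst bounded_clinear_snd)
  \<comment> \<open>For y alone the condition C y in R(A) need not be visibly closed. Keeping a
    witness x with A x + C y = 0 makes it closed in the product, and the wanted subspace is the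
    image of \<open>D\<close> under \<open>snd\<close>.\<close>
  define D where "D = {z. (A (fst z) + C (snd z), P (snd z)) = (0, 0)}"
  have D: "csubspace D" "closed D"
    using clin.linear_subspace_kernel[OF bounded_clinear_clinear[OF bT0]]
      bounded_clinear_closed_vimage[OF bT0, of "{0}" UNIV]
    by (simp_all add: D_def zero_prod_def)
  have DS: "snd z \<in> ?S" "P (snd z) = 0" if "z \<in> D" for z
  proof -
    have "C (snd z) = - A (fst z)" using that by (simp add: D_def eq_neg_iff_add_eq_0 add.commute)
    also have "\<dots> = A (- fst z)" by (simp add: clin.linear_neg[OF lA])
    finally show "snd z \<in> ?S" by simp
    show "P (snd z) = 0" using that by (simp add: D_def)
  qed
  let ?V = "{s + n | s n. s \<in> ?S \<and> n \<in> ker B}"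
  have sV: "csubspace ?V" by (rule complex_vector.subspace_sums[OF sS csubspace_ker[OF lB]])
  obtain G where G: "direct_sum ?V G UNIV"
    by (rule direct_sum_exists[OF sV complex_vector.subspace_UNIV]) simp
  note DG = direct_sumD[OF G]
  obtain R where R: "direct_sum (range ?M) R UNIV"
    using range_complement_exists[OF clinear_upper_triangular[OF lA lB lC]] .
  have emb: "clinear (\<lambda>g. (0::'a, B g))"
    by (rule clinearI) (simp_all add: clin.linear_add[OF lB] clin.linear_scale[OF lB])
  \<comment> \<open>The first row puts \<open>snd w\<close> into \<open>?S\<close>, the second puts
    g - snd w into N(B). So g -> (0, B g) embeds \<open>G\<close> in every complement of the range
    of \<open>?M\<close>, which bounds its dimension.\<close>
  have G0: "g = 0" if g: "g \<in> G" "(0, B g) = ?M w" for g w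
  proof -
    have w: "A (fst w) + C (snd w) = 0" "B g = B (snd w)"
      using g(2) by (simp_all add: upper_triangular_def split_beta)
    have "C (snd w) = - A (fst w)" using w(1) by (simp add: eq_neg_iff_add_eq_0 add.commute)
    also have "\<dots> = A (- fst w)" by (simp add: clin.linear_neg[OF lA])
    finally have "snd w \<in> ?S" by simp
    moreover have "g - snd w \<in> ker B" using w(2) clin.linear_diff[OF lB, of g "snd w"] by (simp add: ker_def)
    moreover have "g = snd w + (g - snd w)" by simp
    ultimately have "g \<in> ?V" by blast
    then show "g = 0" using DG(6) g(1) by blast
  qed
  have M0: "?M 0 = 0" using clin.linear_0[OF clinear_upper_triangular[OF lA lB lC]] .
  have "range ?M \<inter> (\<lambda>g. (0, B g)) ` G = {0}"
  proof -
    have "z = 0" if z: "z \<in> range ?M" "z \<in> (\<lambda>g. (0, B g)) ` G" for z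
    proof -
      obtain g where g: "g \<in> G" "z = (0, B g)" using z(2) by blast
      obtain w where "z = ?M w" using z(1) by blast
      then have "g = 0" using G0[OF g(1)] g(2) by simp
      then show "z = 0" using g(2) clin.linear_0[OF lB] by (simp add: zero_prod_def)
    qed
    moreover have "0 \<in> range ?M" "0 \<in> (\<lambda>g. (0::'a, B g)) ` G"
      using complex_vector.subspace_0 direct_sumD(1)[OF R] clin.linear_subspace_image[OF emb DG(2)] by blast+
    ultimately show ?thesis by blast
  qed
  then have "cdim ((\<lambda>g. (0::'a, B g)) ` G) \<le> cdim R"
    by (rule cdim_le_complement[OF R clin.linear_subspace_image[OF emb DG(2)]])
  moreover have "cdim ((\<lambda>g. (0::'a, B g)) ` G) = cdim G"
  proof (rule cdim_image_inj[OF emb DG(2)], rule inj_onI)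
    fix x y assume xy: "x \<in> G" "y \<in> G" "(0::'a, B x) = (0, B y)"
    then have "x - y \<in> G" using complex_vector.subspace_diff[OF DG(2)] by blast
    moreover have "(0, B (x - y)) = ?M 0" using xy(3) M0 clin.linear_diff[OF lB, of x y] by (simp add: zero_prod_def)
    ultimately have "x - y = 0" by (rule G0)
    then show "x = y" by simp
  qed
  ultimately have "cdim G \<le> beta ?M" using beta_eq_cdim[OF R] by simp
  then have "cdim G < \<infinity>" using fin by (rule le_less_trans)
  then have clG: "closed G" by (rule finite_dimensional_closed[OF DG(2)])
  let ?T = "\<lambda>z::('a \<times> 'b) \<times> 'b. snd (fst z) + snd z"
  have T: "bounded_clinear ?T"
    by (intro bounded_clinear_add bounded_clinear_compose[OF bounded_clinear_snd] bounded_clinear_fst bounded_clinear_snd)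
  have DGs: "csubspace (D \<times> G)" "closed (D \<times> G)"
    using csubspace_Times[OF D(1) DG(2)] closed_Times[OF D(2) clG] .
  have sum: "direct_sum (ker B) (?T ` (D \<times> G)) UNIV"
  proof (rule direct_sumI)
    show "csubspace (?T ` (D \<times> G))"
      by (rule clin.linear_subspace_image[OF bounded_clinear_clinear[OF T] DGs(1)])
    fix y
    show "y = 0" if y: "y \<in> ker B" "y \<in> ?T ` (D \<times> G)"
    proof -
      obtain z g where zg: "z \<in> D" "g \<in> G" "y = snd z + g" using y(2) by auto
      have "- snd z \<in> ?S" using DS(1)[OF zg(1)] complex_vector.subspace_neg[OF sS] by blast
      moreover have "g = - snd z + y" using zg(3) by simp
      ultimately have "g \<in> ?V" using y(1) by blast
      then have "g = 0" using DG(6) zg(2) by blast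
      then have "y = snd z" using zg(3) by simp
      then have "y \<in> ?K" using y(1) DS(1)[OF zg(1)] by simp
      then show "y = 0" using P(3)[of y] DS(2)[OF zg(1)] \<open>y = snd z\<close> by simp
    qed
    obtain s n g where y: "s \<in> ?S" "n \<in> ker B" "g \<in> G" "y = s + n + g" using DG(7)[of y] by blast
    obtain x where x: "C s = A x" using y(1) by blast
    obtain u where u: "C (P s) = A u" using P(2)[of s] by blast
    \<comment> \<open>Subtracting \<open>P s\<close> moves \<open>s\<close> into the kernel of
      \<open>P\<close>; as A x = C s and A u = C (P s), the required witness is u - x.\<close>
    have "(u - x, s - P s) \<in> D"
      using x u P(3)[OF P(2)] by (simp add: D_def clin.linear_diff[OF lA] clin.linear_diff[OF lC] clin.linear_diff[OF lP])
    moreover have "n + P s \<in> ker B"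
      using P(2)[of s] y(2) by (intro complex_vector.subspace_add[OF csubspace_ker[OF lB]]) auto
    moreover have "y = (n + P s) + ?T ((u - x, s - P s), g)" using y(4) by simp
    ultimately show "\<exists>u\<in>ker B. \<exists>l\<in>?T ` (D \<times> G). y = u + l" using y(3) by blast
  qed (use csubspace_ker[OF lB] in auto)
  have "closed (?T ` (D \<times> G))"
    by (rule closed_image_complement[OF T bounded_clinear_ident DGs csubspace_ker[OF lB] closed_ker[OF B]])
      (use sum in \<open>simp add: direct_sum_commute\<close>)
  then show ?thesis using sum closed_ker[OF B] unfolding closed_complemented_iff by blast
qed

subsection \<open>Powers of an upper triangular operator\<close>

lemma snd_upper_triangular_funpow: "snd ((upper_triangular A C B ^^ k) z) = (B ^^ k) (snd z)"
  by (induction k) (simp_all add: upper_triangular_def split_beta)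

lemma upper_triangular_funpow_fst:
  assumes "clinear B" "clinear C"
  shows "(upper_triangular A C B ^^ k) (x, 0) = ((A ^^ k) x, 0)"
  by (induction k) (simp_all add: upper_triangular_def clin.linear_0[OF assms(1)] clin.linear_0[OF assms(2)])

text \<open>X x 0 is invariant and the triangular operator acts on it as \<open>A\<close>, so
  kernels of powers restrict. The dual fact for the descent uses that it acts as \<open>B\<close> on
  the second coordinate.\<close>

lemma asc_upper_triangular_finite:
  assumes "clinear B" "clinear C" "asc (upper_triangular A C B) < \<infinity>"
  shows "asc A < \<infinity>"
proof -
  let ?M = "upper_triangular A C B"
  obtain k where k: "ker (?M ^^ k) = ker (?M ^^ Suc k)" using assms(3) asc_finite_iff by blast
  have iff: "x \<in> ker (A ^^ n) \<longleftrightarrow> (x, 0) \<in> ker (?M ^^ n)" for x n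
    unfolding ker_def using upper_triangular_funpow_fst[OF assms(1,2), where k = n] by (simp add: zero_prod_def)
  have "ker (A ^^ k) = ker (A ^^ Suc k)"
    by (rule set_eqI) (unfold iff k, rule refl)
  then show ?thesis using asc_finite_iff by blast
qed

lemma des_upper_triangular_finite:
  assumes "des (upper_triangular A C B) < \<infinity>"
  shows "des B < \<infinity>"
proof -
  let ?M = "upper_triangular A C B"
  obtain k where k: "range (?M ^^ k) = range (?M ^^ Suc k)" using assms des_finite_iff by blast
  have "range (B ^^ n) = snd ` range (?M ^^ n)" for n
  proof (intro equalityI subsetI)
    fix y assume "y \<in> range (B ^^ n)"
    then obtain x where "y = (B ^^ n) x" by blast
    then have "y = snd ((?M ^^ n) (0, x))" by (simp add: snd_upper_triangular_funpow)
    then show "y \<in> snd ` range (?M ^^ n)" by blast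
  qed (auto simp: snd_upper_triangular_funpow)
  then have "range (B ^^ k) = range (B ^^ Suc k)" using k by (simp only:)
  then show ?thesis using des_finite_iff by blast
qed

lemma direct_sum_Times:
  assumes "direct_sum U L V" "direct_sum U' L' V'"
  shows "direct_sum (U \<times> U') (L \<times> L') (V \<times> V')"
proof (rule direct_sumI)
  note D = direct_sumD[OF assms(1)] and D' = direct_sumD[OF assms(2)]
  show "csubspace (U \<times> U')" "csubspace (L \<times> L')" "csubspace (V \<times> V')"
    using D D' by (simp_all add: csubspace_Times)
  show "U \<times> U' \<subseteq> V \<times> V'" "L \<times> L' \<subseteq> V \<times> V'" using D(3,4) D'(3,4) by auto
  fix x
  show "x = 0" if "x \<in> U \<times> U'" "x \<in> L \<times> L'"
    using that D(6) D'(6) by (auto simp: zero_prod_def)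
  assume x: "x \<in> V \<times> V'"
  obtain u l where ul: "u \<in> U" "l \<in> L" "fst x = u + l" using D(7) x by (metis mem_Times_iff)
  obtain u' l' where ul': "u' \<in> U'" "l' \<in> L'" "snd x = u' + l'" using D'(7) x by (metis mem_Times_iff)
  have "x = (u, u') + (l, l')" using ul ul' by (simp add: prod_eq_iff)
  then show "\<exists>u\<in>U \<times> U'. \<exists>l\<in>L \<times> L'. x = u + l" using ul ul' by blast
qed

lemma direct_sum_zero:
  assumes "csubspace V" shows "direct_sum {0} V V" "direct_sum V {0} V"
proof -
  show "direct_sum {0} V V" using assms by (intro direct_sumI) (auto simp: complex_vector.subspace_0)
  then show "direct_sum V {0} V" by (simp add: direct_sum_commute)
qed

subsection \<open>Necessity\<close>

lemma browder_upper_triangular_necessary: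
  fixes A :: "'a::complex_banach \<Rightarrow> 'a" and B :: "'b::complex_banach \<Rightarrow> 'b"
  assumes A: "bounded_clinear A" and B: "bounded_clinear B" and C: "bounded_clinear C"
    and browder: "browder (upper_triangular A C B)"
  shows "left_semi_browder A" "right_semi_browder B"
    "sub_space (ker A) \<times>\<^sub>V sub_space (ker B) \<cong>\<^sub>V quot_space (range A) \<times>\<^sub>V quot_space (range B)"
proof -
  note lA = bounded_clinear_clinear[OF A] and lB = bounded_clinear_clinear[OF B]
    and lC = bounded_clinear_clinear[OF C]
  let ?M = "upper_triangular A C B" and ?K = "{y \<in> ker B. C y \<in> range A}"
  note lM = clinear_upper_triangular[OF lA lB lC]
  have M: "alpha ?M < \<infinity>" "alpha ?M = beta ?M" "asc ?M < \<infinity>"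
    using browder browder_iff_index[OF lM] by blast+
  have "des ?M < \<infinity>" using browder unfolding browder_def by metis
  have fin: "beta ?M < \<infinity>" using M by simp
  have aM: "alpha ?M = cdim (ker A) + cdim ?K" by (rule alpha_upper_triangular[OF lA lB lC])
  then have alpha: "alpha A < \<infinity>" and K: "cdim ?K < \<infinity>"
    using M(1) unfolding alpha_def by (cases "cdim (ker A)"; cases "cdim ?K"; simp)+
  have ccA: "closed_complemented (range A)"
    by (rule closed_complemented_range_triangular[OF A B C K fin])
  have ccB: "closed_complemented (ker B)"
    by (rule closed_complemented_ker_triangular[OF A B C K fin])
  obtain L where L: "closed (range A)" "closed L" "direct_sum (range A) L UNIV"
    using ccA unfolding closed_complemented_iff by blast
  obtain F where F: "direct_sum (range B) F UNIV" using range_complement_exists[OF lB] .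
  obtain p where p: "bounded_clinear p" "\<And>x. p x \<in> L" "\<And>x. x - p x \<in> range A" "\<And>x. x \<in> L \<Longrightarrow> p x = x"
    "\<And>x. p x = 0 \<longleftrightarrow> x \<in> range A"
    by (rule bounded_projection_closed[OF L(3,1,2)]) (rule that)
  note lp = bounded_clinear_clinear[OF p(1)]
  have bpC: "bounded_clinear (\<lambda>y. p (C y))" by (rule bounded_clinear_compose[OF p(1) C])
  let ?G = "(\<lambda>y. p (C y)) ` ker B"
  obtain E where E: "direct_sum ?G E L"
    by (rule direct_sum_exists[OF clin.linear_subspace_image[OF bounded_clinear_clinear[OF bpC] csubspace_ker[OF lB]]
          direct_sumD(2)[OF L(3)]])
      (use p(2) in auto)
  note DE = direct_sumD[OF E] and DF = direct_sumD[OF F]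
  have bM: "beta ?M = cdim (E \<times> F)"
    by (rule beta_eq_cdim[OF direct_sum_range_upper_triangular[OF lA lB lC L(3) F lp p(2-5) E]])
  then have "cdim E + cdim F < \<infinity>" using fin cdim_Times[OF DE(2) DF(2)] by simp
  then have beta: "beta B < \<infinity>" using beta_eq_cdim[OF F] by (cases "cdim E"; cases "cdim F") simp_all
  show "left_semi_browder A" unfolding left_semi_browder_def left_semi_fredholm_def
    using ccA alpha asc_upper_triangular_finite[OF lB lC M(3)] by blast
  show "right_semi_browder B" unfolding right_semi_browder_def right_semi_fredholm_def
    using ccB beta des_upper_triangular_finite[OF \<open>des ?M < \<infinity>\<close>] by blast
  \<comment> \<open>On N(A) x N(B) this operator has kernel N(A) x \<open>?K\<close>, and E x F
    complements its image in L x F. The dimensions are \<open>alpha ?M\<close> and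
    \<open>beta ?M\<close>, which agree as the index is zero.\<close>
  let ?T = "\<lambda>z::'a \<times> 'b. (p (C (snd z)), 0::'b)"
  have T: "bounded_clinear ?T"
    by (intro bounded_clinear_Pair bounded_clinear_compose[OF bpC] bounded_clinear_snd bounded_clinear_zero)
  have "?T ` (ker A \<times> ker B) = ?G \<times> {0}"
    using complex_vector.subspace_0[OF csubspace_ker[OF lA]] by force
  then have ET: "direct_sum (?T ` (ker A \<times> ker B)) (E \<times> F) (L \<times> F)"
    using direct_sum_Times[OF E direct_sum_zero(1)[OF DF(2)]] by simp
  have sP: "csubspace (ker A \<times> ker B)" by (intro csubspace_Times csubspace_ker lA lB)
  have "{z \<in> ker A \<times> ker B. ?T z = 0} = ker A \<times> ?K" using p(5) by (auto simp: zero_prod_def)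
  then have "cdim {z \<in> ker A \<times> ker B. ?T z = 0} = cdim (ker A) + cdim ?K"
    using cdim_Times[OF csubspace_ker[OF lA] csubspace_vimage_kernel[OF lC csubspace_range[OF lA] csubspace_ker[OF lB]]]
    by simp
  then have dim: "cdim {z \<in> ker A \<times> ker B. ?T z = 0} = cdim (E \<times> F)" "cdim (E \<times> F) < \<infinity>"
    using aM M bM by simp_all
  obtain S where S: "bounded_clinear S" "inj_on S (ker A \<times> ker B)" "S ` (ker A \<times> ker B) = L \<times> F"
    by (rule bijective_finite_rank_perturbation[OF T sP ET dim]) (rule that)
  show "sub_space (ker A) \<times>\<^sub>V sub_space (ker B) \<cong>\<^sub>V quot_space (range A) \<times>\<^sub>V quot_space (range B)"
    using closed_range_if_beta_finite[OF B beta F] S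
    by (intro isomorphic_quotient_spacesI[OF L(3,1,2) F _ _ csubspace_ker[OF lA] closed_ker[OF A]
          csubspace_ker[OF lB] closed_ker[OF B] S(1)])
      (auto simp: bij_betw_def)
qed

subsection \<open>Sufficiency\<close>

text \<open>On the subquotient of \<open>X \<times> Y\<close> between \<open>N(A\<^sup>i) \<times> 0\<close> and \<open>X \<times> R(B\<^sup>j)\<close> the triangular
  operator is bijective, so the kernels and co-ranges of all its powers are bounded by the
  dimensions of \<open>N(A\<^sup>i)\<close> and \<open>Y/R(B\<^sup>j)\<close>.\<close>

lemma browder_upper_triangularI:
  fixes A :: "'a::complex_banach \<Rightarrow> 'a" and B :: "'b::complex_banach \<Rightarrow> 'b"
  assumes A: "clinear A" and B: "clinear B" and C: "clinear C"
    and alpha: "alpha A < \<infinity>" and beta: "beta B < \<infinity>"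
    and i: "ker (A ^^ i) = ker (A ^^ Suc i)" and j: "range (B ^^ j) = range (B ^^ Suc j)"
    and inj: "\<And>y a u. y \<in> ker B \<inter> range (B ^^ j) \<Longrightarrow> u \<in> ker (A ^^ i) \<Longrightarrow> C y = A a + u \<Longrightarrow> y = 0"
    and surj: "\<And>x. \<exists>a. \<exists>u\<in>ker (A ^^ i). \<exists>y\<in>ker B \<inter> range (B ^^ j). x = A a + u + C y"
  shows "browder (upper_triangular A C B)"
proof -
  let ?M = "upper_triangular A C B" and ?X = "ker (A ^^ i)" and ?Y = "range (B ^^ j)"
  have M: "clinear ?M" by (rule clinear_upper_triangular[OF A B C])
  have sX: "csubspace ?X" by (rule csubspace_ker[OF clinear_funpow[OF A]])
  have sY: "csubspace ?Y" by (rule csubspace_range[OF clinear_funpow[OF B]])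
  have AX: "A u \<in> ?X \<longleftrightarrow> u \<in> ?X" for u
  proof -
    have "A u \<in> ?X \<longleftrightarrow> u \<in> ker (A ^^ Suc i)" by (simp add: ker_def funpow_swap1)
    then show ?thesis unfolding i[symmetric] .
  qed
  have BY: "B ` ?Y = ?Y"
  proof -
    have "B ` ?Y = range (B ^^ Suc j)" by auto
    then show ?thesis unfolding j[symmetric] .
  qed
  \<comment> \<open>By induction \<open>?M z\<close> lies in N(A^i) x 0. Then \<open>inj\<close>
    forces \<open>snd z = 0\<close>, and stationarity of the kernels pulls \<open>fst z\<close> back
    into N(A^i).\<close>
  have kernel: "fst z \<in> ?X \<and> snd z = 0" if "(?M ^^ k) z = 0" "snd z \<in> ?Y" for k z
    using that
  proof (induction k arbitrary: z)
    case 0 then show ?case using complex_vector.subspace_0[OF sX] by simp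
  next
    case (Suc k)
    have "(?M ^^ k) (?M z) = 0" using Suc.prems(1) by (simp add: funpow_swap1)
    moreover have Mz: "fst (?M z) = A (fst z) + C (snd z)" "snd (?M z) = B (snd z)"
      by (simp_all add: upper_triangular_def split_beta)
    moreover have "snd (?M z) \<in> ?Y" using Suc.prems(2) BY Mz(2) by auto
    ultimately have h: "A (fst z) + C (snd z) \<in> ?X" "B (snd z) = 0" using Suc.IH[of "?M z"] by simp_all
    have "C (snd z) = A (- fst z) + (A (fst z) + C (snd z))" by (simp add: clin.linear_neg[OF A])
    then have "snd z = 0" using inj[of "snd z" _ "- fst z"] h Suc.prems(2) by (simp add: ker_def)
    moreover then have "fst z \<in> ?X" using h(1) AX by (simp add: clin.linear_0[OF C])
    ultimately show ?case by simp
  qed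
  \<comment> \<open>The preimage must again have its second coordinate in R(B^j), since the
    induction applies \<open>surj\<close> to it.\<close>
  have cover: "\<exists>w. \<exists>u\<in>?X. (x, y) = (?M ^^ k) w + (u, 0) \<and> snd w \<in> ?Y" if "y \<in> ?Y" for k x y
    using that
  proof (induction k arbitrary: x y)
    case 0
    then show ?case using complex_vector.subspace_0[OF sX] by (intro exI[of _ "(x, y)"] bexI[of _ 0]) simp_all
  next
    case (Suc k)
    obtain w u where w: "u \<in> ?X" "(x, y) = (?M ^^ k) w + (u, 0)" "snd w \<in> ?Y" using Suc by blast
    obtain y' where y': "y' \<in> ?Y" "snd w = B y'" using w(3) BY by blast
    obtain a v n where a: "v \<in> ?X" "n \<in> ker B \<inter> ?Y" "fst w - C y' = A a + v + C n"
      using surj[of "fst w - C y'"] by blast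
    \<comment> \<open>\<open>y'\<close> hits \<open>snd w\<close>, and \<open>n\<close> from N(B)
      adjusts the first coordinate through \<open>C n\<close> without changing the second.\<close>
    have "w = ?M (a, y' + n) + (v, 0)"
      using a(2,3) y'(2)
      by (simp add: upper_triangular_def prod_eq_iff clin.linear_add[OF B] clin.linear_add[OF C] ker_def algebra_simps)
    then have "(?M ^^ k) w = (?M ^^ k) (?M (a, y' + n)) + (?M ^^ k) (v, 0)"
      using clin.linear_add[OF clinear_funpow[OF M]] by metis
    also have "\<dots> = (?M ^^ Suc k) (a, y' + n) + ((A ^^ k) v, 0)"
      using upper_triangular_funpow_fst[OF B C] by (simp add: funpow_swap1)
    finally have "(x, y) = (?M ^^ Suc k) (a, y' + n) + ((A ^^ k) v + u, 0)" using w(2) by simp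
    moreover have "(A ^^ k) v \<in> ?X" using a(1) by (induction k) (simp_all add: AX)
    then have "(A ^^ k) v + u \<in> ?X" by (rule complex_vector.subspace_add[OF sX _ w(1)])
    moreover have "y' + n \<in> ?Y" using complex_vector.subspace_add[OF sY y'(1)] a(2) by blast
    ultimately show ?case by (metis snd_conv)
  qed
  obtain V where V: "direct_sum ?Y V UNIV" using range_complement_exists[OF clinear_funpow[OF B]] .
  note DV = direct_sumD[OF V]
  obtain \<rho> :: "'b \<Rightarrow> 'b" where \<rho>: "clinear \<rho>" "\<And>x. \<rho> x \<in> V" "\<And>x. x - \<rho> x \<in> ?Y" "\<And>x. x \<in> V \<Longrightarrow> \<rho> x = x"
    "\<And>x. \<rho> x = 0 \<longleftrightarrow> x \<in> ?Y"
    by (rule direct_sum_projection[OF V]) (rule that)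
  have XV: "csubspace (?X \<times> V)" by (rule csubspace_Times[OF sX DV(2)])
  have dXV: "cdim (?X \<times> V) = cdim ?X + cdim V" by (rule cdim_Times[OF sX DV(2)])
  have "cdim ?X < \<infinity>" using alpha_funpow_finite[OF A alpha] unfolding alpha_def .
  moreover have "cdim V < \<infinity>" using beta_funpow_finite[OF B beta, of j] beta_eq_cdim[OF V] by simp
  ultimately obtain n where n: "cdim ?X + cdim V = enat n" by (cases "cdim ?X"; cases "cdim V") auto
  \<comment> \<open>Rank-nullity for z -> \<rho> (snd z): where it vanishes, second coordinates lie
    in R(B^j) and \<open>kernel\<close> applies; its values lie in \<open>V\<close>.\<close>
  have alpha_le: "alpha (?M ^^ k) \<le> enat n" for k
  proof -
    let ?N = "ker (?M ^^ k)"
    have sN: "csubspace ?N" by (rule csubspace_ker[OF clinear_funpow[OF M]])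
    have \<rho>s: "clinear (\<lambda>z::'a \<times> 'b. \<rho> (snd z))"
      by (rule clinearI) (simp_all add: clin.linear_add[OF \<rho>(1)] clin.linear_scale[OF \<rho>(1)])
    have "{z \<in> ?N. \<rho> (snd z) = 0} \<subseteq> ?X \<times> {0}"
    proof
      fix z assume "z \<in> {z \<in> ?N. \<rho> (snd z) = 0}"
      then have "(?M ^^ k) z = 0" "snd z \<in> ?Y" using \<rho>(5) by (simp_all add: ker_def)
      then have "fst z \<in> ?X \<and> snd z = 0" by (rule kernel)
      then show "z \<in> ?X \<times> {0}" by (simp add: mem_Times_iff)
    qed
    moreover have "csubspace {z \<in> ?N. \<rho> (snd z) \<in> {0}}"
      by (rule csubspace_vimage_kernel[OF \<rho>s _ sN]) simp
    moreover have "csubspace (?X \<times> {0 :: 'b})" by (rule csubspace_Times[OF sX]) simp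
    ultimately have "cdim {z \<in> ?N. \<rho> (snd z) = 0} \<le> cdim (?X \<times> {0 :: 'b})"
      by (intro cdim_mono) simp_all
    also have "\<dots> = cdim ?X" using cdim_Times[OF sX, of "{0 :: 'b}"] by simp
    finally have "cdim {z \<in> ?N. \<rho> (snd z) = 0} \<le> cdim ?X" .
    moreover have "cdim ((\<lambda>z. \<rho> (snd z)) ` ?N) \<le> cdim V"
      by (intro cdim_mono clin.linear_subspace_image[OF \<rho>s sN] DV(2)) (use \<rho>(2) in blast)
    ultimately have "cdim ?N \<le> cdim ?X + cdim V" using cdim_rank_nullity[OF \<rho>s sN] by (simp add: add_mono)
    then show ?thesis using n by (simp add: alpha_def)
  qed
  have beta_le: "beta (?M ^^ k) \<le> enat n" for k
  proof -
    have "\<exists>w\<in>?X \<times> V. z - w \<in> range (?M ^^ k)" for z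
    proof -
      obtain w u where w: "u \<in> ?X" "(fst z, snd z - \<rho> (snd z)) = (?M ^^ k) w + (u, 0)"
        using cover[OF \<rho>(3)[of "snd z"], of "fst z" k] by blast
      have "z - (u, \<rho> (snd z)) = (fst z, snd z - \<rho> (snd z)) - (u, 0)" by (simp add: prod_eq_iff)
      also have "\<dots> = (?M ^^ k) w" using w(2) by simp
      finally show ?thesis using w(1) \<rho>(2) by blast
    qed
    then have "beta (?M ^^ k) \<le> cdim (?X \<times> V)" by (rule beta_le_cdim[OF clinear_funpow[OF M] XV])
    then show ?thesis using dXV n by simp
  qed
  have "alpha ?M < \<infinity>" "beta ?M < \<infinity>"
    using le_less_trans[OF alpha_le[of 1], of \<infinity>] le_less_trans[OF beta_le[of 1], of \<infinity>] by simp_all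
  then show ?thesis
    by (rule browderI[OF M _ _ asc_finite_if_bounded[OF M alpha_le] des_finite_if_bounded[OF M beta_le]])
qed

lemma browder_upper_triangular_sufficient:
  fixes A :: "'a::complex_banach \<Rightarrow> 'a" and B :: "'b::complex_banach \<Rightarrow> 'b"
  assumes A: "bounded_clinear A" and B: "bounded_clinear B"
    and "left_semi_browder A" "right_semi_browder B"
    and iso: "sub_space (ker A) \<times>\<^sub>V sub_space (ker B) \<cong>\<^sub>V quot_space (range A) \<times>\<^sub>V quot_space (range B)"
  obtains C where "bounded_clinear C" "browder (upper_triangular A C B)"
proof -
  note lA = bounded_clinear_clinear[OF A] and lB = bounded_clinear_clinear[OF B]
  have ccA: "closed_complemented (range A)" and alpha: "alpha A < \<infinity>" and asc: "asc A < \<infinity>"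
    using assms(3) unfolding left_semi_browder_def left_semi_fredholm_def by blast+
  have ccB: "closed_complemented (ker B)" and beta: "beta B < \<infinity>" and des: "des B < \<infinity>"
    using assms(4) unfolding right_semi_browder_def right_semi_fredholm_def by blast+
  obtain i where i: "ker (A ^^ i) = ker (A ^^ Suc i)" using asc asc_finite_iff by blast
  obtain j where j: "range (B ^^ j) = range (B ^^ Suc j)" using des des_finite_iff by blast
  let ?X = "ker (A ^^ i)" and ?Y = "range (B ^^ j)"
  have sX: "csubspace ?X" by (rule csubspace_ker[OF clinear_funpow[OF lA]])
  have sY: "csubspace ?Y" by (rule csubspace_range[OF clinear_funpow[OF lB]])
  have AX: "A u \<in> ?X \<longleftrightarrow> u \<in> ?X" for u
  proof -
    have "A u \<in> ?X \<longleftrightarrow> u \<in> ker (A ^^ Suc i)" by (simp add: ker_def funpow_swap1)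
    then show ?thesis unfolding i[symmetric] .
  qed
  have kerA: "ker A \<subseteq> ?X"
  proof
    fix x assume "x \<in> ker A"
    then have "A x \<in> ?X" using complex_vector.subspace_0[OF sX] by (simp add: ker_def)
    then show "x \<in> ?X" using AX by blast
  qed
  have BY: "B ` ?Y = ?Y"
  proof -
    have "B ` ?Y = range (B ^^ Suc j)" by auto
    then show ?thesis unfolding j[symmetric] .
  qed
  have rangeB: "?Y \<subseteq> range B" using BY by blast
  obtain L where L: "closed (range A)" "closed L" "direct_sum (range A) L UNIV"
    using ccA unfolding closed_complemented_iff by blast
  note DL = direct_sumD[OF L(3)]
  obtain F where F: "direct_sum (range B) F UNIV" using range_complement_exists[OF lB] .
  note DF = direct_sumD[OF F]
  obtain R where R: "closed (ker B)" "closed R" "direct_sum R (ker B) UNIV"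
    using ccB unfolding closed_complemented_iff by (metis direct_sum_commute)
  obtain p where p: "bounded_clinear p" "\<And>x. p x \<in> L" "\<And>x. x - p x \<in> range A" "\<And>x. x \<in> L \<Longrightarrow> p x = x"
    "\<And>x. p x = 0 \<longleftrightarrow> x \<in> range A"
    by (rule bounded_projection_closed[OF L(3,1,2)]) (rule that)
  note lp = bounded_clinear_clinear[OF p(1)]
  obtain Q where Q: "bounded_clinear Q" "\<And>x. Q x \<in> ker B" "\<And>x. x \<in> ker B \<Longrightarrow> Q x = x"
    by (rule bounded_projection_closed[OF R(3,2,1)]) (rule that)
  obtain P where P: "bounded_clinear P" "\<And>x. P x \<in> ker A" "\<And>x. x \<in> ker A \<Longrightarrow> P x = x"
    by (rule finite_dimensional_projection[OF csubspace_ker[OF lA] alpha[unfolded alpha_def]]) (rule that)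
  \<comment> \<open>The isomorphism as a bounded operator on the whole product; \<open>C\<close> is
    obtained from it by removing finite-dimensional pieces.\<close>
  obtain \<Phi> where \<Phi>: "bounded_clinear \<Phi>" "bij_betw \<Phi> (ker A \<times> ker B) (L \<times> F)"
    by (rule isomorphic_quotient_spacesE[OF L(3,1,2) F closed_range_if_beta_finite[OF B beta F]
          csubspace_ker[OF lA] closed_ker[OF A] csubspace_ker[OF lB] closed_ker[OF B] iso P Q])
      (assumption | rule that)+

  \<comment> \<open>The image of N(A^i) in the model \<open>L\<close> of X/R(A). A complement
    \<open>L1\<close> of it in \<open>L\<close> is therefore a complement of R(A) + N(A^i).\<close>
  let ?H = "p ` ?X"
  have sH: "csubspace ?H" by (rule clin.linear_subspace_image[OF lp sX])
  have dX: "cdim ?X < \<infinity>" using alpha_funpow_finite[OF lA alpha, of i] unfolding alpha_def .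
  \<comment> \<open>Stationarity gives N(A^i) \<inter> R(A) = A(N(A^i)). Rank-nullity for
    \<open>p\<close> and for \<open>A\<close> on the same finite-dimensional space then yields the
    equality.\<close>
  have H: "cdim ?H = alpha A"
  proof -
    have "{x \<in> ?X. p x = 0} = A ` ?X" using p(5) AX by (auto simp: image_iff)
    then have "cdim ?X = cdim (A ` ?X) + cdim ?H" using cdim_rank_nullity[OF lp sX] by simp
    moreover have "{x \<in> ?X. A x = 0} = ker A" using kerA by (auto simp: ker_def)
    then have "cdim ?X = alpha A + cdim (A ` ?X)" using cdim_rank_nullity[OF lA sX] by (simp add: alpha_def)
    ultimately show ?thesis using dX by (cases "cdim (A ` ?X)"; cases "cdim ?H"; cases "alpha A") auto
  qed
  obtain L1 PH where L1: "direct_sum ?H L1 L" "closed L1" "bounded_clinear PH"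
    "\<And>x. x \<in> ?H \<Longrightarrow> PH x = x" "\<And>x. x \<in> L1 \<Longrightarrow> PH x = 0"
    by (rule closed_complement_exists[OF sH _ DL(2) L(2)]) (use H alpha p(2) that in auto)
  note DL1 = direct_sumD[OF L1(1)]

  let ?N = "ker B \<inter> ?Y"
  have sN: "csubspace ?N" using csubspace_ker[OF lB] sY by (rule complex_vector.subspace_inter)
  obtain G where G: "direct_sum ?N G (ker B)"
    by (rule direct_sum_exists[OF sN csubspace_ker[OF lB]]) auto
  note DG = direct_sumD[OF G]
  \<comment> \<open>The operator induced by \<open>B\<close> on Y/R(B^j) is modelled as v -> \<rho>
    (B v) on \<open>V\<close>. Its kernel is a copy of \<open>G\<close>, its co-range a copy of
    Y/R(B), that is of \<open>F\<close>; on a finite-dimensional space these dimensions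
    agree.\<close>
  have dG: "cdim G = cdim F"
  proof -
    obtain V where V: "direct_sum ?Y V UNIV" using range_complement_exists[OF clinear_funpow[OF lB]] .
    note DV = direct_sumD[OF V]
    obtain \<rho> :: "'b \<Rightarrow> 'b" where \<rho>: "clinear \<rho>" "\<And>x. \<rho> x \<in> V" "\<And>x. x - \<rho> x \<in> ?Y" "\<And>x. x \<in> V \<Longrightarrow> \<rho> x = x"
      "\<And>x. \<rho> x = 0 \<longleftrightarrow> x \<in> ?Y"
      by (rule direct_sum_projection[OF V]) (rule that)
    obtain E where E: "direct_sum ?Y E (range B)"
      by (rule direct_sum_exists[OF sY csubspace_range[OF lB] rangeB])
    have \<rho>B: "clinear (\<lambda>v. \<rho> (B v))"
      using Vector_Spaces.linear_compose[OF lB \<rho>(1)] by (simp add: o_def)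
    have 1: "cdim V = cdim E + cdim F" by (rule cdim_complement_chain[OF E F V])
    have "{v \<in> V. \<rho> (B v) = 0} = \<rho> ` ker B"
    proof (intro equalityI subsetI)
      fix v assume "v \<in> {v \<in> V. \<rho> (B v) = 0}"
      then have v: "v \<in> V" "B v \<in> ?Y" using \<rho>(5) by auto
      then obtain y where y: "y \<in> ?Y" "B v = B y" using BY by blast
      have "v - y \<in> ker B" using y(2) clin.linear_diff[OF lB, of v y] by (simp add: ker_def)
      moreover have "v = \<rho> (v - y)"
        using \<rho>(4)[OF v(1)] \<rho>(5)[of y] y(1) clin.linear_diff[OF \<rho>(1), of v y] by simp
      ultimately show "v \<in> \<rho> ` ker B" by blast
    next
      fix v assume "v \<in> \<rho> ` ker B"
      then obtain n where n: "B n = 0" "v = \<rho> n" by (auto simp: ker_def)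
      have "B (n - v) \<in> ?Y" using \<rho>(3)[of n] n(2) BY by blast
      then have "- B (n - v) \<in> ?Y" by (rule complex_vector.subspace_neg[OF sY])
      moreover have "- B (n - v) = B v" using n(1) clin.linear_diff[OF lB, of n v] by simp
      ultimately have "\<rho> (B v) = 0" using \<rho>(5) by simp
      then show "v \<in> {v \<in> V. \<rho> (B v) = 0}" using \<rho>(2) n(2) by simp
    qed
    moreover have "cdim (\<rho> ` ker B) = cdim G"
      by (rule image_projection_eq(3)[OF G \<rho>(1)]) (simp add: \<rho>(5))
    moreover have "(\<lambda>v. \<rho> (B v)) ` V = \<rho> ` range B"
    proof (intro equalityI subsetI)
      fix z assume "z \<in> \<rho> ` range B"
      then obtain y where y: "z = \<rho> (B y)" by blast
      have "B (y - \<rho> y) \<in> ?Y" using \<rho>(3)[of y] BY by blast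
      then have "\<rho> (B y - B (\<rho> y)) = 0" using \<rho>(5) clin.linear_diff[OF lB, of y "\<rho> y"] by simp
      then have "z = \<rho> (B (\<rho> y))" using y clin.linear_diff[OF \<rho>(1), of "B y" "B (\<rho> y)"] by simp
      then show "z \<in> (\<lambda>v. \<rho> (B v)) ` V" using \<rho>(2) by blast
    qed blast
    moreover have "cdim (\<rho> ` range B) = cdim E"
      by (rule image_projection_eq(3)[OF E \<rho>(1)]) (simp add: \<rho>(5))
    ultimately have "cdim V = cdim G + cdim E" using cdim_rank_nullity[OF \<rho>B DV(2)] by simp
    moreover have "cdim V < \<infinity>" using beta_funpow_finite[OF lB beta, of j] beta_eq_cdim[OF V] by simp
    ultimately show ?thesis using 1 by (cases "cdim G"; cases "cdim E"; cases "cdim F") auto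
  qed

  \<comment> \<open>The cancelled pieces are N(A) x G and \<open>?H\<close> x F, both of dimension
    \<open>alpha A + beta B\<close>. What remains is N(B) \<inter> R(B^j) against
    \<open>L1\<close>.\<close>
  have sum1: "direct_sum ({0} \<times> ?N) (ker A \<times> G) (ker A \<times> ker B)"
    by (rule direct_sum_Times[OF direct_sum_zero(1)[OF csubspace_ker[OF lA]] G])
  have sum2: "direct_sum (L1 \<times> {0}) (?H \<times> F) (L \<times> F)"
    using direct_sum_Times[OF L1(1)[unfolded direct_sum_commute[of ?H]] direct_sum_zero(1)[OF DF(2)]] .
  have dims: "cdim (ker A \<times> G) = cdim (?H \<times> F)" "cdim (?H \<times> F) < \<infinity>"
  proof -
    have "cdim (ker A \<times> G) = alpha A + cdim F"
      using cdim_Times[OF csubspace_ker[OF lA] DG(2)] dG by (simp add: alpha_def)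
    moreover have *: "cdim (?H \<times> F) = alpha A + cdim F" using cdim_Times[OF sH DF(2)] H by simp
    ultimately show "cdim (ker A \<times> G) = cdim (?H \<times> F)" by simp
    show "cdim (?H \<times> F) < \<infinity>"
      using * alpha beta beta_eq_cdim[OF F] by (cases "alpha A"; cases "cdim F") auto
  qed
  \<comment> \<open>On L x F this is the projection onto L1 x 0 along \<open>?H\<close> x F;
    composing with \<open>p\<close> defines it on the whole space.\<close>
  let ?\<pi> = "\<lambda>z::'a \<times> 'b. (p (fst z) - PH (p (fst z)), 0::'b)"
  have bpf: "bounded_clinear (\<lambda>z::'a \<times> 'b. p (fst z))"
    by (rule bounded_clinear_compose[OF p(1) bounded_clinear_fst])
  have \<pi>: "bounded_clinear ?\<pi>"
    by (intro bounded_clinear_Pair bounded_clinear_diff bounded_clinear_compose[OF L1(3)] bpf bounded_clinear_zero)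
  have pL: "p x = x" if "x \<in> L" for x using p(4) that .
  have \<pi>1: "?\<pi> q = q" if "q \<in> L1 \<times> {0}" for q
    using that L1(5) DL1(4) pL by auto
  have \<pi>2: "?\<pi> h = 0" if h: "h \<in> ?H \<times> F" for h
  proof -
    have "fst h \<in> ?H" using h by auto
    moreover then have "p (fst h) = fst h" using pL p(2) by auto
    ultimately show ?thesis using L1(4) by (simp add: zero_prod_def)
  qed
  obtain S :: "'a \<times> 'b \<Rightarrow> 'a \<times> 'b" where S: "bounded_clinear S" "inj_on S ({0} \<times> ?N)" "S ` ({0} \<times> ?N) = L1 \<times> {0}"
    by (rule finite_codimension_cancellation[OF \<Phi> sum1 sum2 dims \<pi> \<pi>1 \<pi>2])
      (assumption | rule that)+
  note lS = bounded_clinear_clinear[OF S(1)]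
  define C where "C y = fst (S (0, y))" for y
  have C: "bounded_clinear C" unfolding C_def
    by (intro bounded_clinear_compose[OF bounded_clinear_fst] bounded_clinear_compose[OF S(1)]
        bounded_clinear_Pair bounded_clinear_zero bounded_clinear_ident)
  have SC: "S (0, y) = (C y, 0)" "C y \<in> L1" if "y \<in> ?N" for y
  proof -
    have "S (0, y) \<in> L1 \<times> {0}" using S(3) that by blast
    then show "S (0, y) = (C y, 0)" "C y \<in> L1" unfolding C_def by (auto simp: prod_eq_iff mem_Times_iff)
  qed
  show thesis
  proof (rule that[OF C], rule browder_upper_triangularI[OF lA lB bounded_clinear_clinear[OF C] alpha beta i j])
    fix y a u assume y: "y \<in> ?N" and u: "u \<in> ?X" and eq: "C y = A a + u"
    have "C y = p (C y)" using SC(2)[OF y] DL1(4) pL by auto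
    also have "\<dots> = p (A a) + p u" unfolding eq by (rule clin.linear_add[OF lp])
    also have "\<dots> = p u" using p(5) by simp
    finally have "C y \<in> ?H" using u by blast
    then have "C y = 0" using DL1(6) SC(2)[OF y] by blast
    then have "S (0, y) = S (0, 0)" using SC(1)[OF y] clin.linear_0[OF lS] by (simp add: zero_prod_def)
    moreover have "0 \<in> ?N" by (rule complex_vector.subspace_0[OF sN])
    ultimately show "y = 0" using inj_onD[OF S(2)] y by blast
  next
    fix x
    \<comment> \<open>The part \<open>h\<close> of \<open>p x\<close> is lifted to N(A^i), the part
      \<open>l\<close> through \<open>S\<close> to N(B) \<inter> R(B^j); the rest of
      \<open>x\<close> lies in R(A).\<close>
    obtain h l where hl: "h \<in> ?H" "l \<in> L1" "p x = h + l" using DL1(7) p(2) by blast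
    obtain u where u: "u \<in> ?X" "h = p u" using hl(1) by blast
    have "(l, 0) \<in> S ` ({0} \<times> ?N)" using S(3) hl(2) by simp
    then obtain y where y: "y \<in> ?N" "S (0, y) = (l, 0)" by force
    have "(x - p x) - (u - p u) \<in> range A" by (rule complex_vector.subspace_diff[OF DL(1) p(3) p(3)])
    then obtain a where a: "A a = (x - p x) - (u - p u)" by (metis rangeE)
    have "x = A a + u + C y" using a hl(3) u(2) y(2) by (simp add: C_def)
    then show "\<exists>a. \<exists>u\<in>?X. \<exists>y\<in>?N. x = A a + u + C y" using u(1) y(1) by blast
  qed
qed

section \<open>Passage from a single operator to the spectra\<close>

lemma shift_upper_triangular:
  "shift (upper_triangular A C B) \<mu> = upper_triangular (shift A \<mu>) C (shift B \<mu>)"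
  by (auto simp: shift_def upper_triangular_def fun_eq_iff)

lemma bounded_clinear_shift: "bounded_clinear T \<Longrightarrow> bounded_clinear (shift T \<mu>)"
  unfolding shift_def by (intro bounded_clinear_diff bounded_clinear_scaleC)

theorem corollary2p10:
  fixes A :: "'a::complex_banach \<Rightarrow> 'a" and B :: "'b::complex_banach \<Rightarrow> 'b"
  assumes "vdim (sub_space (UNIV :: 'a set)) = \<infinity>"
    and "vdim (sub_space (UNIV :: 'b set)) = \<infinity>"
    and "bounded_clinear A" and "bounded_clinear B"
  shows "(\<Inter>C\<in>{C :: 'b \<Rightarrow> 'a. bounded_clinear C}. browder_spectrum (upper_triangular A C B)) =
    left_semi_browder_spectrum A \<union> right_semi_browder_spectrum B \<union>
    {\<mu>. \<not> sub_space (ker (shift A \<mu>)) \<times>\<^sub>V sub_space (ker (shift B \<mu>)) \<cong>\<^sub>V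
          quot_space (range (shift A \<mu>)) \<times>\<^sub>V quot_space (range (shift B \<mu>))}"
proof -
  \<comment> \<open>Taking complements turns the intersection over \<open>C\<close> into the
    existence of some \<open>C\<close> for each fixed \<mu>; this \<open>C\<close> may depend on
    \<mu>.\<close>
  have "(\<exists>C :: 'b \<Rightarrow> 'a. bounded_clinear C \<and> browder (shift (upper_triangular A C B) \<mu>)) \<longleftrightarrow>
      left_semi_browder (shift A \<mu>) \<and> right_semi_browder (shift B \<mu>) \<and>
      sub_space (ker (shift A \<mu>)) \<times>\<^sub>V sub_space (ker (shift B \<mu>)) \<cong>\<^sub>V
        quot_space (range (shift A \<mu>)) \<times>\<^sub>V quot_space (range (shift B \<mu>))" for \<mu>
    unfolding shift_upper_triangular
    using browder_upper_triangular_necessary[OF assms(3,4)[THEN bounded_clinear_shift]]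
      browder_upper_triangular_sufficient[OF assms(3,4)[THEN bounded_clinear_shift]]
    by metis
  then show ?thesis
    unfolding browder_spectrum_def left_semi_browder_spectrum_def right_semi_browder_spectrum_def
    by auto
qed

end
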